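(* Let $K$ be a positive integer and $\gamma_j$, $0\le j\le K$, real numbers with $\gamma_0=1$, $\gamma_K\ne0$. Set $$P(x)=\sum_{j=0}^K\gamma_jx^{K-j},\qquad q_n(x)=\sum_{j=0}^K\gamma_j\,L^\alpha_{n-j}(x),\quad n\ge K,$$ and assume that $P(z)\neq0$ for every $z\in\mathbb C\setminus\mathbb R$ with $|z|\le1$. Denote by $N^{\mathrm{nr}}$ the number of non-real zeros of $P$ and by $N^1$ the number of real zeros of $P$ greater than $1$. Then for every real $\alpha\ge K-N^{\mathrm{nr}}-1$: (1) If $N^{\mathrm{nr}}=0$, then $q_n$ has $n$ real and simple zeros for $n\ge K$, and the zeros of $q_{n+1}$ interlace the zeros of $q_n$. If $N^1=0$ then all the zeros are positive. If $N^1>0$ then for $n$ big enough $q_n$ has exactly $N^1$ negative zeros. (2) Otherwise, for $n$ big enough $q_n$ has exactly $n-N^{\mathrm{nr}}$ real and simple zeros, of which $N^1$ are negative, and the real zeros of $q_{n+1}$ interlace the real zeros of $q_n$.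
   Context: $L_n^\alpha(x)=\sum_{j=0}^n\binom{n+\alpha}{n-j}\frac{(-x)^j}{j!}$ is the Laguerre polynomial. Zeros of $P$ are counted with multiplicity. Interlacing: given two finite sets $U,V$ of real numbers ordered by size, $U$ strictly interlaces $V$ if $\min U<\min V$ and between any two consecutive elements of any of the two sets there exists one element of the other. If $U\cap V=W\ne\emptyset$, then $U$ interlaces $V$ if $U\setminus W$ strictly interlaces $V\setminus W$; if $U\cap V=\emptyset$, $U$ interlaces $V$ means that it strictly interlaces $V$.
   Formalization: In (1) with N^1=0, "all the zeros are positive" is false if α=K-1 and P=(x-1)^K (then q_n(0)=0); there it is proved only that zeros are positive or 0. In interlacing, the minimum of an empty set is read as +∞. *)

theory Defs
  imports Complex_Main "HOL-Computational_Algebra.Polynomial"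
begin

definition laguerre :: "real \<Rightarrow> nat \<Rightarrow> real poly" where
  "laguerre \<alpha> n =
     (\<Sum>j\<le>n. monom (((real n + \<alpha>) gchoose (n - j)) * (- 1) ^ j / fact j) j)"

definition num_nonreal_zeros :: "real poly \<Rightarrow> nat" where
  "num_nonreal_zeros p =
     size (filter_mset (\<lambda>z. z \<notin> \<real>) (proots (map_poly complex_of_real p)))"

definition num_zeros_gt_one :: "real poly \<Rightarrow> nat" where
  "num_zeros_gt_one p = size (filter_mset (\<lambda>x. x > 1) (proots p))"

definition real_zeros :: "real poly \<Rightarrow> real set" where
  "real_zeros p = {x. poly p x = 0}"

text \<open>Exactly \<open>m\<close> real zeros, each of multiplicity one; non-real zeros are not constrained.\<close>

definition has_simple_real_zeros :: "real poly \<Rightarrow> nat \<Rightarrow> bool" where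
  "has_simple_real_zeros p m \<longleftrightarrow>
     p \<noteq> 0 \<and> card (real_zeros p) = m \<and> (\<forall>x\<in>real_zeros p. order x p = 1)"

definition consecutive_in :: "real set \<Rightarrow> real \<Rightarrow> real \<Rightarrow> bool" where
  "consecutive_in S a b \<longleftrightarrow> a \<in> S \<and> b \<in> S \<and> a < b \<and> \<not> (\<exists>c\<in>S. a < c \<and> c < b)"

text \<open>
  The minimum of the empty set is read as infinity. This matters only when the common
  elements exhaust \<open>V\<close>, as for the zeros \<open>{0, 2}\<close> and \<open>{0}\<close> of the Laguerre polynomials
  of degrees 2 and 1 with \<open>\<alpha> = -1\<close>.
\<close>

definition strictly_interlaces :: "real set \<Rightarrow> real set \<Rightarrow> bool" where
  "strictly_interlaces U V \<longleftrightarrow>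
     finite U \<and> finite V \<and>
     U \<noteq> {} \<and> (V \<noteq> {} \<longrightarrow> Min U < Min V) \<and>
     (\<forall>a b. consecutive_in U a b \<longrightarrow> (\<exists>v\<in>V. a < v \<and> v < b)) \<and>
     (\<forall>a b. consecutive_in V a b \<longrightarrow> (\<exists>u\<in>U. a < u \<and> u < b))"

definition interlaces :: "real set \<Rightarrow> real set \<Rightarrow> bool" where
  "interlaces U V \<longleftrightarrow> strictly_interlaces (U - U \<inter> V) (V - U \<inter> V)"

end

theory Submission
  imports Defs "HOL-Complex_Analysis.Residue_Theorem" "HOL-Real_Asymp.Real_Asymp"
    "HOL-Computational_Algebra.Fundamental_Theorem_Algebra"
begin

text \<open>
  Write \<open>L(n, a)\<close> for the Laguerre polynomial of degree \<open>n\<close> and parameter \<open>a\<close>, \<open>D\<close> for the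
  derivative, \<open>m\<close> for the number of non-real zeros of \<open>P\<close>, and let the linear map
  \<open>laguerre_lift s a\<close> send \<open>x ^ i\<close> to \<open>L(s + i, a)\<close>. Then \<open>q n\<close> is the image of \<open>P\<close> for
  \<open>s = n - K\<close>, and \<open>q (n + 1) + b q n\<close> is the image of \<open>(x + b) P\<close>. So everything reduces to
  counting zeros of such images.

  \<^emph>\<open>At least \<open>n - m\<close> real zeros.\<close> The relations \<open>L(n + 1, a) - L(n, a) = L(n + 1, a - 1)\<close> and
  \<open>D L(n + 1, a) = - L(n, a + 1)\<close> turn a factor \<open>x - r\<close> of the argument into the operator
  \<open>1 - (1 - r) D\<close>, at the price of lowering the parameter by one
  (\<open>laguerre_lift_linear_factor\<close>). By Rolle's theorem for \<open>exp (- x / c) p\<close> the operator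
  \<open>1 - c D\<close> never decreases the number of distinct real zeros; it keeps the number of zeros in
  \<open>[0, \<infinity>)\<close> if \<open>c \<ge> 0\<close> and loses at most one of them if \<open>c < 0\<close>, that is, if \<open>r > 1\<close>. Splitting
  off all the \<open>K - m\<close> real zeros of \<open>P\<close> leaves the parameter \<open>\<alpha> - (K - m) \<ge> -1\<close>, which is where
  the hypothesis on \<open>\<alpha>\<close> comes from. For such parameters a lift with shift \<open>s\<close> has at least \<open>s\<close>
  distinct zeros in \<open>[0, \<infinity>)\<close> (\<open>zeros_in_laguerre_lift\<close>): it is obtained by \<open>s\<close> steps
  \<open>p \<mapsto> x p' + (a + 1 - x) p\<close>, each of which differentiates \<open>x ^ (a + 1) exp (- x) p\<close>, a function
  that vanishes at both ends of the half-line.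

  \<^emph>\<open>At most \<open>n - m\<close> real zeros for large \<open>n\<close>.\<close> With \<open>phi z = 2 - z - 1 / z\<close>, the quotients
  \<open>L(N - j, a) / L(N, a)\<close> at the point \<open>N phi z\<close> converge to \<open>z ^ (- j)\<close> for \<open>|z| > 1\<close> off the
  preimage of \<open>[0, \<infinity>)\<close> (\<open>laguerre_power_limit\<close>). Hence \<open>q N\<close>, rescaled, converges
  to \<open>z ^ (- K) P z\<close>, and by Rouche's theorem each zero \<open>w\<close> of \<open>P\<close> that is non-real or a real
  number \<open>> 1\<close> attracts as many zeros of \<open>q N\<close> to \<open>N phi w\<close> as its multiplicity. The assumption
  that \<open>P\<close> has no non-real zero in the closed unit disc makes all of the \<open>m\<close> non-real zeros visible
  in this way. The zeros near \<open>N phi w\<close> are non-real if \<open>w\<close> is, and outside \<open>[0, \<infinity>)\<close> in any case.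
  Together with the lower bounds this fixes the numbers of real and of negative zeros, and forces
  the real zeros to be simple. If \<open>m = 0\<close> the lower bound alone suffices, for every \<open>n \<ge> K\<close>.

  \<^emph>\<open>Interlacing.\<close> The same two estimates hold uniformly for the pencil \<open>q (n + 1) + b q n\<close>: each
  member has at least \<open>n - m\<close> distinct real zeros and at most \<open>n + 1 - m\<close> real zeros with
  multiplicity. If \<open>q (n + 1)\<close> and \<open>q n\<close> did not interlace, Rolle's theorem for their quotient would
  yield a member with a double zero. The counts make all its other real zeros simple, so that a
  small change of \<open>b\<close> in the right direction removes the double zero and creates no other, leaving
  fewer than \<open>n - m\<close> distinct real zeros (\<open>pencil_no_double_zero\<close>).
\<close>

section \<open>Relations between Laguerre polynomials\<close>

lemma pderiv_sum: "pderiv (\<Sum>i\<in>I. f i) = (\<Sum>i\<in>I. pderiv (f i))"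
  by (induction I rule: infinite_finite_induct) (auto simp: pderiv_add)

lemma coeff_laguerre:
  "coeff (laguerre a n) j =
     (if j \<le> n then ((real n + a) gchoose (n - j)) * (- 1) ^ j / fact j else 0)"
  by (auto simp: laguerre_def coeff_sum)

lemma degree_laguerre: "degree (laguerre a n) = n"
  by (rule antisym) (auto intro!: degree_le le_degree simp: coeff_laguerre)

lemma laguerre_neq_0: "laguerre a n \<noteq> 0"
proof -
  have "coeff (laguerre a n) n \<noteq> 0" by (simp add: coeff_laguerre)
  then show ?thesis by auto
qed

lemma laguerre_0: "laguerre a 0 = 1"
  by (simp add: laguerre_def)

text \<open>
  Pascal's rule. The left-hand side is the coefficient form of multiplying the generating function
  \<open>(1 - t) powr (- a - 1) * exp (- x t / (1 - t))\<close> by \<open>1 - t\<close>.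
\<close>
lemma laguerre_Suc_diff: "laguerre a (Suc n) - laguerre a n = laguerre (a - 1) (Suc n)"
proof (rule poly_eqI)
  fix j
  have "(real n + a + 1) gchoose Suc k = ((real n + a) gchoose k) + ((real n + a) gchoose Suc k)" for k
    by (rule gbinomial_Suc_Suc)
  from this [of "n - j"]
  have "((real (Suc n) + a) gchoose Suc (n - j)) - ((real n + a) gchoose (n - j)) = ((real n + a) gchoose Suc (n - j))"
    by (simp add: add_ac)
  moreover have "j \<le> n \<Longrightarrow> Suc n - j = Suc (n - j)" by simp
  ultimately show "coeff (laguerre a (Suc n) - laguerre a n) j = coeff (laguerre (a - 1) (Suc n)) j"
    by (auto simp: coeff_laguerre not_le le_Suc_eq algebra_simps add_divide_distrib)
qed

lemma Suc_times_div_fact_Suc: "real (Suc n) * (x / fact (Suc n)) = x / fact n"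
  by (simp del: of_nat_Suc)

lemma pderiv_laguerre_Suc: "pderiv (laguerre a (Suc n)) = - laguerre (a + 1) n"
proof (rule poly_eqI)
  fix j
  show "coeff (pderiv (laguerre a (Suc n))) j = coeff (- laguerre (a + 1) n) j"
    using Suc_times_div_fact_Suc[of j "(real (Suc n) + a gchoose n - j) * (- 1) ^ Suc j"]
    by (auto simp: coeff_laguerre coeff_pderiv of_nat_Suc[of n] add_ac simp del: of_nat_Suc fact_Suc)
qed

text \<open>
  A step of Rodrigues' formula in polynomial form: up to the factor \<open>x powr a * exp (- x)\<close>, the
  left-hand side is the derivative of the product of \<open>x powr (a + 1) * exp (- x)\<close> and
  \<open>laguerre (a + 1) n\<close>. This makes Rolle's theorem applicable.
\<close>
lemma laguerre_raise:
  "[:0, 1:] * pderiv (laguerre (a + 1) n) + [:a + 1, -1:] * laguerre (a + 1) n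
     = smult (real (Suc n)) (laguerre a (Suc n))"
proof (rule poly_eqI)
  fix j
  let ?b = "real n + a + 1"
  have g: "real (Suc k) * (?b gchoose Suc k) = (?b - real k) * (?b gchoose k)" for k
    using gbinomial_mult_1[of ?b k] by (simp add: algebra_simps)
  show "coeff ([:0, 1:] * pderiv (laguerre (a + 1) n) + [:a + 1, -1:] * laguerre (a + 1) n) j
     = coeff (smult (real (Suc n)) (laguerre a (Suc n))) j"
  proof (cases j)
    case 0
    then show ?thesis
      using g[of n] by (simp add: coeff_laguerre coeff_pderiv add_ac)
  next
    case (Suc i)
    show ?thesis
    proof (cases "Suc i \<le> n")
      case True
      then have e: "n - i = Suc (n - Suc i)" by simp
      define k where "k = n - Suc i"
      define u where "u = (- 1 :: real) ^ i / fact (Suc i)"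
      have gg: "real (Suc k) * (?b gchoose Suc k) = (?b - real k) * (?b gchoose k)" by (rule g)
      have n: "real n = real k + real i + 1" using True by (simp add: k_def of_nat_diff)
      have f: "(- 1 :: real) ^ i / fact i = real (Suc i) * u"
        unfolding u_def by (rule Suc_times_div_fact_Suc[symmetric])
      have 1: "coeff (laguerre (a + 1) n) (Suc i) = - (?b gchoose k) * u"
        using True by (simp add: coeff_laguerre k_def u_def add_ac)
      have 2: "coeff (laguerre (a + 1) n) i = (?b gchoose Suc k) * (real (Suc i) * u)"
        using True e f by (simp add: coeff_laguerre k_def add_ac flip: times_divide_eq_right)
      have 3: "coeff (laguerre a (Suc n)) (Suc i) = - (?b gchoose Suc k) * u"
        using True e by (simp add: coeff_laguerre k_def u_def add_ac)
      have "real (Suc i) * (- (?b gchoose k) * u) + (a + 1) * (- (?b gchoose k) * u)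
             - (?b gchoose Suc k) * (real (Suc i) * u) = real (Suc n) * (- (?b gchoose Suc k) * u)"
        using arg_cong[OF gg, of "\<lambda>x. x * u"] n by (simp add: algebra_simps)
      then show ?thesis
        using Suc 1 2 3 by (simp add: coeff_pderiv)
    next
      case False
      then show ?thesis
        using Suc by (auto simp: coeff_laguerre coeff_pderiv not_le less_Suc_eq_le le_Suc_eq)
    qed
  qed
qed

text \<open>
  Expresses the quotient of two neighbouring polynomials by a logarithmic derivative. It is a formal
  consequence of the three relations above.
\<close>
lemma x_pderiv_laguerre:
  "[:0, 1:] * pderiv (laguerre a (Suc n))
     = smult (real (Suc n)) (laguerre a (Suc n)) - smult (real (Suc n) + a) (laguerre a n)"
proof -
  have *: "[:0, 1:] * laguerre (a + 1) n =
     smult (real (Suc n) + a) (laguerre a n) - smult (real (Suc n)) (laguerre a (Suc n))"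
  proof (cases n)
    case 0
    have "laguerre a (Suc 0) = [:1 + a, -1:]" by (simp add: laguerre_def monom_altdef)
    then show ?thesis using 0 by (simp add: laguerre_0 flip: one_pCons)
  next
    case (Suc m)
    have e: "laguerre (a - 1) (Suc n) = laguerre a (Suc n) - laguerre a n"
      using laguerre_Suc_diff[of a n] by simp
    have p: "pderiv (laguerre a n) = laguerre a n - laguerre (a + 1) n"
      using pderiv_laguerre_Suc[of a m] laguerre_Suc_diff[of "a + 1" m] Suc by simp
    have "[:0, 1:] * pderiv (laguerre a n) + [:a, -1:] * laguerre a n
      = smult (real (Suc n)) (laguerre (a - 1) (Suc n))"
      using laguerre_raise[of "a - 1" n] by simp
    then have *: "[:0, 1:] * (laguerre a n - laguerre (a + 1) n) + [:a, -1:] * laguerre a n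
      = smult (real (Suc n)) (laguerre a (Suc n) - laguerre a n)"
      by (simp only: p e)
    show ?thesis
    proof (rule poly_ext)
      fix x
      show "poly ([:0, 1:] * laguerre (a + 1) n) x =
        poly (smult (real (Suc n) + a) (laguerre a n) - smult (real (Suc n)) (laguerre a (Suc n))) x"
        using arg_cong[OF *, of "\<lambda>p. poly p x"] by (simp add: algebra_simps)
    qed
  qed
  show ?thesis
    unfolding pderiv_laguerre_Suc mult_minus_right * by simp
qed

text \<open>The index-raising relation applied to the derivative, which is again a Laguerre polynomial.\<close>
lemma laguerre_ode:
  "[:0, 1:] * pderiv (pderiv (laguerre a n)) + [:a + 1, -1:] * pderiv (laguerre a n)
     + smult (real n) (laguerre a n) = 0"
proof (cases n)
  case 0 then show ?thesis by (simp add: laguerre_0)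
next
  case (Suc m)
  show ?thesis
  proof (rule poly_ext)
    fix x
    show "poly ([:0, 1:] * pderiv (pderiv (laguerre a n)) + [:a + 1, -1:] * pderiv (laguerre a n)
     + smult (real n) (laguerre a n)) x = poly 0 x"
      using arg_cong[OF laguerre_raise[of a m], of "\<lambda>p. poly p x"]
      unfolding Suc pderiv_laguerre_Suc by (simp add: pderiv_minus algebra_simps)
  qed
qed

section \<open>Linear combinations of consecutive Laguerre polynomials\<close>

text \<open>
  The combinations are indexed by a polynomial, with the lowest occurring degree \<open>s\<close> as a separate
  argument. In this way multiplication of \<open>p\<close> by \<open>x\<close> is a shift of \<open>s\<close>, and the map is linear in \<open>p\<close>
  without any bound on its degree.
\<close>
definition laguerre_lift :: "nat \<Rightarrow> real \<Rightarrow> real poly \<Rightarrow> real poly" where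
  "laguerre_lift s a p = (\<Sum>i\<le>degree p. smult (coeff p i) (laguerre a (s + i)))"

lemma laguerre_lift_eq_sum:
  "degree p \<le> d \<Longrightarrow> laguerre_lift s a p = (\<Sum>i\<le>d. smult (coeff p i) (laguerre a (s + i)))"
  unfolding laguerre_lift_def
  by (rule sum.mono_neutral_left) (auto simp: coeff_eq_0)

lemma smult_sum_right: "smult c (\<Sum>i\<in>I. f i) = (\<Sum>i\<in>I. smult c (f i))"
  by (induction I rule: infinite_finite_induct) (auto simp: smult_add_right)

lemma laguerre_lift_add: "laguerre_lift s a (p + q) = laguerre_lift s a p + laguerre_lift s a q"
proof -
  let ?d = "max (degree p) (degree q)"
  have "degree (p + q) \<le> ?d" by (simp add: degree_add_le_max)
  then show ?thesis
    by (simp add: laguerre_lift_eq_sum[of _ ?d] smult_add_left sum.distrib)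
qed

lemma laguerre_lift_smult: "laguerre_lift s a (smult c p) = smult c (laguerre_lift s a p)"
proof -
  have "degree (smult c p) \<le> degree p" by (simp add: degree_smult_le)
  then show ?thesis
    by (simp add: laguerre_lift_eq_sum[of _ "degree p"] smult_sum_right)
qed

lemma laguerre_lift_pCons_0: "laguerre_lift s a (pCons 0 p) = laguerre_lift (Suc s) a p"
proof -
  have "degree (pCons 0 p) \<le> Suc (degree p)" by (simp add: degree_pCons_le)
  then show ?thesis
    by (simp add: laguerre_lift_eq_sum[of _ "Suc (degree p)"] laguerre_lift_def sum.atMost_Suc_shift del: sum.atMost_Suc)
qed

lemma laguerre_lift_linear_times:
  "laguerre_lift s a ([:b, c:] * p) = smult c (laguerre_lift (Suc s) a p) + smult b (laguerre_lift s a p)"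
proof -
  have "[:b, c:] * p = smult b p + pCons 0 (smult c p)"
    by (simp add: mult_pCons_left)
  then show ?thesis by (simp add: laguerre_lift_add laguerre_lift_smult laguerre_lift_pCons_0)
qed

lemma pderiv_laguerre_lift: "pderiv (laguerre_lift (Suc s) a p) = - laguerre_lift s (a + 1) p"
  by (simp add: laguerre_lift_def pderiv_sum pderiv_smult pderiv_laguerre_Suc sum_negf)

lemma laguerre_lift_Suc_diff:
  "laguerre_lift (Suc s) a p - laguerre_lift s a p = laguerre_lift (Suc s) (a - 1) p"
  by (simp add: laguerre_lift_def sum_subtractf[symmetric] smult_diff_right[symmetric] laguerre_Suc_diff)

text \<open>
  The key identity: write \<open>x - r\<close> as \<open>(x - 1) + (1 - r)\<close>. The first summand lowers the parameter
  by one, and the second one produces, up to sign, the derivative of the result.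
\<close>
lemma laguerre_lift_linear_factor:
  "laguerre_lift s a ([:-r, 1:] * p) =
     laguerre_lift (Suc s) (a - 1) p - smult (1 - r) (pderiv (laguerre_lift (Suc s) (a - 1) p))"
proof -
  have "laguerre_lift s a ([:-r, 1:] * p) = (laguerre_lift (Suc s) a p - laguerre_lift s a p)
      + smult (1 - r) (laguerre_lift s a p)"
    by (simp add: laguerre_lift_linear_times[of s a "-r" 1 p, simplified] smult_diff_left)
  also have "\<dots> = laguerre_lift (Suc s) (a - 1) p - smult (1 - r) (pderiv (laguerre_lift (Suc s) (a - 1) p))"
    by (simp add: laguerre_lift_Suc_diff pderiv_laguerre_lift)
  finally show ?thesis .
qed

lemma degree_laguerre_lift:
  assumes "p \<noteq> 0" shows "degree (laguerre_lift s a p) = s + degree p"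
proof (rule antisym)
  show "degree (laguerre_lift s a p) \<le> s + degree p"
    unfolding laguerre_lift_def
    by (rule degree_sum_le) (auto intro: order_trans[OF degree_smult_le] simp: degree_laguerre)
  have "coeff (laguerre_lift s a p) (s + degree p) = (\<Sum>i\<le>degree p. if i = degree p then coeff p i * coeff (laguerre a (s + i)) (s + i) else 0)"
    unfolding laguerre_lift_def coeff_sum
    by (rule sum.cong) (auto simp: coeff_laguerre)
  also have "\<dots> \<noteq> 0" using assms by (simp add: coeff_laguerre)
  finally show "s + degree p \<le> degree (laguerre_lift s a p)" by (rule le_degree)
qed

text \<open>
  The index-raising relation for combinations: the relation has the factor \<open>s + i + 1\<close> on the
  right-hand side, so the coefficients have to be divided by it.
\<close>
lemma laguerre_lift_raise:
  obtains p' where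
    "laguerre_lift (Suc s) a p = [:0, 1:] * pderiv (laguerre_lift s (a + 1) p') + [:a + 1, -1:] * laguerre_lift s (a + 1) p'"
proof
  define p' where "p' = (\<Sum>i\<le>degree p. monom (coeff p i / real (Suc (s + i))) i)"
  have c: "coeff p' i = coeff p i / real (Suc (s + i))" for i
    by (cases "i \<le> degree p") (auto simp: p'_def coeff_sum coeff_eq_0)
  have "degree p' \<le> degree p"
    by (rule degree_le) (auto simp: c coeff_eq_0)
  then have l: "laguerre_lift s (a + 1) p' = (\<Sum>i\<le>degree p. smult (coeff p' i) (laguerre (a + 1) (s + i)))"
    by (rule laguerre_lift_eq_sum)
  have t: "smult (coeff p i) (laguerre a (Suc s + i)) =
     smult (coeff p' i) ([:0, 1:] * pderiv (laguerre (a + 1) (s + i)) + [:a + 1, -1:] * laguerre (a + 1) (s + i))" for i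
    unfolding laguerre_raise by (simp add: c)
  show "laguerre_lift (Suc s) a p = [:0, 1:] * pderiv (laguerre_lift s (a + 1) p') + [:a + 1, -1:] * laguerre_lift s (a + 1) p'"
    unfolding l laguerre_lift_def[of "Suc s" a p] t
    by (simp only: pderiv_sum pderiv_smult sum_distrib_left smult_add_right sum.distrib mult_smult_right)
qed

section \<open>Zeros gained and kept by first-order differential operators\<close>

text \<open>
  Rolle's theorem gives lower bounds for numbers of distinct zeros only. With this relational form
  the bounds compose, and they cover the zero polynomial.
\<close>
definition zeros_in :: "real set \<Rightarrow> nat \<Rightarrow> real poly \<Rightarrow> bool" where
  "zeros_in S k p \<longleftrightarrow> (\<exists>X\<subseteq>S. finite X \<and> card X = k \<and> (\<forall>x\<in>X. poly p x = 0))"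

lemma zeros_in_mono: "zeros_in S k p \<Longrightarrow> S \<subseteq> T \<Longrightarrow> zeros_in T k p"
  unfolding zeros_in_def by blast

lemma zeros_in_0 [simp]: "zeros_in S 0 p"
  unfolding zeros_in_def by (rule exI[of _ "{}"]) simp

lemma card_zeros_ge:
  assumes "zeros_in S k p" "p \<noteq> 0"
  shows "k \<le> card {x \<in> S. poly p x = 0}"
proof -
  obtain X where X: "X \<subseteq> S" "card X = k" "\<forall>x\<in>X. poly p x = 0"
    using assms(1) unfolding zeros_in_def by blast
  have "finite {x \<in> S. poly p x = 0}"
    by (rule finite_subset[OF _ poly_roots_finite[OF assms(2)]]) auto
  then have "card X \<le> card {x \<in> S. poly p x = 0}"
    by (rule card_mono) (use X in auto)
  then show ?thesis using X by simp
qed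

text \<open>
  A function that vanishes at \<open>a\<close> and at infinity takes some intermediate value on both sides of any
  point where it is nonzero, so the ordinary form of Rolle's theorem applies.
\<close>
lemma Rolle_at_infinity:
  fixes g g' :: "real \<Rightarrow> real"
  assumes cont: "continuous_on {a..} g"
    and der: "\<And>x. x > a \<Longrightarrow> (g has_real_derivative g' x) (at x)"
    and zero: "g a = 0" and lim: "(g \<longlongrightarrow> 0) at_top"
  shows "\<exists>x>a. g' x = 0"
proof -
  have main: "\<exists>x>a. g' x = 0"
    if cont: "continuous_on {a..} g"
    and der: "\<And>x. x > a \<Longrightarrow> (g has_real_derivative g' x) (at x)"
    and zero: "g a = 0" and lim: "(g \<longlongrightarrow> 0) at_top" and b: "b > a" "g b > 0" for g g' b
  proof -
    have "\<forall>\<^sub>F x in at_top. g x < g b / 2"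
      using lim b by (intro order_tendstoD) auto
    then have "\<forall>\<^sub>F x in at_top. g x < g b / 2 \<and> b < x"
      using eventually_gt_at_top by (rule eventually_conj)
    then obtain d where d: "g d < g b / 2" "b < d"
      using eventually_happens' by (metis (no_types, lifting) trivial_limit_at_top_linorder)
    \<comment> \<open>Half the value at b is taken once on [a, b] and once more on [b, d].\<close>
    obtain u where u: "a \<le> u" "u \<le> b" "g u = g b / 2"
      using IVT'[of g a "g b / 2" b] b zero continuous_on_subset[OF cont, of "{a..b}"] by force
    obtain v where v: "b \<le> v" "v \<le> d" "g v = g b / 2"
      using IVT2'[of g d "g b / 2" b] b d continuous_on_subset[OF cont, of "{b..d}"] by force
    have "u < v" using u v b by (smt (verit) field_sum_of_halves)
    then obtain x where "u < x" "x < v" "DERIV g x :> 0"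
      using Rolle[of u v g] u v der continuous_on_subset[OF cont, of "{u..v}"]
      by (force simp: real_differentiable_def)
    moreover from this have "g' x = 0"
      using der[of x] u DERIV_unique by fastforce
    ultimately show ?thesis using u by force
  qed
  show ?thesis
  proof (cases "\<exists>b>a. g b \<noteq> 0")
    case True
    then obtain b where b: "b > a" "g b \<noteq> 0" by blast
    show ?thesis
    proof (cases "g b > 0")
      case True
      then show ?thesis using main[OF assms] b by blast
    next
      case False
      have "\<exists>x>a. - g' x = 0"
      proof (rule main[of "\<lambda>x. - g x" _ b])
        show "continuous_on {a..} (\<lambda>x. - g x)" using cont by (intro continuous_intros)
        show "((\<lambda>x. - g x) has_real_derivative - g' x) (at x)" if "x > a" for x
          using der[OF that] by (rule DERIV_minus)
        show "((\<lambda>x. - g x) \<longlongrightarrow> 0) at_top" using tendsto_minus[OF lim] by simp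
      qed (use b False zero in auto)
      then show ?thesis by simp
    qed
  next
    case False
    have "\<forall>\<^sub>F x in nhds (a + 1). g x = 0"
      using False eventually_nhds_in_open[of "{a<..}" "a + 1"] by (auto elim: eventually_mono)
    then have "(g has_real_derivative 0) (at (a + 1))"
      by (subst DERIV_cong_ev[OF refl _ refl, of _ "\<lambda>_. 0"]) auto
    then show ?thesis using der[of "a + 1"] DERIV_unique by force
  qed
qed

lemma poly_exp_tendsto_0:
  fixes b c :: real
  assumes "c > 0"
  shows "((\<lambda>x. x powr b * exp (- x / c) * poly p x) \<longlongrightarrow> 0) at_top"
proof (induction p arbitrary: b)
  case 0 then show ?case by simp
next
  case (pCons a p)
  have 1: "((\<lambda>x::real. x powr b * exp (- x / c)) \<longlongrightarrow> 0) at_top"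
    using assms by real_asymp
  have "((\<lambda>x. a * (x powr b * exp (- x / c)) + x powr (b + 1) * exp (- x / c) * poly p x) \<longlongrightarrow> a * 0 + 0) at_top"
    by (intro tendsto_intros 1 pCons.IH)
  moreover have "\<forall>\<^sub>F x in at_top. a * (x powr b * exp (- x / c)) + x powr (b + 1) * exp (- x / c) * poly p x
     = x powr b * exp (- x / c) * poly (pCons a p) x"
    using eventually_gt_at_top[of 0]
    by eventually_elim (simp add: powr_add algebra_simps)
  ultimately show ?case by (simp add: tendsto_cong)
qed

lemma gap_points:
  fixes X :: "real set"
  assumes "finite X" and "\<And>a b. a \<in> X \<Longrightarrow> b \<in> X \<Longrightarrow> a < b \<Longrightarrow> \<exists>y. a < y \<and> y < b \<and> Z y"
  shows "\<exists>Y. finite Y \<and> card Y = card X - 1 \<and> (\<forall>y\<in>Y. Z y \<and> Min X < y \<and> y < Max X)"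
  using assms
proof (induction X rule: finite_linorder_max_induct)
  case empty
  then show ?case by (intro exI[of _ "{}"]) simp
next
  case (insert b X)
  show ?case
  proof (cases "X = {}")
    case True
    then show ?thesis by (intro exI[of _ "{}"]) simp
  next
    case False
    obtain Y where Y: "finite Y" "card Y = card X - 1" "\<forall>y\<in>Y. Z y \<and> Min X < y \<and> y < Max X"
      using insert.IH insert.prems by auto
    have M: "Max X \<in> X" using insert False by simp
    obtain y where y: "Max X < y" "y < b" "Z y"
      using insert.prems[of "Max X" b] M insert.hyps by auto
    have "y \<notin> Y" using Y y by force
    have mm: "Min X \<le> Max X" using insert False by simp
    have b: "Max X < b" using M insert by auto
    have "Min (insert b X) = Min X" "Max (insert b X) = b"
      using b mm Min_insert[OF insert.hyps(1) False, of b] Max_insert[OF insert.hyps(1) False, of b]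
      by simp_all
    moreover have "card X > 0" using insert False by (simp add: card_gt_0_iff)
    moreover have "b \<notin> X" using insert by auto
    ultimately show ?thesis
      using Y y \<open>y \<notin> Y\<close> insert.hyps mm b by (intro exI[of _ "insert y Y"]) force
  qed
qed

text \<open>
  Rolle's theorem for \<open>exp (- x / c) * p x\<close>, whose derivative is a nonvanishing multiple of
  \<open>p - c p'\<close>. This function tends to zero at infinity if \<open>c > 0\<close>, which explains the next lemma, and
  at minus infinity if \<open>c < 0\<close>.
\<close>
lemma Rolle_minus_smult_pderiv:
  fixes p :: "real poly"
  assumes "c \<noteq> 0" "a < b" "poly p a = 0" "poly p b = 0"
  shows "\<exists>y. a < y \<and> y < b \<and> poly (p - smult c (pderiv p)) y = 0"
proof -
  define g where "g = (\<lambda>x. exp (- x / c) * poly p x)"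
  have der: "(g has_real_derivative exp (- x / c) * (- poly (p - smult c (pderiv p)) x / c)) (at x)" for x
    unfolding g_def using assms(1)
    by (auto intro!: derivative_eq_intros simp: field_simps)
  have "\<exists>z>a. z < b \<and> (g has_real_derivative 0) (at z)"
    using assms der
    by (intro Rolle continuous_at_imp_continuous_on ballI DERIV_isCont[OF der])
       (auto simp: g_def real_differentiable_def)
  then obtain z where "z > a" "z < b" "(g has_real_derivative 0) (at z)" by blast
  moreover from this have "exp (- z / c) * (- poly (p - smult c (pderiv p)) z / c) = 0"
    using der DERIV_unique by blast
  ultimately show ?thesis using assms(1) by auto
qed

lemma Rolle_minus_smult_pderiv_right:
  fixes p :: "real poly"
  assumes "c > 0" "poly p a = 0"
  shows "\<exists>y>a. poly (p - smult c (pderiv p)) y = 0"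
proof -
  define g where "g = (\<lambda>x. exp (- x / c) * poly p x)"
  have der: "(g has_real_derivative exp (- x / c) * (- poly (p - smult c (pderiv p)) x / c)) (at x)" for x
    unfolding g_def using assms(1)
    by (auto intro!: derivative_eq_intros simp: field_simps)
  have "\<forall>\<^sub>F x in at_top. x powr 0 * exp (- x / c) * poly p x = g x"
    using eventually_gt_at_top[of 0] by eventually_elim (simp add: g_def)
  then have "(g \<longlongrightarrow> 0) at_top"
    using poly_exp_tendsto_0[OF assms(1), of 0 p] by (simp add: tendsto_cong)
  then have "\<exists>x>a. exp (- x / c) * (- poly (p - smult c (pderiv p)) x / c) = 0"
    using assms der
    by (intro Rolle_at_infinity[of a g] continuous_at_imp_continuous_on ballI DERIV_isCont[OF der])
       (auto simp: g_def)
  then show ?thesis using assms(1) by auto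
qed

text \<open>The reflection \<open>x \<mapsto> - x\<close> reverses the sign of \<open>c\<close>.\<close>
lemma Rolle_minus_smult_pderiv_left:
  fixes p :: "real poly"
  assumes "c < 0" "poly p a = 0"
  shows "\<exists>y<a. poly (p - smult c (pderiv p)) y = 0"
proof -
  define r where "r = pcompose p [:0, -1:]"
  have "poly r (- a) = 0" using assms by (simp add: r_def poly_pcompose)
  then obtain y where "y > - a" "poly (r - smult (- c) (pderiv r)) y = 0"
    using Rolle_minus_smult_pderiv_right[of "- c" r "- a"] assms by auto
  then show ?thesis
    by (intro exI[of _ "- y"]) (auto simp: r_def poly_pcompose pderiv_pcompose pderiv_pCons)
qed

text \<open>
  The \<open>k - 1\<close> gaps and the ray to the right of the last zero contain one zero each. All of these
  lie strictly to the right of the first zero, whence the open half-line.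
\<close>
lemma zeros_in_minus_smult_pderiv_pos:
  assumes c: "c > 0" and p: "zeros_in {a..} k p"
  shows "zeros_in {a<..} k (p - smult c (pderiv p))"
proof -
  let ?q = "p - smult c (pderiv p)"
  obtain X where X: "X \<subseteq> {a..}" "finite X" "card X = k" "\<forall>x\<in>X. poly p x = 0"
    using p unfolding zeros_in_def by blast
  show ?thesis
  proof (cases "X = {}")
    case True
    then show ?thesis using X by simp
  next
    case False
    have "\<exists>Y. finite Y \<and> card Y = card X - 1 \<and> (\<forall>y\<in>Y. poly ?q y = 0 \<and> Min X < y \<and> y < Max X)"
      using X c by (intro gap_points Rolle_minus_smult_pderiv) auto
    then obtain Y where Y: "finite Y" "card Y = card X - 1" "\<forall>y\<in>Y. poly ?q y = 0 \<and> Min X < y \<and> y < Max X"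
      by blast
    have M: "Max X \<in> X" "Min X \<in> X" using X False by simp_all
    then obtain y where y: "Max X < y" "poly ?q y = 0"
      using Rolle_minus_smult_pderiv_right[OF c, of p "Max X"] X by auto
    have "y \<notin> Y" using Y y by force
    moreover have "card X > 0" using X False by (metis card_gt_0_iff)
    moreover have "a \<le> Min X" "a \<le> Max X" using X M by auto
    ultimately show ?thesis
      unfolding zeros_in_def using Y y X
      by (intro exI[of _ "insert y Y"]) force
  qed
qed

text \<open>
  Here the additional zero lies to the left of the first zero, possibly outside the half-line, so
  only the gaps count.
\<close>
lemma zeros_in_minus_smult_pderiv_neg:
  assumes c: "c < 0" and p: "zeros_in {a..} k p"
  shows "zeros_in {a..} (k - 1) (p - smult c (pderiv p))"
proof -
  let ?q = "p - smult c (pderiv p)"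
  obtain X where X: "X \<subseteq> {a..}" "finite X" "card X = k" "\<forall>x\<in>X. poly p x = 0"
    using p unfolding zeros_in_def by blast
  show ?thesis
  proof (cases "X = {}")
    case True
    then show ?thesis using X by simp
  next
    case False
    have "\<exists>Y. finite Y \<and> card Y = card X - 1 \<and> (\<forall>y\<in>Y. poly ?q y = 0 \<and> Min X < y \<and> y < Max X)"
      using X c by (intro gap_points Rolle_minus_smult_pderiv) auto
    then obtain Y where Y: "finite Y" "card Y = card X - 1" "\<forall>y\<in>Y. poly ?q y = 0 \<and> Min X < y \<and> y < Max X"
      by blast
    have "Min X \<in> X" using X False by simp
    then have "a \<le> Min X" using X by auto
    then show ?thesis
      unfolding zeros_in_def using Y X by (intro exI[of _ Y]) force
  qed
qed

lemma zeros_in_minus_smult_pderiv: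
  assumes p: "zeros_in UNIV k p"
  shows "zeros_in UNIV k (p - smult c (pderiv p))"
proof (cases c "0 :: real" rule: linorder_cases)
  case equal
  then show ?thesis using p by simp
next
  case greater
  obtain X where X: "finite X" "card X = k" "\<forall>x\<in>X. poly p x = 0"
    using p unfolding zeros_in_def by blast
  have "X \<subseteq> {Min (insert 0 X)..}" using X by auto
  then have "zeros_in {Min (insert 0 X)..} k p" unfolding zeros_in_def using X by blast
  then show ?thesis
    using zeros_in_minus_smult_pderiv_pos[OF greater] zeros_in_mono by blast
next
  case less
  let ?q = "p - smult c (pderiv p)"
  obtain X where X: "finite X" "card X = k" "\<forall>x\<in>X. poly p x = 0"
    using p unfolding zeros_in_def by blast
  show ?thesis
  proof (cases "X = {}")
    case True
    then show ?thesis using X by simp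
  next
    case False
    have "\<exists>Y. finite Y \<and> card Y = card X - 1 \<and> (\<forall>y\<in>Y. poly ?q y = 0 \<and> Min X < y \<and> y < Max X)"
      using X less by (intro gap_points Rolle_minus_smult_pderiv) auto
    then obtain Y where Y: "finite Y" "card Y = card X - 1" "\<forall>y\<in>Y. poly ?q y = 0 \<and> Min X < y \<and> y < Max X"
      by blast
    have M: "Min X \<in> X" using X False by simp_all
    then obtain y where y: "y < Min X" "poly ?q y = 0"
      using Rolle_minus_smult_pderiv_left[OF less, of p "Min X"] X by auto
    have "y \<notin> Y" using Y y by force
    moreover have "card X > 0" using X False by (metis card_gt_0_iff)
    ultimately show ?thesis
      unfolding zeros_in_def using Y y X
      by (intro exI[of _ "insert y Y"]) force
  qed
qed

text \<open>
  Rolle's theorem for \<open>x powr b * exp (- x) * p x\<close>. Besides the zeros of \<open>p\<close> it has the zero \<open>0\<close>,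
  because \<open>b > 0\<close>, and it tends to zero at infinity; so one zero is gained.
\<close>
lemma zeros_in_raise:
  assumes b: "b > 0" and p: "zeros_in {0<..} k p"
  shows "zeros_in {0<..} (Suc k) ([:0, 1:] * pderiv p + [:b, -1:] * p)"
proof -
  let ?q = "[:0, 1:] * pderiv p + [:b, -1:] * p"
  obtain X where X: "X \<subseteq> {0<..}" "finite X" "card X = k" "\<forall>x\<in>X. poly p x = 0"
    using p unfolding zeros_in_def by blast
  define g where "g = (\<lambda>x. x powr b * exp (- x) * poly p x)"
  have der: "(g has_real_derivative x powr (b - 1) * exp (- x) * poly ?q x) (at x)" if "x > 0" for x
  proof -
    have 1: "((\<lambda>x. x powr b) has_real_derivative b * x powr (b - 1)) (at x)"
      using that by (rule has_real_derivative_powr)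
    have 2: "((\<lambda>x. exp (- x) * poly p x) has_real_derivative exp (- x) * (poly (pderiv p) x - poly p x)) (at x)"
      by (auto intro!: derivative_eq_intros simp: algebra_simps)
    have 3: "x powr b = x * x powr (b - 1)" using that by (simp add: powr_diff)
    show ?thesis
      unfolding g_def mult.assoc using DERIV_mult[OF 1 2] by (simp add: 3 algebra_simps)
  qed
  have "continuous_on {0..} g"
    unfolding g_def using b by (intro continuous_on_mult continuous_on_powr' continuous_intros) auto
  note cont = continuous_on_subset[OF this]
  have g0: "g x = 0" if "x \<in> insert 0 X" for x
    using that X b by (auto simp: g_def)
  have Xp: "x \<ge> 0" if "x \<in> insert 0 X" for x using that X by auto
  have "\<exists>y. x < y \<and> y < z \<and> poly ?q y = 0" if xz: "x \<in> insert 0 X" "z \<in> insert 0 X" "x < z" for x z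
  proof -
    have "\<exists>y>x. y < z \<and> (g has_real_derivative 0) (at y)"
    proof (rule Rolle[OF \<open>x < z\<close>])
      show "g x = g z" using g0 xz by simp
      show "continuous_on {x..z} g" by (rule cont) (use Xp xz in force)
      show "g differentiable at y" if "x < y" "y < z" for y
        using der[of y] Xp[OF xz(1)] that unfolding real_differentiable_def by force
    qed
    then obtain y where y: "y > x" "y < z" "(g has_real_derivative 0) (at y)" by blast
    have "y > 0" using y Xp[OF xz(1)] by simp
    then have "y powr (b - 1) * exp (- y) * poly ?q y = 0" using der y DERIV_unique by blast
    then show ?thesis using y \<open>y > 0\<close> by auto
  qed
  then have "\<exists>Y. finite Y \<and> card Y = card (insert 0 X) - 1 \<and> (\<forall>y\<in>Y. poly ?q y = 0 \<and> Min (insert 0 X) < y \<and> y < Max (insert 0 X))"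
    using X by (intro gap_points) auto
  then obtain Y where Y: "finite Y" "card Y = card (insert 0 X) - 1"
      "\<forall>y\<in>Y. poly ?q y = 0 \<and> Min (insert 0 X) < y \<and> y < Max (insert 0 X)"
    by blast
  let ?M = "Max (insert 0 X)"
  have M: "?M \<in> insert 0 X" "Min (insert 0 X) \<in> insert 0 X" by (rule Max_in Min_in; use X in simp)+
  have "?M \<ge> 0" "Min (insert 0 X) \<ge> 0" using Xp M by auto
  have "\<exists>y>?M. y powr (b - 1) * exp (- y) * poly ?q y = 0"
  proof (rule Rolle_at_infinity)
    show "continuous_on {?M..} g" by (rule cont) (use \<open>?M \<ge> 0\<close> in force)
    show "g ?M = 0" using g0 M by simp
    show "(g \<longlongrightarrow> 0) at_top" using poly_exp_tendsto_0[of 1 b p] by (simp add: g_def)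
  qed (use der \<open>?M \<ge> 0\<close> in force)
  then obtain y where y: "y > ?M" "poly ?q y = 0" using \<open>?M \<ge> 0\<close> by force
  have "y \<notin> Y" using Y y by force
  moreover have "0 \<notin> X" using X by auto
  moreover have "\<forall>z\<in>Y. z > 0" using Y \<open>Min (insert 0 X) \<ge> 0\<close> by force
  ultimately show ?thesis
    unfolding zeros_in_def using Y y X \<open>?M \<ge> 0\<close>
    by (intro exI[of _ "insert y Y"]) force
qed

section \<open>Lower bounds for the number of real zeros\<close>

lemma zeros_in_laguerre_lift_pos:
  "a > -1 \<Longrightarrow> zeros_in {0<..} s (laguerre_lift s a p)"
proof (induction s arbitrary: a p)
  case 0
  then show ?case by simp
next
  case (Suc s)
  obtain p' where "laguerre_lift (Suc s) a p =
      [:0, 1:] * pderiv (laguerre_lift s (a + 1) p') + [:a + 1, -1:] * laguerre_lift s (a + 1) p'"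
    by (rule laguerre_lift_raise)
  then show ?case using zeros_in_raise[of "a + 1" s "laguerre_lift s (a + 1) p'"] Suc by simp
qed

text \<open>
  For \<open>a = -1\<close> the last raising step is \<open>p \<mapsto> x (p' - p)\<close>. It gains the zero \<open>0\<close> through the factor
  \<open>x\<close>, and \<open>p - p'\<close> has at least as many positive zeros as \<open>p\<close>.
\<close>
lemma zeros_in_laguerre_lift:
  assumes "a \<ge> -1"
  shows "zeros_in {0..} s (laguerre_lift s a p)"
proof (cases "a = -1 \<and> s > 0")
  case False
  then show ?thesis
    using zeros_in_laguerre_lift_pos[of a s p] assms by (cases "s = 0") (auto intro: zeros_in_mono)
next
  case True
  then obtain t where s: "s = Suc t" by (cases s) auto
  obtain p' where p': "laguerre_lift (Suc t) a p =
      [:0, 1:] * pderiv (laguerre_lift t (a + 1) p') + [:a + 1, -1:] * laguerre_lift t (a + 1) p'"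
    by (rule laguerre_lift_raise)
  let ?r = "laguerre_lift t 0 p'"
  have "zeros_in {0..} t ?r"
    using zeros_in_laguerre_lift_pos[of 0 t p'] zeros_in_mono[of "{0<..}" t ?r "{0..}"] by force
  then have "zeros_in {0<..} t (?r - smult 1 (pderiv ?r))"
    by (rule zeros_in_minus_smult_pderiv_pos[rotated]) simp
  then obtain X where X: "X \<subseteq> {0<..}" "finite X" "card X = t" "\<forall>x\<in>X. poly (?r - smult 1 (pderiv ?r)) x = 0"
    unfolding zeros_in_def by blast
  have "0 \<notin> X" using X by auto
  then show ?thesis
    unfolding zeros_in_def s using X p' True by (intro exI[of _ "insert 0 X"]) auto
qed

lemma filter_mset_eq_empty: "\<forall>x\<in>#M. \<not> Q x \<Longrightarrow> filter_mset Q M = {#}"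
  by (induction M) auto

lemma filter_mset_eq_self: "\<forall>x\<in>#M. Q x \<Longrightarrow> filter_mset Q M = M"
  by (induction M) auto

text \<open>
  Each factor \<open>x - r\<close> costs one unit of the parameter and applies \<open>1 - (1 - r) D\<close>. This lemma
  and the next two record what this operator does to the zeros on the real line and on the closed and
  open half-lines.
\<close>
lemma laguerre_lift_linear_factors_zeros:
  "zeros_in UNIV k (laguerre_lift (s + size M) (a - real (size M)) R) \<Longrightarrow>
     zeros_in UNIV k (laguerre_lift s a ((\<Prod>r\<in>#M. [:-r, 1:]) * R))"
proof (induction M arbitrary: s a)
  case empty
  then show ?case by simp
next
  case (add r M)
  have "zeros_in UNIV k (laguerre_lift (Suc s) (a - 1) ((\<Prod>r\<in>#M. [:-r, 1:]) * R))"
    using add.prems by (intro add.IH) (simp add: algebra_simps)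
  from zeros_in_minus_smult_pderiv[OF this, of "1 - r"]
  show ?case by (simp only: image_mset_add_mset prod_mset.add_mset mult.assoc laguerre_lift_linear_factor)
qed

lemma laguerre_lift_linear_factors_zeros_nonneg:
  "zeros_in {0..} k (laguerre_lift (s + size M) (a - real (size M)) R) \<Longrightarrow>
     zeros_in {0..} (k - size (filter_mset (\<lambda>r. r > 1) M)) (laguerre_lift s a ((\<Prod>r\<in>#M. [:-r, 1:]) * R))"
proof (induction M arbitrary: s a)
  case empty
  then show ?case by simp
next
  case (add r M)
  let ?p = "laguerre_lift (Suc s) (a - 1) ((\<Prod>r\<in>#M. [:-r, 1:]) * R)"
  let ?k = "k - size (filter_mset (\<lambda>r. r > 1) M)"
  have p: "zeros_in {0..} ?k ?p"
    using add.prems by (intro add.IH) (simp add: algebra_simps)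
  have "zeros_in {0..} (k - size (filter_mset (\<lambda>r. r > 1) (add_mset r M))) (?p - smult (1 - r) (pderiv ?p))"
  proof (cases r "1 :: real" rule: linorder_cases)
    case less
    then show ?thesis
      using zeros_in_minus_smult_pderiv_pos[OF _ p, of "1 - r"] by (auto intro: zeros_in_mono)
  next
    case equal
    then show ?thesis using p by simp
  next
    case greater
    then show ?thesis
      using zeros_in_minus_smult_pderiv_neg[OF _ p, of "1 - r"] by simp
  qed
  then show ?case by (simp only: image_mset_add_mset prod_mset.add_mset mult.assoc laguerre_lift_linear_factor)
qed

text \<open>
  A factor with \<open>r < 1\<close> moves all zeros into the open half-line, and a factor with \<open>r = 1\<close> acts as
  the identity. So a zero at the origin can survive only if every \<open>r\<close> is \<open>1\<close>.
\<close>
lemma laguerre_lift_linear_factors_zeros_pos: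
  assumes "\<forall>r\<in>#M. r \<le> 1" "zeros_in {0..} k (laguerre_lift (s + size M) (a - real (size M)) R)"
    "zeros_in {0<..} k (laguerre_lift (s + size M) (a - real (size M)) R) \<or> (\<exists>r\<in>#M. r < 1)"
  shows "zeros_in {0<..} k (laguerre_lift s a ((\<Prod>r\<in>#M. [:-r, 1:]) * R))"
  using assms
proof (induction M arbitrary: s a)
  case empty
  then show ?case by simp
next
  case (add r M)
  let ?p = "laguerre_lift (Suc s) (a - 1) ((\<Prod>r\<in>#M. [:-r, 1:]) * R)"
  have "zeros_in {0<..} k (?p - smult (1 - r) (pderiv ?p))"
  proof (cases "r < 1")
    case True
    have e: "filter_mset (\<lambda>r. r > 1) M = {#}"
      using add.prems(1) by (intro filter_mset_eq_empty) (auto simp: not_less)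
    have "zeros_in {0..} (k - size (filter_mset (\<lambda>r. r > 1) M)) ?p"
      by (rule laguerre_lift_linear_factors_zeros_nonneg) (use add.prems(2) in \<open>simp add: algebra_simps\<close>)
    then have "zeros_in {0..} k ?p" unfolding e by simp
    then show ?thesis
      by (rule zeros_in_minus_smult_pderiv_pos[rotated]) (use True in simp)
  next
    case False
    then have r: "r = 1" using add.prems by simp
    have "zeros_in {0<..} k ?p"
      using add.prems r by (intro add.IH) (auto simp: algebra_simps)
    then show ?thesis using r by simp
  qed
  then show ?case by (simp only: image_mset_add_mset prod_mset.add_mset mult.assoc laguerre_lift_linear_factor)
qed

section \<open>Counting the zeros of real polynomials\<close>

lemma linear_factors_times_rootfree:
  fixes p :: "'a :: field poly"
  assumes "p \<noteq> 0"
  shows "\<exists>R. p = (\<Prod>r\<in>#proots p. [:-r, 1:]) * R \<and> (\<forall>x. poly R x \<noteq> 0)"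
  using assms
proof (induction "degree p" arbitrary: p rule: less_induct)
  case less
  show ?case
  proof (cases "\<exists>x. poly p x = 0")
    case False
    then have "set_mset (proots p) = {}" using less.prems by simp
    then have "proots p = {#}" by (simp only: set_mset_eq_empty_iff)
    then show ?thesis using False by (intro exI[of _ p]) simp
  next
    case True
    then obtain x p' where x: "p = [:-x, 1:] * p'"
      by (auto simp: poly_eq_0_iff_dvd elim!: dvdE)
    then have p': "p' \<noteq> 0" using less.prems by auto
    have "degree p = Suc (degree p')" using p' unfolding x by (subst degree_mult_eq) auto
    then obtain R where R: "p' = (\<Prod>r\<in>#proots p'. [:-r, 1:]) * R" "\<forall>x. poly R x \<noteq> 0"
      using less.hyps[of p'] p' by auto
    have "proots p = add_mset x (proots p')"
      unfolding x using p' by (subst proots_mult) auto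
    then have "p = (\<Prod>r\<in>#proots p. [:-r, 1:]) * R"
      by (simp only: image_mset_add_mset prod_mset.add_mset mult.assoc R(1)[symmetric] x[symmetric])
    then show ?thesis using R(2) by blast
  qed
qed

abbreviation cpoly :: "real poly \<Rightarrow> complex poly" where
  "cpoly \<equiv> map_poly complex_of_real"

lemma poly_cpoly: "poly (cpoly p) (of_real x) = of_real (poly p x)"
  by (induction p) (auto simp: map_poly_pCons)

lemma cpoly_mult: "cpoly (p * q) = cpoly p * cpoly q"
  by (rule poly_eqI) (simp add: coeff_map_poly coeff_mult)

lemma cpoly_add: "cpoly (p + q) = cpoly p + cpoly q"
  by (rule poly_eqI) (simp add: coeff_map_poly)

lemma cpoly_diff: "cpoly (p - q) = cpoly p - cpoly q"
  by (rule poly_eqI) (simp add: coeff_map_poly)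

lemma cpoly_smult: "cpoly (smult c p) = smult (of_real c) (cpoly p)"
  by (rule poly_eqI) (simp add: coeff_map_poly)

lemma cpoly_sum: "cpoly (\<Sum>i\<in>I. f i) = (\<Sum>i\<in>I. cpoly (f i))"
  by (induction I rule: infinite_finite_induct) (auto simp: cpoly_add)

lemma cpoly_eq_0_iff: "cpoly p = 0 \<longleftrightarrow> p = 0"
  by (simp add: map_poly_eq_0_iff)

lemma degree_cpoly: "degree (cpoly p) = degree p"
  by (rule degree_map_poly) simp

lemma cpoly_linear: "cpoly [:a, b:] = [:of_real a, of_real b:]"
  by (simp add: map_poly_pCons)

lemma pderiv_cpoly: "pderiv (cpoly p) = cpoly (pderiv p)"
  by (rule poly_eqI) (simp add: coeff_map_poly coeff_pderiv)

lemma cpoly_linear_factors: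
  "cpoly (\<Prod>r\<in>#M. [:-r, 1:]) = (\<Prod>r\<in>#image_mset of_real M. [:-r, 1:])"
  by (induction M) (simp_all only: image_mset_add_mset prod_mset.add_mset cpoly_mult cpoly_linear image_mset_empty
     prod_mset_empty of_real_minus of_real_1 map_poly_1')

lemma degree_linear_factors:
  "degree (\<Prod>r\<in>#M. [:-r, 1 :: 'a :: idom:]) = size M"
  "(\<Prod>r\<in>#M. [:-r, 1 :: 'a :: idom:]) \<noteq> 0"
proof -
  have "degree (\<Prod>r\<in>#M. [:-r, 1 :: 'a :: idom:]) = size M \<and> (\<Prod>r\<in>#M. [:-r, 1 :: 'a :: idom:]) \<noteq> 0"
  proof (induction M)
    case (add x M)
    let ?P = "\<Prod>r\<in>#M. [:-r, 1 :: 'a :: idom:]"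
    have "degree ([:-x, 1:] * ?P) = Suc (size M) \<and> [:-x, 1:] * ?P \<noteq> 0"
      using add by (subst degree_mult_eq) (auto simp del: mult_pCons_left)
    then show ?case
      by (simp only: image_mset_add_mset prod_mset.add_mset size_add_mset) simp
  qed auto
  then show "degree (\<Prod>r\<in>#M. [:-r, 1 :: 'a :: idom:]) = size M"
  "(\<Prod>r\<in>#M. [:-r, 1 :: 'a :: idom:]) \<noteq> 0" by auto
qed

lemma proots_linear_factors:
  "proots (\<Prod>r\<in>#M. [:-r, 1 :: 'a :: idom:]) = M"
proof (induction M)
  case (add x M)
  have "proots ([:-x, 1:] * (\<Prod>r\<in>#M. [:-r, 1 :: 'a:])) = add_mset x M"
    by (subst proots_mult) (use add degree_linear_factors(2)[of M] in auto)
  then show ?case by (simp only: image_mset_add_mset prod_mset.add_mset)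
qed simp

text \<open>
  Split off the real linear factors. The remaining real polynomial has no real zero, so all its
  complex zeros are the non-real zeros of \<open>p\<close>.
\<close>
lemma degree_eq_real_plus_nonreal:
  assumes "p \<noteq> 0"
  shows "degree p = size (proots p) + num_nonreal_zeros p"
proof -
  obtain R where R: "p = (\<Prod>r\<in>#proots p. [:-r, 1:]) * R" "\<forall>x. poly R x \<noteq> 0"
    using linear_factors_times_rootfree[OF assms] by blast
  have R0: "R \<noteq> 0" using R(2) by auto
  have "cpoly p = (\<Prod>r\<in>#image_mset of_real (proots p). [:-r, 1:]) * cpoly R"
    by (subst R(1)) (simp add: cpoly_mult cpoly_linear_factors)
  then have "proots (cpoly p) = image_mset of_real (proots p) + proots (cpoly R)"
    using degree_linear_factors(2)[of "image_mset complex_of_real (proots p)"] R0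
    by (metis proots_mult proots_linear_factors cpoly_eq_0_iff)
  moreover have "filter_mset (\<lambda>z. z \<notin> \<real>) (image_mset complex_of_real (proots p)) = {#}"
    by (rule filter_mset_eq_empty) auto
  moreover have "filter_mset (\<lambda>z. z \<notin> \<real>) (proots (cpoly R)) = proots (cpoly R)"
    using R(2) R0 by (intro filter_mset_eq_self) (auto simp: cpoly_eq_0_iff elim!: Reals_cases simp: poly_cpoly)
  ultimately have "num_nonreal_zeros p = degree R"
    by (simp add: num_nonreal_zeros_def size_proots_complex degree_cpoly)
  moreover have "degree p = size (proots p) + degree R"
    using degree_mult_eq[OF degree_linear_factors(2)[of "proots p"] R0] degree_linear_factors(1)[of "proots p"] R(1)
    by metis
  ultimately show ?thesis by simp
qed

lemma card_set_mset_le_size: "card (set_mset M) \<le> size M"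
  by (simp add: size_multiset_overloaded_eq) (metis card_eq_sum count_greater_eq_one_iff sum_mono)

lemma count_eq_1_if_size_le_card:
  assumes "size M \<le> card (set_mset M)" "x \<in># M"
  shows "count M x = 1"
proof (rule ccontr)
  assume "count M x \<noteq> 1"
  then have "1 < count M x" using assms(2) by (metis count_greater_eq_one_iff le_neq_implies_less)
  then have "(\<Sum>x\<in>set_mset M. 1) < (\<Sum>x\<in>set_mset M. count M x)"
    using assms(2) by (intro sum_strict_mono_ex1) auto
  then show False using assms(1) by (simp add: size_multiset_overloaded_eq)
qed

text \<open>
  There are at least \<open>m\<close> zeros without and at most \<open>m\<close> zeros with multiplicity, so both numbers
  are \<open>m\<close>.
\<close>
lemma has_simple_real_zerosI:
  assumes "p \<noteq> 0" "zeros_in UNIV m p" "size (proots p) \<le> m"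
  shows "has_simple_real_zeros p m"
proof -
  have s: "set_mset (proots p) = real_zeros p" using assms(1) by (simp add: real_zeros_def)
  have "m \<le> card (real_zeros p)"
    using card_zeros_ge[OF assms(2,1)] by (simp add: real_zeros_def)
  moreover have "card (real_zeros p) \<le> size (proots p)"
    using card_set_mset_le_size[of "proots p"] s by simp
  ultimately have "card (real_zeros p) = m" "size (proots p) \<le> card (set_mset (proots p))"
    using assms(3) s by auto
  moreover from this have "\<forall>x\<in>real_zeros p. order x p = 1"
    using count_eq_1_if_size_le_card[of "proots p"] s assms(1) by (metis count_proots)
  ultimately show ?thesis using assms(1) by (simp add: has_simple_real_zeros_def)
qed

lemma size_filter_disjoint_le:
  assumes "finite I" "disjoint_family_on S I" "\<And>i. i \<in> I \<Longrightarrow> S i \<subseteq> T"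
  shows "(\<Sum>i\<in>I. size (filter_mset (\<lambda>z. z \<in> S i) M)) \<le> size (filter_mset (\<lambda>z. z \<in> T) M)"
proof -
  have "(\<Sum>i\<in>I. size (filter_mset (\<lambda>z. z \<in> S i) M)) = size (filter_mset (\<lambda>z. z \<in> (\<Union>i\<in>I. S i)) M)"
    using assms(1,2)
  proof (induction I rule: finite_induct)
    case (insert i I)
    have d: "S i \<inter> (\<Union>i\<in>I. S i) = {}"
      using insert by (auto simp: disjoint_family_on_def)
    have "filter_mset (\<lambda>z. z \<in> (\<Union>i\<in>insert i I. S i)) M =
       filter_mset (\<lambda>z. z \<in> S i) M + filter_mset (\<lambda>z. z \<in> (\<Union>i\<in>I. S i)) M"
      by (rule multiset_eqI) (use d in auto)
    moreover have "disjoint_family_on S I"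
      using insert.prems by (rule disjoint_family_on_mono[rotated]) auto
    ultimately show ?case using insert by simp
  qed simp
  also have "\<dots> \<le> size (filter_mset (\<lambda>z. z \<in> T) M)"
  proof -
    have "filter_mset (\<lambda>z. z \<in> (\<Union>i\<in>I. S i)) M = filter_mset (\<lambda>z. z \<in> (\<Union>i\<in>I. S i)) (filter_mset (\<lambda>z. z \<in> T) M)"
      unfolding filter_filter_mset by (rule filter_mset_cong) (use assms(3) in auto)
    then show ?thesis by (metis size_filter_mset_lesseq)
  qed
  finally show ?thesis .
qed

section \<open>Interlacing in a pencil of polynomials\<close>

lemma abs_poly_le_far_out:
  fixes g h :: "real poly"
  assumes "degree g < degree h"
  shows "\<exists>B. \<forall>x. \<bar>x\<bar> \<ge> B \<longrightarrow> \<bar>poly g x\<bar> \<le> \<bar>poly h x\<bar>"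
proof -
  have "((\<lambda>x. poly g x / poly h x) \<longlongrightarrow> 0) at_infinity"
    using assms by (rule poly_divide_tendsto_0_at_infinity)
  then have "\<forall>\<^sub>F x in at_infinity. \<bar>poly g x / poly h x\<bar> < 1"
    by (auto simp: tendsto_iff dist_real_def)
  moreover have "\<forall>\<^sub>F x in at_infinity. poly h x \<noteq> 0"
    using filterlim_poly_at_infinity[of h] assms by (auto simp: filterlim_at_infinity_imp_eventually_ne)
  ultimately have "\<forall>\<^sub>F x in at_infinity. \<bar>poly g x\<bar> \<le> \<bar>poly h x\<bar>"
    by eventually_elim (simp add: abs_divide field_simps)
  then show ?thesis by (simp add: eventually_at_infinity)
qed

text \<open>
  Choose the sign of \<open>e\<close> such that \<open>e * g\<close> has the sign of \<open>h\<close> on both sides of its double zero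
  \<open>x0\<close>. Then no zero survives near \<open>x0\<close>, while for small \<open>e\<close> at most one zero survives near each
  simple zero of \<open>h\<close>, as the derivative does not vanish there, and none elsewhere, where \<open>g / h\<close>
  is bounded.
\<close>
lemma perturb_double_zero:
  fixes g h :: "real poly"
  assumes deg: "degree g < degree h"
    and h: "h = [:-x0, 1:] ^ 2 * k" and k: "poly k x0 \<noteq> 0" and g: "poly g x0 \<noteq> 0"
    and simple: "\<And>y. poly h y = 0 \<Longrightarrow> y \<noteq> x0 \<Longrightarrow> poly (pderiv h) y \<noteq> 0"
  shows "\<exists>e. card {x. poly (h + smult e g) x = 0} < card {x. poly h x = 0}"
proof -
  define Z where "Z = {x. poly h x = 0}"
  have h0: "h \<noteq> 0" using deg by auto
  have finZ: "finite Z" unfolding Z_def using h0 by (rule poly_roots_finite)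
  have x0: "x0 \<in> Z" by (simp add: Z_def h)
  define s where "s = poly k x0 * poly g x0"
  have s: "s \<noteq> 0" using k g by (simp add: s_def)
  \<comment> \<open>The perturbation is e = s t with small t > 0. The radius r around a zero y of h serves at the
    same time as a bound for t.\<close>
  let ?P = "\<lambda>y r. r > 0 \<and>
    (\<forall>t. 0 < t \<and> t < r \<longrightarrow> (if y = x0 then \<forall>x\<in>ball y r. poly (h + smult (s * t) g) x \<noteq> 0
        else \<forall>x\<in>ball y r. poly (pderiv (h + smult (s * t) g)) x \<noteq> 0))"
  have "\<exists>r. ?P y r" if y: "y \<in> Z" for y
  proof (cases "y = x0")
    case True
    have "isCont (\<lambda>x. poly k x * (s * poly g x)) x0" by (intro continuous_intros)
    moreover have "poly k x0 * (s * poly g x0) = s * s" by (simp add: s_def)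
    then have "poly k x0 * (s * poly g x0) > 0" using s by (metis not_real_square_gt_zero)
    moreover from calculation(1)
    have "((\<lambda>x. poly k x * (s * poly g x)) \<longlongrightarrow> poly k x0 * (s * poly g x0)) (nhds x0)"
      unfolding continuous_at tendsto_at_iff_tendsto_nhds[of "\<lambda>x. poly k x * (s * poly g x)" x0] .
    ultimately have "\<forall>\<^sub>F x in nhds x0. poly k x * (s * poly g x) > 0"
      using order_tendstoD(1) by blast
    then obtain r where r: "r > 0" "\<And>x. x \<in> ball x0 r \<Longrightarrow> poly k x * (s * poly g x) > 0"
      unfolding eventually_nhds_metric by (auto simp: dist_commute)
    have "poly (h + smult (s * t) g) x \<noteq> 0" if "0 < t" "x \<in> ball x0 r" for t x
    proof
      assume 0: "poly (h + smult (s * t) g) x = 0"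
      \<comment> \<open>Multiplied by k(x), both summands of the perturbed polynomial are nonnegative, and the second
        one is positive.\<close>
      have "0 \<le> (x - x0)\<^sup>2 * (poly k x)\<^sup>2" by simp
      moreover have "0 < t * (poly k x * (s * poly g x))" using r(2)[OF that(2)] that(1) by simp
      ultimately have "0 < poly k x * ((x - x0)\<^sup>2 * poly k x + s * t * poly g x)"
        by (simp add: algebra_simps power2_eq_square)
      also have "(x - x0)\<^sup>2 * poly k x + s * t * poly g x = 0"
        using 0 by (simp add: h)
      finally show False by simp
    qed
    then show ?thesis using True r(1) by auto
  next
    case False
    have y0: "poly (pderiv h) y \<noteq> 0" using simple y False by (simp add: Z_def)
    have "isCont (\<lambda>(x, t). poly (pderiv h) x + s * t * poly (pderiv g) x) (y, 0)"
      by (auto intro!: continuous_intros simp: case_prod_unfold)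
    then have "((\<lambda>(x, t). poly (pderiv h) x + s * t * poly (pderiv g) x) \<longlongrightarrow> poly (pderiv h) y) (nhds (y, 0))"
      unfolding continuous_at
        tendsto_at_iff_tendsto_nhds[of "\<lambda>(x, t). poly (pderiv h) x + s * t * poly (pderiv g) x" "(y, 0)"] by simp
    then have "\<forall>\<^sub>F z in nhds (y, 0). (\<lambda>(x, t). poly (pderiv h) x + s * t * poly (pderiv g) x) z \<noteq> 0"
      using y0 by (rule tendsto_imp_eventually_ne)
    then obtain r where r: "r > 0" "\<And>x t. dist (x, t) (y, 0) < r \<Longrightarrow> poly (pderiv h) x + s * t * poly (pderiv g) x \<noteq> 0"
      unfolding eventually_nhds_metric by auto
    have "poly (pderiv (h + smult (s * t) g)) x \<noteq> 0" if "0 < t" "t < r / 2" "x \<in> ball y (r / 2)" for t x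
    proof -
      have "dist (x, t) (y, 0) \<le> dist x y + dist t 0"
        using sqrt_sum_squares_le_sum[OF zero_le_dist zero_le_dist, of x y t 0] by (simp add: dist_prod_def)
      also have "\<dots> < r" using that by (simp add: dist_commute)
      finally show ?thesis using r(2) by (simp add: pderiv_add pderiv_smult)
    qed
    then show ?thesis using False r(1) by (intro exI[of _ "r / 2"]) auto
  qed
  then obtain r where r: "\<And>y. y \<in> Z \<Longrightarrow> ?P y (r y)" by metis
  \<comment> \<open>Away from the zeros of h the quotient g / h is bounded: on a large interval by compactness,
    and outside of it by comparison of degrees.\<close>
  define F where "F = - (\<Union>y\<in>Z. ball y (r y))"
  have F0: "poly h x \<noteq> 0" if "x \<in> F" for x
    using that r unfolding F_def Z_def by force
  obtain B where B: "\<And>x. \<bar>x\<bar> \<ge> B \<Longrightarrow> \<bar>poly g x\<bar> \<le> \<bar>poly h x\<bar>"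
    using abs_poly_le_far_out[OF deg] by blast
  have "closed F" unfolding F_def by (intro closed_Compl open_UN) auto
  then have "compact (F \<inter> cball 0 B)" by (intro closed_Int_compact) auto
  moreover have "continuous_on (F \<inter> cball 0 B) (\<lambda>x. poly g x / poly h x)"
    using F0 by (intro continuous_intros) auto
  ultimately have "bounded ((\<lambda>x. poly g x / poly h x) ` (F \<inter> cball 0 B))"
    by (intro compact_imp_bounded compact_continuous_image)
  then obtain C where "\<forall>x\<in>F \<inter> cball 0 B. \<bar>poly g x / poly h x\<bar> \<le> C"
    unfolding bounded_iff by auto
  then have C: "\<bar>poly g x / poly h x\<bar> \<le> C" if "x \<in> F" "\<bar>x\<bar> \<le> B" for x
    using that by auto
  define C' where "C' = max C 1"
  have C': "\<bar>poly g x\<bar> \<le> C' * \<bar>poly h x\<bar>" if "x \<in> F" for x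
  proof (cases "\<bar>x\<bar> \<le> B")
    case True
    have "\<bar>poly g x\<bar> \<le> C * \<bar>poly h x\<bar>"
      using C[OF that True] F0[OF that] by (simp add: abs_divide divide_le_eq)
    also have "\<dots> \<le> C' * \<bar>poly h x\<bar>" by (intro mult_right_mono) (auto simp: C'_def)
    finally show ?thesis .
  next
    case False
    then have "\<bar>poly g x\<bar> \<le> 1 * \<bar>poly h x\<bar>" using B[of x] by simp
    also have "\<dots> \<le> C' * \<bar>poly h x\<bar>" by (intro mult_right_mono) (auto simp: C'_def)
    finally show ?thesis .
  qed
  have C'0: "C' > 0" by (simp add: C'_def)
  define t where "t = Min (insert (1 / (\<bar>s\<bar> * C')) (r ` Z)) / 2"
  have tM: "0 < Min (insert (1 / (\<bar>s\<bar> * C')) (r ` Z))"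
    using finZ r s C'0 by (subst Min_gr_iff) auto
  then have t0: "t > 0" by (simp add: t_def)
  have "t < Min (insert (1 / (\<bar>s\<bar> * C')) (r ` Z))" using tM by (simp add: t_def)
  then have t1: "t < 1 / (\<bar>s\<bar> * C')" and t2: "\<And>y. y \<in> Z \<Longrightarrow> t < r y"
    using finZ by (auto simp: Min_gr_iff)
  define q where "q = h + smult (s * t) g"
  define Y where "Y = {x. poly q x = 0}"
  have near: "\<exists>y\<in>Z - {x0}. x \<in> ball y (r y)" if x: "x \<in> Y" for x
  proof -
    have "x \<notin> F"
    proof
      assume xF: "x \<in> F"
      have "\<bar>s * t * poly g x\<bar> \<le> \<bar>s\<bar> * t * (C' * \<bar>poly h x\<bar>)"
        using C'[OF xF] t0 by (simp add: abs_mult mult.assoc mult_left_mono)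
      also have "\<dots> = (\<bar>s\<bar> * C' * t) * \<bar>poly h x\<bar>" by simp
      also have "\<dots> < 1 * \<bar>poly h x\<bar>"
        using t1 s C'0 F0[OF xF] by (intro mult_strict_right_mono) (auto simp: field_simps)
      finally have "poly h x + s * t * poly g x \<noteq> 0" by linarith
      then show False using x by (simp add: Y_def q_def)
    qed
    then obtain y where y: "y \<in> Z" "x \<in> ball y (r y)" by (auto simp: F_def)
    have "y \<noteq> x0" using r[OF y(1)] t0 t2[OF y(1)] y(2) x by (auto simp: Y_def q_def)
    then show ?thesis using y by auto
  qed
  then obtain c where c: "\<And>x. x \<in> Y \<Longrightarrow> c x \<in> Z - {x0} \<and> x \<in> ball (c x) (r (c x))" by metis
  have one: "False" if xy: "x \<in> Y" "y \<in> Y" "c x = c y" "x < y" for x y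
  proof -
    have "\<exists>z>x. z < y \<and> poly q y - poly q x = (y - x) * poly (pderiv q) z"
      using MVT2[OF \<open>x < y\<close>, of "poly q" "poly (pderiv q)"] poly_DERIV by auto
    then obtain z where z: "x < z" "z < y" "poly (pderiv q) z = 0"
      using xy by (auto simp: Y_def)
    have "z \<in> ball (c x) (r (c x))"
      using c[OF xy(1)] c[OF xy(2)] xy(3) z by (auto simp: dist_real_def)
    then show False
      using r[of "c x"] c[OF xy(1)] t0 t2[of "c x"] z(3) by (auto simp: q_def)
  qed
  have "inj_on c Y" by (rule inj_onI) (metis one linorder_neqE)
  then have "card Y \<le> card (Z - {x0})" using c finZ by (intro card_inj_on_le) auto
  also have "\<dots> < card Z" using finZ x0 by (rule card_Diff1_less)
  finally show ?thesis unfolding Y_def q_def Z_def by blast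
qed

lemma order_ge_2:
  fixes p :: "real poly"
  assumes "p \<noteq> 0" "poly p x = 0" "poly (pderiv p) x = 0"
  shows "2 \<le> order x p"
proof -
  obtain q where q: "p = [:-x, 1:] * q" using assms(2) by (auto simp: poly_eq_0_iff_dvd elim!: dvdE)
  have "pderiv p = q + [:-x, 1:] * pderiv q" unfolding q by (subst pderiv_mult) (simp add: pderiv_pCons)
  then have "poly q x = 0" using assms(3) by simp
  then obtain r where r: "q = [:-x, 1:] * r" by (auto simp: poly_eq_0_iff_dvd elim!: dvdE)
  have "[:-x, 1:] ^ 2 dvd p" unfolding q r by (simp only: power2_eq_square mult.assoc[symmetric] dvd_triv_left)
  then show ?thesis using assms(1) by (simp add: order_divides)
qed

text \<open>Without one copy of \<open>x\<close> the multiset is no larger than its support, so it has no repeated element.\<close>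
lemma counts_if_size_le_Suc_card:
  assumes "size M \<le> Suc (card (set_mset M))" "x \<in># M" "count M x \<ge> 2"
  shows "count M x = 2" "size M = Suc (card (set_mset M))" "\<And>y. y \<in># M \<Longrightarrow> y \<noteq> x \<Longrightarrow> count M y = 1"
proof -
  define N where "N = M - {#x#}"
  have M: "M = add_mset x N" using assms(2) by (simp add: N_def)
  have "x \<in># N" using assms(3) unfolding M by (simp flip: count_greater_zero_iff)
  then have s: "set_mset M = set_mset N" unfolding M by auto
  have "size N \<le> card (set_mset N)" using assms(1) s unfolding M by simp
  then have *: "y \<in># N \<Longrightarrow> count N y = 1" for y by (rule count_eq_1_if_size_le_card)
  show "count M x = 2" using *[of x] \<open>x \<in># N\<close> unfolding M by simp
  show "count M y = 1" if "y \<in># M" "y \<noteq> x" for y using *[of y] that s unfolding M by simp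
  show "size M = Suc (card (set_mset M))"
    using card_set_mset_le_size[of N] assms(1) s unfolding M by simp
qed

text \<open>
  If some member of the pencil had a double zero, the bounds \<open>k\<close> for distinct zeros and \<open>k + 1\<close> for
  zeros with multiplicity would be attained, with all other zeros simple. Perturbing in the
  direction of \<open>g\<close>, which stays in the pencil, would then leave fewer than \<open>k\<close> distinct zeros.
  The second hypothesis on \<open>x0\<close> covers common zeros of \<open>f\<close> and \<open>g\<close>, where moving along \<open>g\<close>
  keeps the zero; there the multiplicity three already contradicts the bounds.
\<close>
lemma pencil_no_double_zero:
  fixes f g :: "real poly"
  assumes deg: "degree f = Suc (degree g)"
    and many: "\<And>b. zeros_in UNIV k (f + smult b g)"
    and few: "\<And>b. size (proots (f + smult b g)) \<le> Suc k"
    and x0: "2 \<le> order x0 (f + smult b g)" "poly g x0 = 0 \<Longrightarrow> 3 \<le> order x0 (f + smult b g)"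
  shows False
proof -
  define h where "h = f + smult b g"
  have dh: "degree (f + smult b g) = Suc (degree g)" for b
    using deg degree_smult_le[of b g] by (subst degree_add_eq_left) auto
  have nz: "f + smult b g \<noteq> 0" for b using dh[of b] by auto
  have h0: "h \<noteq> 0" using nz by (simp add: h_def)
  have set: "set_mset (proots h) = {x. poly h x = 0}" using h0 by simp
  have c: "count (proots h) y = order y h" for y using h0 by simp
  have "k \<le> card (set_mset (proots h))"
    using card_zeros_ge[OF many[of b] nz] set by (simp add: h_def)
  then have "size (proots h) \<le> Suc (card (set_mset (proots h)))"
    using few[of b] by (simp add: h_def)
  moreover have x0': "x0 \<in># proots h" using x0(1) h0 by (simp add: h_def[symmetric] order_root)
  ultimately have o: "order x0 h = 2" "size (proots h) = Suc (card (set_mset (proots h)))"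
      "\<And>y. y \<in># proots h \<Longrightarrow> y \<noteq> x0 \<Longrightarrow> order y h = 1"
    using counts_if_size_le_Suc_card[of "proots h" x0] x0(1) c by (auto simp: h_def[symmetric])
  have gx: "poly g x0 \<noteq> 0" using x0(2) o(1) by (auto simp: h_def[symmetric])
  obtain q where q: "h = [:-x0, 1:] ^ 2 * q" "\<not> [:-x0, 1:] dvd q"
    using order_decomp[OF h0, of x0] o(1) by auto
  have qx: "poly q x0 \<noteq> 0" using q(2) by (simp add: poly_eq_0_iff_dvd)
  have "\<exists>e. card {x. poly (h + smult e g) x = 0} < card {x. poly h x = 0}"
  proof (rule perturb_double_zero[OF _ q(1) qx gx])
    show "degree g < degree h" using dh by (simp add: h_def)
    fix y assume "poly h y = 0" "y \<noteq> x0"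
    then have "order y h = 1" using o(3) set by auto
    then show "poly (pderiv h) y \<noteq> 0"
      using order_ge_2[OF h0, of y] \<open>poly h y = 0\<close> by auto
  qed
  then obtain e where e: "card {x. poly (h + smult e g) x = 0} < card {x. poly h x = 0}" by blast
  have he: "h + smult e g = f + smult (b + e) g" by (simp add: h_def smult_add_left add.assoc)
  have "k \<le> card {x. poly (h + smult e g) x = 0}"
    using card_zeros_ge[OF many[of "b + e"] nz] he by simp
  moreover have "card {x. poly h x = 0} \<le> k"
    using o(2) few[of b] set by (simp add: h_def)
  ultimately show False using e by simp
qed

lemma Rolle_quotient:
  fixes f g :: "real poly"
  assumes "a < b" "poly f a = 0" "poly f b = 0" "\<And>x. a \<le> x \<Longrightarrow> x \<le> b \<Longrightarrow> poly g x \<noteq> 0"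
  shows "\<exists>x. a < x \<and> x < b \<and> poly (pderiv f) x * poly g x = poly f x * poly (pderiv g) x"
proof -
  let ?q = "\<lambda>x. poly f x / poly g x"
  have der: "(?q has_real_derivative
     (poly (pderiv f) x * poly g x - poly f x * poly (pderiv g) x) / (poly g x * poly g x)) (at x)"
    if "a \<le> x" "x \<le> b" for x
    using assms(4)[OF that] by (auto intro!: derivative_eq_intros)
  have "\<exists>z>a. z < b \<and> (?q has_real_derivative 0) (at z)"
  proof (rule Rolle[OF assms(1)])
    show "continuous_on {a..b} ?q" using assms(4) by (intro continuous_intros) auto
    show "?q differentiable at x" if "a < x" "x < b" for x
      using der[of x] that real_differentiable_def by fastforce
  qed (use assms in auto)
  then obtain z where z: "a < z" "z < b" "(?q has_real_derivative 0) (at z)" by blast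
  then have "(poly (pderiv f) z * poly g z - poly f z * poly (pderiv g) z) / (poly g z * poly g z) = 0"
    using der[of z] DERIV_unique by force
  then show ?thesis using z assms(4)[of z] by auto
qed

lemma prod_linear_dvd:
  fixes p :: "'a :: field poly"
  assumes "finite C" "\<forall>w\<in>C. poly p w = 0"
  shows "(\<Prod>w\<in>C. [:-w, 1:]) dvd p"
  using assms
proof (induction C rule: finite_induct)
  case (insert w C)
  then obtain q where q: "p = (\<Prod>w\<in>C. [:-w, 1:]) * q" by (auto elim: dvdE)
  have "poly (\<Prod>w\<in>C. [:-w, 1:]) w \<noteq> 0" using insert by (auto simp: poly_prod)
  then have "poly q w = 0" using insert.prems q by auto
  then obtain r where "q = [:-w, 1:] * r" by (auto simp: poly_eq_0_iff_dvd elim!: dvdE)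
  then have "p = (\<Prod>w\<in>insert w C. [:-w, 1:]) * r"
    using q by (simp only: prod.insert[OF insert.hyps] mult_ac)
  then show ?case by (metis dvd_triv_left)
qed simp

text \<open>
  If the smallest element belonged to \<open>V\<close>, mapping each element of \<open>U\<close> to its predecessor in \<open>V\<close>
  would be injective.
\<close>
lemma Min_less_Min_if_card:
  fixes U V :: "real set"
  assumes "finite U" "finite V" "U \<inter> V = {}" "U \<noteq> {}" "V \<noteq> {}" "card V < card U"
    and gap: "\<And>a b. consecutive_in U a b \<Longrightarrow> \<exists>v\<in>V. a < v \<and> v < b"
  shows "Min U < Min V"
proof (rule ccontr)
  assume "\<not> Min U < Min V"
  moreover have MV: "Min V \<in> V" and MU: "Min U \<in> U" using assms by simp_all
  ultimately have less: "Min V < Min U" using assms(3) by force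
  define c where "c u = Max {v \<in> V. v < u}" for u
  have c: "c u \<in> V \<and> c u < u" "v \<in> V \<Longrightarrow> v < u \<Longrightarrow> v \<le> c u" if "u \<in> U" for u v
  proof -
    have "Min U \<le> u" using that assms by simp
    then have "Min V \<in> {v \<in> V. v < u}" using less MV by auto
    then have "c u \<in> {v \<in> V. v < u}" unfolding c_def using assms(2) by (intro Max_in) auto
    then show "c u \<in> V \<and> c u < u" by simp
    show "v \<le> c u" if "v \<in> V" "v < u" unfolding c_def using assms(2) that by (intro Max_ge) auto
  qed
  have "c u < c u'" if u: "u \<in> U" "u' \<in> U" "u < u'" for u u'
  proof -
    define w where "w = Min {w \<in> U. u < w}"
    have ne: "{w \<in> U. u < w} \<noteq> {}" using u by auto
    have w: "w \<in> {w \<in> U. u < w}" unfolding w_def using ne assms(1) by (intro Min_in) auto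
    have wle: "w \<le> x" if "x \<in> U" "u < x" for x
      unfolding w_def using that assms(1) by (intro Min_le) auto
    have "consecutive_in U u w" unfolding consecutive_in_def using u w wle by force
    then obtain v where v: "v \<in> V" "u < v" "v < w" using gap by blast
    have "c u < u" using c(1)[OF u(1)] by simp
    moreover have "v \<le> c u'" using c(2)[OF u(2) v(1)] v wle[OF u(2,3)] by simp
    ultimately show ?thesis using v by simp
  qed
  then have "inj_on c U" by (intro inj_onI) (metis linorder_neqE less_irrefl)
  then have "card U \<le> card V" using c(1) assms(2) by (intro card_inj_on_le) auto
  then show False using assms(6) by simp
qed

text \<open>
  After division by the common zeros, a gap between consecutive zeros of one polynomial without a
  zero of the other one contains a critical point \<open>x\<close> of their quotient. The member of the pencil
  that vanishes at \<open>x\<close> then has a double zero there.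
\<close>
lemma pencil_interlaces:
  fixes f g :: "real poly"
  assumes deg: "degree f = Suc (degree g)"
    and f: "has_simple_real_zeros f (Suc k)" and g: "has_simple_real_zeros g k"
    and many: "\<And>b. zeros_in UNIV k (f + smult b g)"
    and few: "\<And>b. size (proots (f + smult b g)) \<le> Suc k"
  shows "interlaces (real_zeros f) (real_zeros g)"
proof -
  define C where "C = real_zeros f \<inter> real_zeros g"
  have f0: "f \<noteq> 0" and g0: "g \<noteq> 0" using f g by (auto simp: has_simple_real_zeros_def)
  have finf: "finite (real_zeros f)" and fing: "finite (real_zeros g)"
    using f0 g0 by (auto simp: real_zeros_def poly_roots_finite)
  then have finC: "finite C" by (simp add: C_def)
  define d where "d = (\<Prod>w\<in>C. [:-w, 1:])"
  have "d dvd f" "d dvd g"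
    unfolding d_def by (rule prod_linear_dvd; use finC in \<open>simp add: C_def real_zeros_def\<close>)+
  then obtain f1 g1 where f1: "f = d * f1" and g1: "g = d * g1" by (auto elim!: dvdE)
  have d_root: "poly d x = 0 \<longleftrightarrow> x \<in> C" for x
    using finC by (auto simp: d_def poly_prod)
  have d0: "d \<noteq> 0" using f0 f1 by auto
  have roots: "{x. poly p1 x = 0} = real_zeros p - C"
    if "p = d * p1" "has_simple_real_zeros p l" "C \<subseteq> real_zeros p" for p p1 l
  proof -
    have "x \<notin> C" if x: "poly p1 x = 0" for x
    proof
      assume xC: "x \<in> C"
      have p0: "p \<noteq> 0" using \<open>has_simple_real_zeros p l\<close> by (simp add: has_simple_real_zeros_def)
      have "order x p = order x d + order x p1" using p0 \<open>p = d * p1\<close> by (simp add: order_mult)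
      moreover have "order x d \<noteq> 0" using xC d_root[of x] d0 by (simp add: order_root)
      moreover have "order x p1 \<noteq> 0" using x p0 \<open>p = d * p1\<close> by (auto simp: order_root)
      moreover have "order x p = 1"
        using \<open>has_simple_real_zeros p l\<close> xC \<open>C \<subseteq> real_zeros p\<close> by (auto simp: has_simple_real_zeros_def)
      ultimately show False by simp
    qed
    then show ?thesis using \<open>p = d * p1\<close> d_root by (auto simp: real_zeros_def)
  qed
  define U where "U = real_zeros f - C"
  define V where "V = real_zeros g - C"
  have U: "U = {x. poly f1 x = 0}" unfolding U_def by (rule roots[OF f1 f, symmetric]) (simp add: C_def)
  have V: "V = {x. poly g1 x = 0}" unfolding V_def by (rule roots[OF g1 g, symmetric]) (simp add: C_def)
  have no: "False" if W: "poly (pderiv f1) x * poly g1 x = poly f1 x * poly (pderiv g1) x" and gx: "poly g1 x \<noteq> 0" for x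
  proof -
    define b where "b = - poly f1 x / poly g1 x"
    define h1 where "h1 = f1 + smult b g1"
    have h: "f + smult b g = d * h1" by (simp add: f1 g1 h1_def algebra_simps)
    have dh: "degree (f + smult b g) = Suc (degree g)"
      using deg degree_smult_le[of b g] by (subst degree_add_eq_left) auto
    then have h0: "d * h1 \<noteq> 0" using h by auto
    have 1: "2 \<le> order x h1"
    proof (rule order_ge_2)
      show "h1 \<noteq> 0" using h0 by auto
      show "poly h1 x = 0" using gx by (simp add: h1_def b_def)
      have "b * poly g1 x = - poly f1 x" using gx by (simp add: b_def)
      then have "(b * poly g1 x) * poly (pderiv g1) x = - poly f1 x * poly (pderiv g1) x" by simp
      then have "poly (pderiv h1) x * poly g1 x = 0"
        using W by (simp add: h1_def pderiv_add pderiv_smult algebra_simps)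
      then show "poly (pderiv h1) x = 0" using gx by simp
    qed
    have o: "order x (f + smult b g) = order x d + order x h1" unfolding h using h0 by (rule order_mult)
    \<comment> \<open>At a common zero of f and g, the divisor d contributes one more to the multiplicity.\<close>
    have 2: "order x d \<noteq> 0" if "poly g x = 0"
      using that gx d0 by (simp add: g1 order_root)
    show False
      by (rule pencil_no_double_zero[OF deg many few, of x b]) (use 1 2 o in linarith)+
  qed
  have gapU: "\<exists>v\<in>V. a < v \<and> v < b" if ab: "consecutive_in U a b" for a b
  proof (rule ccontr)
    assume nov: "\<not> (\<exists>v\<in>V. a < v \<and> v < b)"
    have ab': "a \<in> U" "b \<in> U" "a < b" using ab by (auto simp: consecutive_in_def)
    have "U \<inter> V = {}" by (auto simp: U_def V_def C_def)
    then have nz: "poly g1 x \<noteq> 0" if "a \<le> x" "x \<le> b" for x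
      using nov ab' that V by (metis (mono_tags, lifting) disjoint_iff mem_Collect_eq order_le_less)
    then obtain x where "a < x" "x < b" "poly (pderiv f1) x * poly g1 x = poly f1 x * poly (pderiv g1) x"
      using Rolle_quotient[of a b f1 g1] ab' U by auto
    then show False using no nz[of x] by auto
  qed
  have gapV: "\<exists>u\<in>U. a < u \<and> u < b" if ab: "consecutive_in V a b" for a b
  proof (rule ccontr)
    assume nou: "\<not> (\<exists>u\<in>U. a < u \<and> u < b)"
    have ab': "a \<in> V" "b \<in> V" "a < b" "\<And>x. a < x \<Longrightarrow> x < b \<Longrightarrow> x \<notin> V"
      using ab by (auto simp: consecutive_in_def)
    have "U \<inter> V = {}" by (auto simp: U_def V_def C_def)
    then have nz: "poly f1 x \<noteq> 0" if "a \<le> x" "x \<le> b" for x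
      using nou ab' that U by (metis (mono_tags, lifting) disjoint_iff mem_Collect_eq order_le_less)
    then obtain x where x: "a < x" "x < b" "poly (pderiv g1) x * poly f1 x = poly g1 x * poly (pderiv f1) x"
      using Rolle_quotient[of a b g1 f1] ab' V by auto
    then have "poly g1 x \<noteq> 0" using ab'(4)[of x] V by auto
    then show False using no[of x] x by (simp add: mult.commute)
  qed
  have "card U = Suc k - card C" "card V = k - card C" "card C \<le> k"
    unfolding U_def V_def using f g finf fing finC
    by (auto simp: has_simple_real_zeros_def C_def card_Diff_subset intro: card_mono)
  then have card: "card V < card U" by simp
  have fin: "finite U" "finite V" using finf fing by (auto simp: U_def V_def)
  have U0: "U \<noteq> {}" using card by auto
  have "V \<noteq> {} \<longrightarrow> Min U < Min V"
    using Min_less_Min_if_card[OF fin _ U0 _ card] gapU by (auto simp: U_def V_def C_def)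
  then show ?thesis
    unfolding interlaces_def C_def[symmetric] U_def[symmetric] V_def[symmetric] strictly_interlaces_def
    using fin U0 gapU gapV by blast
qed

section \<open>Ratio asymptotics off the half-line\<close>

lemma linear_factors_log_derivative:
  fixes x :: "'a :: field"
  assumes "finite X" "x \<notin> X"
  defines "P \<equiv> \<Prod>y\<in>X. [:-y, 1:]"
  shows "poly P x \<noteq> 0"
    "poly (pderiv P) x = (\<Sum>y\<in>X. 1 / (x - y)) * poly P x"
    "poly (pderiv (pderiv P)) x = ((\<Sum>y\<in>X. 1 / (x - y))\<^sup>2 - (\<Sum>y\<in>X. 1 / (x - y)\<^sup>2)) * poly P x"
proof -
  have "poly P x \<noteq> 0 \<and> poly (pderiv P) x = (\<Sum>y\<in>X. 1 / (x - y)) * poly P x \<and>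
    poly (pderiv (pderiv P)) x = ((\<Sum>y\<in>X. 1 / (x - y))\<^sup>2 - (\<Sum>y\<in>X. 1 / (x - y)\<^sup>2)) * poly P x"
    using assms(1,2) unfolding P_def
  proof (induction X rule: finite_induct)
    case (insert y X)
    let ?P = "\<Prod>y\<in>X. [:-y, 1:]"
    let ?A = "\<Sum>y\<in>X. 1 / (x - y)" and ?B = "\<Sum>y\<in>X. 1 / (x - y)\<^sup>2"
    have P: "(\<Prod>y\<in>insert y X. [:-y, 1:]) = [:-y, 1:] * ?P"
      by (rule prod.insert[OF insert.hyps])
    have IH: "poly ?P x \<noteq> 0" "poly (pderiv ?P) x = ?A * poly ?P x"
      "poly (pderiv (pderiv ?P)) x = (?A\<^sup>2 - ?B) * poly ?P x" and xy: "x - y \<noteq> 0"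
      using insert by auto
    have d1: "pderiv ([:-y, 1:] * ?P) = ?P + [:-y, 1:] * pderiv ?P"
      by (subst pderiv_mult) (simp add: pderiv_pCons)
    have d2: "pderiv (pderiv ([:-y, 1:] * ?P)) = 2 * pderiv ?P + [:-y, 1:] * pderiv (pderiv ?P)"
      unfolding d1 by (subst pderiv_add, subst pderiv_mult) (simp add: pderiv_pCons)
    have A: "(\<Sum>y\<in>insert y X. 1 / (x - y)) = 1 / (x - y) + ?A"
      and B: "(\<Sum>y\<in>insert y X. 1 / (x - y)\<^sup>2) = 1 / (x - y)\<^sup>2 + ?B"
      using insert.hyps by simp_all
    define u where "u = 1 / (x - y)"
    have u: "(x - y) * u = 1" using xy by (simp add: u_def)
    have u2: "1 / (x - y)\<^sup>2 = u\<^sup>2" by (simp add: u_def power_one_over)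
    show ?case
    proof (intro conjI)
      show "poly (\<Prod>y\<in>insert y X. [:-y, 1:]) x \<noteq> 0"
        unfolding P using IH(1) xy by simp
      have "poly (pderiv ([:-y, 1:] * ?P)) x = poly ?P x + (x - y) * (?A * poly ?P x)"
        unfolding d1 by (simp add: IH algebra_simps)
      also have "\<dots> = ((x - y) * u) * poly ?P x + (x - y) * (?A * poly ?P x)" by (simp only: u) simp
      finally show "poly (pderiv (\<Prod>y\<in>insert y X. [:-y, 1:])) x =
          (\<Sum>y\<in>insert y X. 1 / (x - y)) * poly (\<Prod>y\<in>insert y X. [:-y, 1:]) x"
        unfolding P A u_def[symmetric] by (simp add: algebra_simps)
      have "poly (pderiv (pderiv ([:-y, 1:] * ?P))) x = 2 * ?A * poly ?P x + (x - y) * ((?A\<^sup>2 - ?B) * poly ?P x)"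
        unfolding d2 by (simp add: IH algebra_simps)
      also have "\<dots> = ((x - y) * u) * (2 * ?A * poly ?P x) + (x - y) * ((?A\<^sup>2 - ?B) * poly ?P x)"
        by (simp only: u) simp
      finally show "poly (pderiv (pderiv (\<Prod>y\<in>insert y X. [:-y, 1:]))) x =
          ((\<Sum>y\<in>insert y X. 1 / (x - y))\<^sup>2 - (\<Sum>y\<in>insert y X. 1 / (x - y)\<^sup>2)) *
          poly (\<Prod>y\<in>insert y X. [:-y, 1:]) x"
        unfolding P A B u_def[symmetric] u2 by (simp add: algebra_simps power2_eq_square)
    qed
  qed simp
  then show "poly P x \<noteq> 0"
    "poly (pderiv P) x = (\<Sum>y\<in>X. 1 / (x - y)) * poly P x"
    "poly (pderiv (pderiv P)) x = ((\<Sum>y\<in>X. 1 / (x - y))\<^sup>2 - (\<Sum>y\<in>X. 1 / (x - y)\<^sup>2)) * poly P x"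
    by auto
qed

lemma laguerre_lift_1: "laguerre_lift n a 1 = laguerre a n"
  by (simp add: laguerre_lift_def)

lemma laguerre_linear_factors:
  assumes "a \<ge> -1"
  obtains X c where "finite X" "X \<subseteq> {0..}" "card X = n" "c \<noteq> 0"
    "laguerre a n = smult c (\<Prod>y\<in>X. [:-y, 1:])"
proof -
  have "zeros_in {0..} n (laguerre a n)"
    using zeros_in_laguerre_lift[OF assms, of n 1] by (simp add: laguerre_lift_1)
  then obtain X where X: "X \<subseteq> {0..}" "finite X" "card X = n" "\<forall>x\<in>X. poly (laguerre a n) x = 0"
    unfolding zeros_in_def by blast
  let ?P = "\<Prod>y\<in>X. [:-y, 1:]"
  obtain r where r: "laguerre a n = ?P * r"
    using prod_linear_dvd[OF X(2,4)] by (auto elim: dvdE)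
  have nz: "?P \<noteq> 0" "r \<noteq> 0" using r laguerre_neq_0[of a n] by auto
  have "degree ?P = n"
    using degree_linear_factors(1)[of "mset_set X"] X by (simp add: prod_unfold_prod_mset)
  then have "degree r = 0"
    using degree_mult_eq[OF nz] r degree_laguerre[of a n] by simp
  then obtain c where "r = [:c:]" by (rule degree_eq_zeroE)
  then show ?thesis using that[of X c] X nz(2) r by (auto simp: mult.commute)
qed

definition log_deriv :: "complex poly \<Rightarrow> complex \<Rightarrow> complex" where
  "log_deriv p x = poly (pderiv p) x / poly p x"

text \<open>
  The zeros \<open>y\<close> of the Laguerre polynomial are simple and nonnegative, so its logarithmic derivative
  \<open>A\<close> is the sum of all \<open>1 / (x - y)\<close>, and minus the derivative of \<open>A\<close> is the sum \<open>B\<close> of their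
  squares. The differential equation becomes a Riccati equation for \<open>A\<close>. The two sign conditions
  hold for each summand; they will select the right one of the two roots of the limit equation.
\<close>
lemma laguerre_log_deriv:
  fixes x :: complex and n :: nat
  assumes a: "a \<ge> -1" and D: "D > 0" "\<forall>y\<ge>0. D \<le> norm (x - of_real y)"
  defines "A \<equiv> log_deriv (cpoly (laguerre a n)) x"
  shows "poly (cpoly (laguerre a n)) x \<noteq> 0"
    and "norm A \<le> real n / D"
    and "\<exists>B. norm B \<le> real n / D\<^sup>2 \<and> x * (A\<^sup>2 - B) + (of_real a + 1 - x) * A + of_nat n = 0"
    and "Im x * Im A \<le> 0"
    and "Re x < 0 \<Longrightarrow> Re A \<le> 0"
proof -
  let ?L = "cpoly (laguerre a n)"
  obtain X c where X: "finite X" "X \<subseteq> {0..}" "card X = n" "c \<noteq> 0" "laguerre a n = smult c (\<Prod>y\<in>X. [:-y, 1:])"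
    by (rule laguerre_linear_factors[OF a, of n])
  define Y where "Y = complex_of_real ` X"
  define P where "P = (\<Prod>y\<in>Y. [:-y, 1:])"
  have "cpoly (\<Prod>y\<in>X. [:-y, 1:]) = P"
    using cpoly_linear_factors[of "mset_set X"]
    by (simp add: prod_unfold_prod_mset P_def Y_def image_mset_mset_set inj_on_def)
  then have L: "?L = smult (of_real c) P" by (simp add: X(5) cpoly_smult)
  have finY: "finite Y" "card Y = n" using X by (auto simp: Y_def card_image inj_on_def)
  have dist: "D \<le> norm (x - y)" if "y \<in> Y" for y using that X D by (auto simp: Y_def)
  have xY: "x \<notin> Y" using dist D by fastforce
  let ?A = "\<Sum>y\<in>Y. 1 / (x - y)" and ?B = "\<Sum>y\<in>Y. 1 / (x - y)\<^sup>2"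
  note P = linear_factors_log_derivative[OF finY(1) xY, folded P_def]
  have A: "A = ?A" using P X(4) by (simp add: A_def log_deriv_def L pderiv_smult)
  show L0: "poly ?L x \<noteq> 0" using P X(4) by (simp add: L)
  have "norm ?A \<le> (\<Sum>y\<in>Y. 1 / D)"
    using dist D(1) by (intro sum_norm_le) (simp only: norm_divide norm_one frac_le)
  then show "norm A \<le> real n / D" using finY A by simp
  have "norm ?B \<le> (\<Sum>y\<in>Y. 1 / D\<^sup>2)"
  proof (intro sum_norm_le)
    fix y assume "y \<in> Y"
    then have "D\<^sup>2 \<le> (norm (x - y))\<^sup>2" using dist D by (intro power_mono) auto
    then show "norm (1 / (x - y)\<^sup>2) \<le> 1 / D\<^sup>2"
      using D(1) by (simp only: norm_divide norm_one norm_power frac_le zero_less_power)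
  qed
  then have B: "norm ?B \<le> real n / D\<^sup>2" using finY by simp
  have "cpoly ([:0, 1:] * pderiv (pderiv (laguerre a n)) + [:a + 1, -1:] * pderiv (laguerre a n)
     + smult (real n) (laguerre a n)) = 0"
    by (simp only: laguerre_ode map_poly_0)
  then have "[:0, 1:] * pderiv (pderiv ?L) + [:of_real a + 1, -1:] * pderiv ?L + smult (of_nat n) ?L = 0"
    by (simp only: cpoly_add cpoly_mult cpoly_linear cpoly_smult pderiv_cpoly of_real_0 of_real_1 of_real_add
       of_real_minus of_real_of_nat_eq)
  then have "poly ([:0, 1:] * pderiv (pderiv ?L) + [:of_real a + 1, -1:] * pderiv ?L + smult (of_nat n) ?L) x = 0"
    by simp
  then have "x * poly (pderiv (pderiv ?L)) x + (of_real a + 1 - x) * poly (pderiv ?L) x + of_nat n * poly ?L x = 0"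
    by (simp add: algebra_simps)
  then have "poly ?L x * (x * (A\<^sup>2 - ?B) + (of_real a + 1 - x) * A + of_nat n) = 0"
    by (simp add: L pderiv_smult P A algebra_simps)
  then show "\<exists>B. norm B \<le> real n / D\<^sup>2 \<and> x * (A\<^sup>2 - B) + (of_real a + 1 - x) * A + of_nat n = 0"
    using L0 B by (intro exI[of _ ?B]) auto
  have "Im x * Im (1 / (x - y)) \<le> 0" if "y \<in> Y" for y
    using that by (auto simp: Y_def Im_divide intro!: divide_nonpos_nonneg simp flip: minus_divide_left power2_eq_square)
  then have "(\<Sum>y\<in>Y. Im x * Im (1 / (x - y))) \<le> 0" by (intro sum_nonpos)
  then show "Im x * Im A \<le> 0" unfolding A by (simp add: sum_distrib_left)
  show "Re A \<le> 0" if "Re x < 0"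
    unfolding A Re_sum using that X(2)
    by (intro sum_nonpos) (auto simp: Y_def Re_divide intro!: divide_nonpos_nonneg)
qed

lemma laguerre_ratio:
  assumes "poly (cpoly (laguerre a (Suc n))) x \<noteq> 0" "real (Suc n) + a \<noteq> 0"
  shows "poly (cpoly (laguerre a n)) x / poly (cpoly (laguerre a (Suc n))) x
    = (of_nat (Suc n) - x * log_deriv (cpoly (laguerre a (Suc n))) x) / of_real (real (Suc n) + a)"
proof -
  let ?L = "\<lambda>n. cpoly (laguerre a n)"
  have "cpoly ([:0, 1:] * pderiv (laguerre a (Suc n)))
     = cpoly (smult (real (Suc n)) (laguerre a (Suc n)) - smult (real (Suc n) + a) (laguerre a n))"
    by (simp only: x_pderiv_laguerre)
  then have "[:0, 1:] * pderiv (?L (Suc n)) = smult (of_nat (Suc n)) (?L (Suc n)) - smult (of_real (real (Suc n) + a)) (?L n)"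
    by (simp only: cpoly_diff cpoly_mult cpoly_linear cpoly_smult pderiv_cpoly of_real_0 of_real_1 of_real_of_nat_eq)
  then have "poly ([:0, 1:] * pderiv (?L (Suc n))) x =
      poly (smult (of_nat (Suc n)) (?L (Suc n)) - smult (of_real (real (Suc n) + a)) (?L n)) x"
    by (rule arg_cong)
  then have "x * poly (pderiv (?L (Suc n))) x = of_nat (Suc n) * poly (?L (Suc n)) x - of_real (real (Suc n) + a) * poly (?L n) x"
    by (simp del: of_nat_Suc of_real_add)
  moreover have "complex_of_real (real (Suc n) + a) \<noteq> 0" using assms(2) by (simp only: of_real_eq_0_iff) simp
  ultimately show ?thesis
    using assms(1) by (simp add: log_deriv_def field_simps del: of_nat_Suc of_real_add)
qed

text \<open>
  Maps the exterior of the unit disc bijectively onto the complement of \<open>[0, 4]\<close>, the interval that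
  the zeros of the Laguerre polynomials fill after division of \<open>x\<close> by the degree. It is a Joukowski
  map, and \<open>1 / z\<close> is the limit of the quotient of neighbouring polynomials at \<open>phi z\<close>.
\<close>
definition phi :: "complex \<Rightarrow> complex" where
  "phi z = 2 - z - 1 / z"

lemma phi_diff: "z \<noteq> 0 \<Longrightarrow> w \<noteq> 0 \<Longrightarrow> phi z - phi w = (z - w) * (1 / (z * w) - 1)"
  by (simp add: phi_def field_simps)

lemma inj_on_phi: "inj_on phi {z. norm z > 1}"
proof (rule inj_onI)
  fix z w :: complex assume zw: "z \<in> {z. norm z > 1}" "w \<in> {z. norm z > 1}" "phi z = phi w"
  have nz: "z \<noteq> 0" "w \<noteq> 0" using zw by auto
  have "norm z * norm w > 1" using zw by (simp add: less_1_mult)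
  then have "z * w \<noteq> 1" by (metis less_irrefl norm_mult norm_one)
  then show "z = w" using phi_diff[OF nz] zw(3) nz by (auto simp: divide_simps)
qed

lemma Im_phi: "z \<noteq> 0 \<Longrightarrow> Im (phi z) = - Im z * (1 - 1 / (norm z)\<^sup>2)"
  by (simp add: phi_def Im_divide cmod_power2 algebra_simps)

lemma one_minus_inverse_norm_square_pos: "norm z > 1 \<Longrightarrow> 1 - 1 / (norm z)\<^sup>2 > 0" for z :: complex
proof -
  assume "norm z > 1"
  then have "(norm z)\<^sup>2 > 1" by (simp add: one_less_power)
  then have "1 / (norm z)\<^sup>2 < 1" by (subst divide_less_eq_1_pos) auto
  then show ?thesis by simp
qed

lemma Im_phi_neq_0:
  assumes "norm z > 1" "Im z \<noteq> 0" shows "Im (phi z) \<noteq> 0"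
proof -
  have "z \<noteq> 0" using assms(1) by auto
  then show ?thesis
    using Im_phi[of z] one_minus_inverse_norm_square_pos[OF assms(1)] assms(2)
    by (metis less_irrefl mult_eq_0_iff neg_equal_0_iff_equal)
qed

lemma phi_of_real_gt_1: "x > 1 \<Longrightarrow> Re (phi (of_real x)) < 0"
proof -
  assume x: "x > 1"
  have "x * (2 - x - 1 / x) = - ((x - 1)\<^sup>2)" using x by (simp add: field_simps power2_eq_square)
  also have "\<dots> < 0" using x by simp
  finally have "2 - x - 1 / x < 0"
    using x mult_nonneg_nonneg[of x "2 - x - 1 / x"] by linarith
  then show ?thesis using x by (simp add: phi_def Re_divide power2_eq_square)
qed

text \<open>
  After the rescaling \<open>x = N * phi z\<close> the Riccati equation tends to \<open>A\<^sup>2 - A + 1 / phi z = 0\<close>, because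
  \<open>B\<close> is of order \<open>1 / N\<close>. The root \<open>1 / (1 - z)\<close> is the one that corresponds to the quotient \<open>1 / z\<close>.
\<close>
lemma riccati_roots:
  assumes "norm z > 1"
  shows "A\<^sup>2 - A + 1 / phi z = (A - 1 / (1 - z)) * (A - z / (z - 1))"
    and "1 / z = 1 - phi z / (1 - z)"
proof -
  have z: "z \<noteq> 0" "z - 1 \<noteq> 0" "1 - z \<noteq> 0" using assms by auto
  have p: "phi z = - ((z - 1)\<^sup>2) / z" using z by (simp add: phi_def field_simps power2_eq_square)
  have w: "1 / (1 - z) = - (1 / (z - 1))" using z by (simp add: field_simps)
  define u where "u = 1 / (z - 1)"
  have u: "(z - 1) * u = 1" using z by (simp add: u_def)
  then have zu: "z * u = 1 + u" by (simp add: algebra_simps)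
  have 1: "1 / phi z = - (z * u * u)" by (simp add: p u_def power2_eq_square)
  have "z / (z - 1) = z * u" by (simp add: u_def)
  then show "A\<^sup>2 - A + 1 / phi z = (A - 1 / (1 - z)) * (A - z / (z - 1))"
    unfolding 1 w u_def[symmetric] zu by (simp add: zu algebra_simps power2_eq_square)
  show "1 / z = 1 - phi z / (1 - z)" using z by (simp add: p field_simps power2_eq_square)
qed

text \<open>
  The imaginary parts of \<open>A\<close> and \<open>phi z\<close> have opposite signs, while those of the root \<open>z / (z - 1)\<close>
  and \<open>phi z\<close> have the same sign.
\<close>
lemma riccati_wrong_root_Im:
  assumes z: "norm z > 1" "Im z \<noteq> 0" and A: "Im (phi z) * Im A \<le> 0"
  shows "\<bar>Im z\<bar> / (norm (z - 1))\<^sup>2 \<le> norm (A - z / (z - 1))"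
proof -
  have z0: "z \<noteq> 0" "z - 1 \<noteq> 0" using z by auto
  have "1 - 1 / (norm z)\<^sup>2 > 0" using z(1) by (rule one_minus_inverse_norm_square_pos)
  moreover have "Im z * Im A * (1 - 1 / (norm z)\<^sup>2) \<ge> 0" using A z0 by (simp add: Im_phi mult_ac)
  ultimately have 1: "Im z * Im A \<ge> 0" by (simp add: zero_le_mult_iff)
  have "z / (z - 1) = 1 + 1 / (z - 1)" using z0 by (simp add: field_simps)
  then have 2: "Im (z / (z - 1)) = - Im z / (norm (z - 1))\<^sup>2"
    by (simp add: Im_divide cmod_power2)
  have "\<bar>Im z\<bar> / (norm (z - 1))\<^sup>2 \<le> \<bar>Im A - Im (z / (z - 1))\<bar>"
  proof (cases "Im z > 0")
    case True
    then have "Im A \<ge> 0" using 1 by (simp add: zero_le_mult_iff)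
    then show ?thesis using True unfolding 2 by (simp add: abs_if)
  next
    case False
    then have n: "Im z < 0" using z by simp
    then have "Im A \<le> 0" using 1 by (simp add: zero_le_mult_iff)
    moreover have "Im z / (norm (z - 1))\<^sup>2 \<le> 0" using n by (simp add: divide_nonpos_nonneg)
    ultimately show ?thesis using n unfolding 2 by (simp add: abs_if)
  qed
  also have "\<dots> \<le> norm (A - z / (z - 1))" using abs_Im_le_cmod[of "A - z / (z - 1)"] by simp
  finally show ?thesis .
qed

text \<open>
  On the negative half-line the imaginary parts do not separate the roots, but the real parts do:
  \<open>1 - z / (z - 1)\<close> is the root \<open>1 / (1 - z)\<close>, with real part less than \<open>1 / 2\<close> for \<open>|z| > 1\<close>,
  so the wrong root has real part greater than \<open>1 / 2\<close>.
\<close>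
lemma riccati_wrong_root_Re:
  assumes z: "norm z > 1" and A: "Re A \<le> 0"
  shows "1 / 2 \<le> norm (A - z / (z - 1))"
proof -
  have z0: "z - 1 \<noteq> 0" using z by auto
  define w where "w = z - 1"
  have w: "w \<noteq> 0" "norm (w + 1) > 1" using z z0 by (simp_all add: w_def)
  have "(norm (w + 1))\<^sup>2 > 1" using w(2) by (simp add: one_less_power)
  moreover have "(norm (w + 1))\<^sup>2 = (norm w)\<^sup>2 + 2 * Re w + 1"
    unfolding cmod_power2 by (simp add: power2_eq_square algebra_simps)
  ultimately have r: "(norm w)\<^sup>2 + 2 * Re w > 0" by simp
  have "(norm w)\<^sup>2 > 0" using w by simp
  then have "- 1 / 2 < Re w / (norm w)\<^sup>2" using r by (simp add: field_simps)
  moreover have "Re (1 / w) = Re w / (norm w)\<^sup>2" by (simp add: Re_divide cmod_power2)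
  moreover have "z / (z - 1) = 1 + 1 / w" using w(1) by (simp add: w_def field_simps)
  ultimately have "Re (z / (z - 1)) = 1 + Re w / (norm w)\<^sup>2" "- 1 / 2 < Re w / (norm w)\<^sup>2" by simp_all
  then have "Re (z / (z - 1)) > 1 / 2" by linarith
  then have "1 / 2 \<le> \<bar>Re A - Re (z / (z - 1))\<bar>" using A by simp
  also have "\<dots> \<le> norm (A - z / (z - 1))" using abs_Re_le_cmod[of "A - z / (z - 1)"] by simp
  finally show ?thesis .
qed

text \<open>
  The sets on which the limit is uniform after restriction to compact subsets: one of the two
  separations of the roots must work on the whole set.
\<close>
definition off_cut :: "complex set \<Rightarrow> bool" where
  "off_cut S \<longleftrightarrow> (\<forall>z\<in>S. norm z > 1) \<and> ((\<forall>z\<in>S. Im z \<noteq> 0) \<or> (\<forall>z\<in>S. Re (phi z) < 0))"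

lemma off_cut_subset: "off_cut T \<Longrightarrow> S \<subseteq> T \<Longrightarrow> off_cut S"
  unfolding off_cut_def by blast

lemma compact_pos_lower_bound:
  fixes f :: "'a :: topological_space \<Rightarrow> real"
  assumes "compact S" "continuous_on S f" "\<And>x. x \<in> S \<Longrightarrow> f x > 0"
  obtains d where "d > 0" "\<And>x. x \<in> S \<Longrightarrow> d \<le> f x"
proof (cases "S = {}")
  case True then show ?thesis using that[of 1] by simp
next
  case False
  then obtain x where "x \<in> S" "\<forall>y\<in>S. f x \<le> f y"
    using continuous_attains_inf[OF assms(1) _ assms(2)] by blast
  then show ?thesis using that[of "f x"] assms(3) by blast
qed

lemma continuous_on_phi: "0 \<notin> S \<Longrightarrow> continuous_on S phi"
  unfolding phi_def by (intro continuous_intros) auto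

lemma off_cut_bounds:
  assumes "compact S" "off_cut S"
  obtains d where "d > 0"
    "\<And>z y. z \<in> S \<Longrightarrow> y \<ge> 0 \<Longrightarrow> d \<le> norm (phi z - of_real y)"
    "\<And>z A. z \<in> S \<Longrightarrow> Im (phi z) * Im A \<le> 0 \<Longrightarrow> (Re (phi z) < 0 \<Longrightarrow> Re A \<le> 0) \<Longrightarrow>
       d \<le> norm (A - z / (z - 1))"
proof -
  have S: "norm z > 1" if "z \<in> S" for z using assms(2) that by (auto simp: off_cut_def)
  then have z0: "0 \<notin> S" and z1: "1 \<notin> S" by force+
  note cont = continuous_on_phi[OF z0]
  consider (Im) "\<forall>z\<in>S. Im z \<noteq> 0" | (Re) "\<forall>z\<in>S. Re (phi z) < 0"
    using assms(2) by (auto simp: off_cut_def)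
  then show ?thesis
  proof cases
    case Im
    have "Im (phi z) \<noteq> 0" if "z \<in> S" for z
      using Im_phi_neq_0[OF S[OF that]] Im that by blast
    moreover have "continuous_on S (\<lambda>z. \<bar>Im (phi z)\<bar>)" using cont by (intro continuous_intros)
    ultimately obtain d1 where d1: "d1 > 0" "\<And>z. z \<in> S \<Longrightarrow> d1 \<le> \<bar>Im (phi z)\<bar>"
      using compact_pos_lower_bound[OF assms(1), of "\<lambda>z. \<bar>Im (phi z)\<bar>"] by auto
    have "continuous_on S (\<lambda>z. \<bar>Im z\<bar> / (norm (z - 1))\<^sup>2)"
      using z1 by (intro continuous_intros) auto
    moreover have "\<bar>Im z\<bar> / (norm (z - 1))\<^sup>2 > 0" if "z \<in> S" for z
    proof -
      have "z \<noteq> 1" "Im z \<noteq> 0" using that z1 Im by auto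
      then show ?thesis by (intro divide_pos_pos) auto
    qed
    ultimately obtain d2 where d2: "d2 > 0" "\<And>z. z \<in> S \<Longrightarrow> d2 \<le> \<bar>Im z\<bar> / (norm (z - 1))\<^sup>2"
      using compact_pos_lower_bound[OF assms(1)] by blast
    show ?thesis
    proof (rule that[of "min d1 d2"])
      show "min d1 d2 > 0" using d1 d2 by simp
      show "min d1 d2 \<le> norm (phi z - of_real y)" if "z \<in> S" for z y
        using d1(2)[OF that] abs_Im_le_cmod[of "phi z - of_real y"] by simp
      show "min d1 d2 \<le> norm (A - z / (z - 1))" if "z \<in> S" "Im (phi z) * Im A \<le> 0" for z A
        using d2(2)[OF that(1)] riccati_wrong_root_Im[OF S[OF that(1)] _ that(2)] Im that(1) by force
    qed
  next
    case Re
    moreover have "continuous_on S (\<lambda>z. - Re (phi z))" using cont by (intro continuous_intros)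
    ultimately obtain d1 where d1: "d1 > 0" "\<And>z. z \<in> S \<Longrightarrow> d1 \<le> - Re (phi z)"
      using compact_pos_lower_bound[OF assms(1), of "\<lambda>z. - Re (phi z)"] by auto
    show ?thesis
    proof (rule that[of "min d1 (1 / 2)"])
      show "min d1 (1 / 2) > 0" using d1 by simp
      show "min d1 (1 / 2) \<le> norm (phi z - of_real y)" if "z \<in> S" "y \<ge> 0" for z y
        using d1(2)[OF that(1)] that(2) abs_Re_le_cmod[of "phi z - of_real y"] by simp
      show "min d1 (1 / 2) \<le> norm (A - z / (z - 1))" if "z \<in> S" "Re (phi z) < 0 \<Longrightarrow> Re A \<le> 0" for z A
        using riccati_wrong_root_Re[OF S[OF that(1)], of A] Re that by force
    qed
  qed
qed

text \<open>
  The rescaled Riccati equation bounds the product of the distances of \<open>A\<close> to the two roots by a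
  multiple of \<open>1 / N\<close>. The distance to the wrong root stays away from zero, so \<open>A\<close> tends to the other
  root, uniformly with rate \<open>1 / N\<close>. The degree \<open>N - j\<close> differs from the scale \<open>N\<close> by a bounded
  amount and does not affect the limit.
\<close>
lemma laguerre_ratio_limit:
  assumes a: "a \<ge> -1" and S: "compact S" "off_cut S"
  shows "uniform_limit S
     (\<lambda>N z. poly (cpoly (laguerre a (N - Suc j))) (of_nat N * phi z) / poly (cpoly (laguerre a (N - j))) (of_nat N * phi z))
     (\<lambda>z. 1 / z) sequentially"
proof -
  let ?r = "\<lambda>N z. poly (cpoly (laguerre a (N - Suc j))) (of_nat N * phi z) / poly (cpoly (laguerre a (N - j))) (of_nat N * phi z)"
  have S1: "norm z > 1" if "z \<in> S" for z using S(2) that by (auto simp: off_cut_def)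
  then have z0: "0 \<notin> S" by force
  obtain d where d: "d > 0"
    "\<And>z y. z \<in> S \<Longrightarrow> y \<ge> 0 \<Longrightarrow> d \<le> norm (phi z - of_real y)"
    "\<And>z A. z \<in> S \<Longrightarrow> Im (phi z) * Im A \<le> 0 \<Longrightarrow> (Re (phi z) < 0 \<Longrightarrow> Re A \<le> 0) \<Longrightarrow>
       d \<le> norm (A - z / (z - 1))"
    by (rule off_cut_bounds[OF S]) blast
  have "compact (phi ` S)" using continuous_on_phi[OF z0] S(1) by (rule compact_continuous_image)
  then have "bounded (phi ` S)" by (rule compact_imp_bounded)
  then obtain M where M: "M > 0" "\<And>z. z \<in> S \<Longrightarrow> norm (phi z) \<le> M"
    by (auto simp: bounded_pos)
  define C1 where "C1 = 1 / d\<^sup>2 + (\<bar>a\<bar> + 1) / d\<^sup>2 + real j / d"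
  define C2 where "C2 = M * (C1 / d) + 2 * real j + \<bar>a\<bar>"
  have C1: "C1 \<ge> 0" using d by (simp add: C1_def)
  have C2: "C2 \<ge> 0" using M d C1 by (simp add: C2_def)
  have bound: "norm (?r N z - 1 / z) \<le> 2 * C2 / N" if N: "N \<ge> 2 * j + 3" and z: "z \<in> S" for N z
  proof -
    define n where "n = N - j"
    have n: "n > 0" "N - j = Suc (n - 1)" "N - Suc j = n - 1" "real n = real N - real j" and Suc: "Suc (n - 1) = n"
      using N by (auto simp: n_def)
    have Np: "real N > 0" using N by simp
    define x where "x = of_nat N * phi z"
    have Dy: "real N * d \<le> norm (x - of_real y)" if "y \<ge> 0" for y
    proof -
      have "x - of_real y = of_nat N * (phi z - of_real (y / real N))" using Np by (simp add: x_def field_simps)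
      then have "norm (x - of_real y) = real N * norm (phi z - of_real (y / real N))" by (simp add: norm_mult)
      then show ?thesis using d(2)[OF z, of "y / real N"] that Np by (simp add: mult_left_mono)
    qed
    then have D: "\<forall>y\<ge>0. real N * d \<le> norm (x - of_real y)" by blast
    have D0: "real N * d > 0" using d Np by simp
    define A where "A = log_deriv (cpoly (laguerre a n)) x"
    note log = laguerre_log_deriv[OF a D0 D, of n, folded A_def]
    obtain B where B: "norm B \<le> real n / (real N * d)\<^sup>2" "x * (A\<^sup>2 - B) + (of_real a + 1 - x) * A + of_nat n = 0"
      using log(3) by blast
    have nN: "real n \<le> real N" using n by simp
    have "norm A \<le> real N / (real N * d)"
      by (rule order_trans[OF log(2)]) (intro divide_right_mono nN, use D0 in simp)
    then have A: "norm A \<le> 1 / d" using Np by simp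
    have "norm B \<le> real N / (real N * d)\<^sup>2"
      by (rule order_trans[OF B(1)]) (intro divide_right_mono nN, use D0 in simp)
    then have Bn: "norm B \<le> (1 / d\<^sup>2) / N" using Np by (simp add: power2_eq_square mult_ac)
    have xn: "real N * d \<le> norm x" using Dy[of 0] by simp
    then have x0: "x \<noteq> 0" using D0 by auto
    have p0: "phi z \<noteq> 0" using x0 by (auto simp: x_def)
    have z1: "z \<noteq> 0" using z z0 by auto
    have nc: "complex_of_nat n = of_nat N - of_nat j"
      using N by (simp add: n_def of_nat_diff)
    have "1 / phi z = of_nat N / x" using Np p0 by (simp add: x_def)
    moreover have "A\<^sup>2 - A + of_nat N / x = B - (of_real a + 1) * A / x + of_nat j / x"
      using B(2) x0 nc by (simp add: field_simps)
    ultimately have "(A - 1 / (1 - z)) * (A - z / (z - 1)) = B - (of_real a + 1) * A / x + of_nat j / x"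
      using riccati_roots(1)[OF S1[OF z], of A] by simp
    then have "norm (A - 1 / (1 - z)) * norm (A - z / (z - 1)) = norm (B - (of_real a + 1) * A / x + of_nat j / x)"
      by (metis norm_mult)
    also have "\<dots> \<le> norm B + norm ((of_real a + 1) * A / x) + norm (of_nat j / x)"
      by (metis (no_types, opaque_lifting) add_mono norm_triangle_ineq norm_triangle_ineq4 order_refl order_trans)
    also have "\<dots> \<le> (1 / d\<^sup>2) / N + (\<bar>a\<bar> + 1) * (1 / d) / (real N * d) + real j / (real N * d)"
    proof (intro add_mono Bn)
      have "norm (complex_of_real a + 1) \<le> \<bar>a\<bar> + 1"
        by (metis norm_of_real norm_one norm_triangle_ineq)
      then show "norm ((of_real a + 1) * A / x) \<le> (\<bar>a\<bar> + 1) * (1 / d) / (real N * d)"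
        unfolding norm_divide norm_mult using A xn D0 d(1) by (intro frac_le mult_mono) auto
      show "norm (of_nat j / x) \<le> real j / (real N * d)"
        unfolding norm_divide using xn D0 by (intro frac_le) auto
    qed
    also have "\<dots> = C1 / N" using Np d by (simp add: C1_def field_simps power2_eq_square)
    finally have *: "norm (A - 1 / (1 - z)) * norm (A - z / (z - 1)) \<le> C1 / N" .
    have "Im (phi z) * Im A \<le> 0"
      using log(4) Np by (simp add: x_def mult.assoc mult_le_0_iff)
    moreover have "Re A \<le> 0" if "Re (phi z) < 0"
      using log(5) that Np by (simp add: x_def mult_less_0_iff)
    ultimately have "d \<le> norm (A - z / (z - 1))" using d(3)[OF z] by blast
    then have "norm (A - 1 / (1 - z)) * d \<le> C1 / N"
      using * mult_left_mono[of d "norm (A - z / (z - 1))" "norm (A - 1 / (1 - z))"] by simp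
    then have near: "norm (A - 1 / (1 - z)) \<le> C1 / d / N" using d Np by (simp add: field_simps)
    have na: "real n + a > 0" "real N \<le> 2 * (real n + a)" using a N n(4) by auto
    have r: "?r N z = (of_nat n - x * A) / of_real (real n + a)"
      using laguerre_ratio[of a "n - 1" x] log(1) na(1) unfolding n(2,3) Suc A_def x_def by simp
    have "of_real (real n + a) * (?r N z - 1 / z) = of_nat n - x * A - of_real (real n + a) * (1 / z)"
      unfolding r right_diff_distrib using na(1) by (simp del: of_real_add)
    also have "\<dots> = of_nat N * (1 - phi z * A - 1 / z) - of_nat j + (of_nat j - of_real a) / z"
      by (simp add: x_def nc diff_divide_distrib add_divide_distrib algebra_simps)
    also have "1 - phi z * A - 1 / z = phi z * (1 / (1 - z) - A)"
      using riccati_roots(2)[OF S1[OF z]] by (simp add: algebra_simps)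
    finally have "real n + a * 1 > 0 \<Longrightarrow> (real n + a) * norm (?r N z - 1 / z) =
        norm (of_nat N * (phi z * (1 / (1 - z) - A)) - of_nat j + (of_nat j - of_real a) / z)"
      by (metis abs_of_pos mult.right_neutral norm_mult norm_of_real)
    then have "(real n + a) * norm (?r N z - 1 / z) =
        norm (of_nat N * (phi z * (1 / (1 - z) - A)) - of_nat j + (of_nat j - of_real a) / z)"
      using na by simp
    also have "\<dots> \<le> norm (of_nat N * (phi z * (1 / (1 - z) - A))) + norm (of_nat j :: complex) + norm ((of_nat j - of_real a) / z)"
      by (metis (no_types, opaque_lifting) add_mono norm_triangle_ineq norm_triangle_ineq4 order_refl order_trans)
    also have "\<dots> \<le> M * (C1 / d) + real j + (real j + \<bar>a\<bar>)"
    proof (intro add_mono)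
      have "norm (phi z * (1 / (1 - z) - A)) \<le> M * (C1 / d / N)"
        unfolding norm_mult using near M(1) M(2)[OF z] by (intro mult_mono) (auto simp: norm_minus_commute)
      then have "real N * norm (phi z * (1 / (1 - z) - A)) \<le> real N * (M * (C1 / d / N))"
        using Np by (intro mult_left_mono) auto
      also have "\<dots> = M * (C1 / d)" using Np by simp
      finally show "norm (of_nat N * (phi z * (1 / (1 - z) - A))) \<le> M * (C1 / d)"
        by (simp only: norm_mult[of "of_nat N"] norm_of_nat)
      have "norm (of_nat j - complex_of_real a) \<le> real j + \<bar>a\<bar>"
        by (metis norm_of_nat norm_of_real norm_triangle_ineq4)
      then have "norm ((of_nat j - complex_of_real a) / z) \<le> (real j + \<bar>a\<bar>) / 1"
        unfolding norm_divide using S1[OF z] by (intro frac_le) auto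
      then show "norm ((of_nat j - complex_of_real a) / z) \<le> real j + \<bar>a\<bar>" by simp
    qed simp
    also have "\<dots> = C2" by (simp add: C2_def)
    finally have "(real n + a) * norm (?r N z - 1 / z) \<le> C2" .
    moreover have "real N * norm (?r N z - 1 / z) \<le> 2 * ((real n + a) * norm (?r N z - 1 / z))"
      unfolding mult.assoc[symmetric] using na by (intro mult_right_mono) auto
    ultimately have "real N * norm (?r N z - 1 / z) \<le> 2 * C2" by linarith
    then show ?thesis using Np by (simp add: field_simps)
  qed
  show ?thesis
  proof (rule uniform_limitI)
    fix e :: real assume e: "e > 0"
    have "(\<lambda>N. 2 * C2 / real N) \<longlonglongrightarrow> 0" by real_asymp
    then have "\<forall>\<^sub>F N in sequentially. 2 * C2 / real N < e" using e by (rule order_tendstoD)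
    then show "\<forall>\<^sub>F N in sequentially. \<forall>z\<in>S. dist (?r N z) (1 / z) < e"
      using eventually_ge_at_top[of "2 * j + 3"]
      by eventually_elim (use bound in \<open>force simp: dist_norm\<close>)
  qed
qed

lemma laguerre_nonzero_off_cut:
  assumes a: "a \<ge> -1" and z: "off_cut {z}" and N: "N > 0"
  shows "poly (cpoly (laguerre a n)) (of_nat N * phi z) \<noteq> 0"
proof -
  obtain d where d: "d > 0" "\<And>y. y \<ge> 0 \<Longrightarrow> d \<le> norm (phi z - of_real y)"
    by (rule off_cut_bounds[of "{z}"]) (use z in auto)
  have "real N * d \<le> norm (of_nat N * phi z - of_real y)" if "y \<ge> 0" for y
  proof -
    have "of_nat N * phi z - of_real y = of_nat N * (phi z - of_real (y / real N))" using N by (simp add: field_simps)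
    then have "norm (of_nat N * phi z - of_real y) = real N * norm (phi z - of_real (y / real N))" by (simp add: norm_mult)
    then show ?thesis using d(2)[of "y / real N"] that N by (simp add: mult_left_mono)
  qed
  then show ?thesis using laguerre_log_deriv(1)[OF a, of "real N * d" "of_nat N * phi z" n] d(1) N by simp
qed

text \<open>A telescoping product of \<open>j\<close> quotients of neighbouring polynomials.\<close>
lemma laguerre_power_limit:
  assumes a: "a \<ge> -1" and S: "compact S" "off_cut S"
  shows "uniform_limit S
     (\<lambda>N z. poly (cpoly (laguerre a (N - j))) (of_nat N * phi z) / poly (cpoly (laguerre a N)) (of_nat N * phi z))
     (\<lambda>z. (1 / z) ^ j) sequentially"
proof (induction j)
  case 0
  have "uniform_limit S (\<lambda>N z. 1 :: complex) (\<lambda>z. 1) sequentially" by (rule uniform_limit_const)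
  moreover have "\<forall>\<^sub>F N in sequentially. \<forall>z\<in>S. 1 = poly (cpoly (laguerre a (N - 0))) (of_nat N * phi z) / poly (cpoly (laguerre a N)) (of_nat N * phi z)"
    using eventually_gt_at_top[of 0]
    by eventually_elim (use laguerre_nonzero_off_cut[OF a] off_cut_subset[OF S(2)] in auto)
  ultimately show ?case
    by (rule uniform_limit_cong[THEN iffD1, rotated 2, OF _ _]) auto
next
  case (Suc j)
  have z0: "0 \<notin> S" using S(2) by (auto simp: off_cut_def)
  have "compact ((\<lambda>z. (1 / z) ^ j) ` S)" "compact ((\<lambda>z. 1 / z) ` S)"
    using S(1) z0 by (auto intro!: compact_continuous_image continuous_intros)
  then have lim: "uniform_limit S (\<lambda>N z. poly (cpoly (laguerre a (N - j))) (of_nat N * phi z) / poly (cpoly (laguerre a N)) (of_nat N * phi z) *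
     (poly (cpoly (laguerre a (N - Suc j))) (of_nat N * phi z) / poly (cpoly (laguerre a (N - j))) (of_nat N * phi z)))
     (\<lambda>z. (1 / z) ^ j * (1 / z)) sequentially"
    by (intro uniform_lim_mult Suc.IH laguerre_ratio_limit[OF a S] compact_imp_bounded)
  have ev: "\<forall>\<^sub>F N in sequentially. \<forall>z\<in>S. poly (cpoly (laguerre a (N - j))) (of_nat N * phi z) / poly (cpoly (laguerre a N)) (of_nat N * phi z) *
     (poly (cpoly (laguerre a (N - Suc j))) (of_nat N * phi z) / poly (cpoly (laguerre a (N - j))) (of_nat N * phi z))
     = poly (cpoly (laguerre a (N - Suc j))) (of_nat N * phi z) / poly (cpoly (laguerre a N)) (of_nat N * phi z)"
    using eventually_gt_at_top[of 0]
    by eventually_elim (use laguerre_nonzero_off_cut[OF a] off_cut_subset[OF S(2)] in auto)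
  have eq: "(1 / z) ^ j * (1 / z) = (1 / z) ^ Suc j" for z :: complex by simp
  show ?case
    using lim by (rule uniform_limit_cong[THEN iffD1, rotated 2]) (rule ev, rule eq)
qed

lemma uniform_limit_finite_sum:
  fixes f :: "'i \<Rightarrow> 'a \<Rightarrow> 'b \<Rightarrow> 'c :: real_normed_vector"
  assumes "\<And>i. i \<in> I \<Longrightarrow> uniform_limit X (f i) (l i) F"
  shows "uniform_limit X (\<lambda>n x. \<Sum>i\<in>I. f i n x) (\<lambda>x. \<Sum>i\<in>I. l i x) F"
  using assms
  by (induction I rule: infinite_finite_induct) (auto intro!: uniform_limit_add uniform_limit_const)

lemma laguerre_lift_limit:
  assumes a: "a \<ge> -1" and S: "compact S" "off_cut S" and d: "degree p \<le> d"
  shows "uniform_limit S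
     (\<lambda>N z. poly (cpoly (laguerre_lift (N - d) a p)) (of_nat N * phi z) / poly (cpoly (laguerre a N)) (of_nat N * phi z))
     (\<lambda>z. poly (cpoly p) z / z ^ d) sequentially"
proof -
  let ?R = "\<lambda>j N z. poly (cpoly (laguerre a (N - j))) (of_nat N * phi z) / poly (cpoly (laguerre a N)) (of_nat N * phi z)"
  have z0: "0 \<notin> S" using S(2) by (auto simp: off_cut_def)
  have lim: "uniform_limit S (\<lambda>N z. \<Sum>i\<le>d. of_real (coeff p i) * ?R (d - i) N z)
     (\<lambda>z. \<Sum>i\<le>d. of_real (coeff p i) * (1 / z) ^ (d - i)) sequentially"
    by (intro uniform_limit_finite_sum bounded_linear.uniform_limit[OF bounded_linear_mult_right] laguerre_power_limit[OF a S])
  have ev: "\<forall>\<^sub>F N in sequentially. \<forall>z\<in>S. (\<Sum>i\<le>d. of_real (coeff p i) * ?R (d - i) N z) =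
    poly (cpoly (laguerre_lift (N - d) a p)) (of_nat N * phi z) / poly (cpoly (laguerre a N)) (of_nat N * phi z)"
    using eventually_ge_at_top[of d]
  proof eventually_elim
    case (elim N)
    have "N - d + i = N - (d - i)" if "i \<le> d" for i using that elim by simp
    then show ?case
      by (simp add: laguerre_lift_eq_sum[OF d] cpoly_sum cpoly_smult poly_sum sum_divide_distrib)
  qed
  have eq: "(\<Sum>i\<le>d. of_real (coeff p i) * (1 / z) ^ (d - i)) = poly (cpoly p) z / z ^ d" if "z \<in> S" for z
  proof -
    have z: "z \<noteq> 0" using that z0 by auto
    have "poly (cpoly p) z = (\<Sum>i\<le>d. of_real (coeff p i) * z ^ i)"
      using d by (simp add: poly_altdef degree_cpoly coeff_map_poly)
        (rule sum.mono_neutral_left; auto simp: coeff_eq_0)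
    moreover have "(1 / z) ^ (d - i) = z ^ i / z ^ d" if "i \<le> d" for i
      using z that by (simp add: power_diff power_one_over field_simps)
    ultimately show ?thesis by (simp add: sum_divide_distrib)
  qed
  show ?thesis
    using lim by (rule uniform_limit_cong[THEN iffD1, rotated 2]) (rule ev, rule eq)
qed

section \<open>Zeros attracted by the zeros of P\<close>

text \<open>
  Rouche's theorem in the variable \<open>z\<close>, comparing a normalised form of \<open>f (N * phi z)\<close> with
  \<open>(z - w) ^ k\<close>. As \<open>phi\<close> is injective with nonvanishing derivative outside the closed unit disc,
  zeros and multiplicities are the same in \<open>z\<close> and in \<open>x = N * phi z\<close>.
\<close>
lemma Rouche_power_count:
  fixes f :: "complex poly" and h :: "complex \<Rightarrow> complex"
  assumes N: "N > 0" and k: "k > 0" and e: "0 < e" "e < r" and S: "\<And>z. z \<in> ball w r \<Longrightarrow> norm z > 1"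
    and h: "h holomorphic_on ball w r" "\<And>z. z \<in> ball w r \<Longrightarrow> h z \<noteq> 0"
    and less: "\<And>z. z \<in> sphere w e \<Longrightarrow> norm (poly f (of_nat N * phi z) * h z - (z - w) ^ k) < e ^ k"
  shows "size (filter_mset (\<lambda>x. x \<in> (\<lambda>z. of_nat N * phi z) ` ball w e) (proots f)) = k"
proof -
  define psi where "psi = (\<lambda>z. of_nat N * phi z)"
  define F where "F = (\<lambda>z. (z - w) ^ k)"
  define G where "G = (\<lambda>z. poly f (psi z) * h z - (z - w) ^ k)"
  let ?S = "ball w r" and ?c = "circlepath w e"
  have S0: "z \<noteq> 0" if "z \<in> ?S" for z using S[OF that] by auto
  have less': "norm (G z) < norm (F z)" if "z \<in> sphere w e" for z
    using less[OF that] that by (simp add: F_def G_def psi_def norm_power dist_norm norm_minus_commute)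
  have "w + of_real e \<in> sphere w e" using e by (simp add: dist_norm)
  then have "F (w + of_real e) + G (w + of_real e) \<noteq> 0"
    using less' by (metis add_eq_0_iff norm_minus_cancel order_less_irrefl)
  then have f0: "f \<noteq> 0" by (auto simp: F_def G_def)
  have psi_hol: "psi holomorphic_on ?S"
    unfolding psi_def phi_def using S0 by (intro holomorphic_intros) auto
  note poly_hol = poly_holomorphic_on[OF psi_hol]
  have inj: "inj_on psi ?S"
    using inj_on_phi N S unfolding psi_def inj_on_def by simp
  define Z where "Z = {z \<in> ?S. poly f (psi z) = 0}"
  have Z: "{z \<in> ?S. F z + G z = 0} = Z"
    using h(2) by (auto simp: F_def G_def Z_def)
  have finZ: "finite Z"
  proof (rule inj_on_finite)
    show "inj_on psi Z" using inj by (rule inj_on_subset) (auto simp: Z_def)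
    show "psi ` Z \<subseteq> {x. poly f x = 0}" by (auto simp: Z_def)
    show "finite {x. poly f x = 0}" using f0 by (rule poly_roots_finite)
  qed
  have F: "{z \<in> ?S. F z = 0} = {w}" using k e by (auto simp: F_def)
  have "(\<Sum>p\<in>{z \<in> ?S. F z + G z = 0}. winding_number ?c p * of_int (zorder (\<lambda>p. F p + G p) p)) =
    (\<Sum>p\<in>{z \<in> ?S. F z = 0}. winding_number ?c p * of_int (zorder F p))"
  proof (rule Rouche_theorem)
    show "finite {z \<in> ?S. F z + G z = 0}" "finite {z \<in> ?S. F z = 0}"
      using Z finZ F by simp_all
    show "F holomorphic_on ?S" unfolding F_def by (intro holomorphic_intros)
    show "G holomorphic_on ?S" unfolding G_def by (intro holomorphic_intros poly_hol h(1))
    show "path_image ?c \<subseteq> ?S" using e by auto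
    show "\<forall>z\<in>path_image ?c. norm (G z) < norm (F z)" using less' e by simp
    show "\<forall>z. z \<notin> ?S \<longrightarrow> winding_number ?c z = 0"
    proof (intro allI impI)
      fix z assume "z \<notin> ?S"
      then show "winding_number ?c z = 0"
        using e by (intro winding_number_zero_outside[of _ "cball w e"]) auto
    qed
  qed auto
  then have main: "(\<Sum>p\<in>Z. winding_number ?c p * of_int (zorder (\<lambda>p. F p + G p) p)) = winding_number ?c w * of_int (zorder F w)"
    unfolding Z F by simp
  have "zorder F w = int k"
    by (rule zorder_eqI[of UNIV w "\<lambda>_. 1"]) (auto simp: F_def)
  then have rhs: "winding_number ?c w * of_int (zorder F w) = of_nat k"
    using e by (simp add: winding_number_circlepath)
  have zord: "zorder (\<lambda>p. F p + G p) p = int (order (psi p) f)" if p: "p \<in> Z" for p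
  proof -
    have pS: "p \<in> ?S" using p by (simp add: Z_def)
    obtain g where g: "f = [:- psi p, 1:] ^ order (psi p) f * g" "\<not> [:- psi p, 1:] dvd g"
      using order_decomp[OF f0] by blast
    have gp: "poly g (psi p) \<noteq> 0" using g(2) by (simp add: poly_eq_0_iff_dvd)
    have "norm p * norm p > 1" using S[OF pS] by (simp add: less_1_mult)
    then have pp: "p * p \<noteq> 1" by (metis less_irrefl norm_mult norm_one)
    \<comment> \<open>The factor N (1 / (z p) - 1) is the difference quotient of z \<mapsto> N phi z, by phi_diff.\<close>
    let ?u = "\<lambda>z. (of_nat N * (1 / (z * p) - 1)) ^ order (psi p) f * poly g (psi z) * h z"
    show ?thesis
    proof (rule zorder_eqI[of ?S p ?u])
      show "?u holomorphic_on ?S" using S0 pS by (intro holomorphic_intros poly_hol h(1)) auto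
      show "?u p \<noteq> 0" using gp h(2)[OF pS] N pp S0[OF pS] by (auto simp: field_simps)
      fix z assume z: "z \<in> ?S" "z \<noteq> p"
      have "psi z - psi p = (z - p) * (of_nat N * (1 / (z * p) - 1))"
        using arg_cong[OF phi_diff[OF S0[OF z(1)] S0[OF pS]], of "\<lambda>x. of_nat N * x"]
        by (simp add: psi_def right_diff_distrib mult_ac)
      moreover have "poly f (psi z) = (psi z - psi p) ^ order (psi p) f * poly g (psi z)"
        using arg_cong[OF g(1), of "\<lambda>q. poly q (psi z)"] by simp
      ultimately have "poly f (psi z) = (z - p) ^ order (psi p) f * (of_nat N * (1 / (z * p) - 1)) ^ order (psi p) f * poly g (psi z)"
        by (simp add: power_mult_distrib)
      then show "F z + G z = ?u z * (z - p) powi int (order (psi p) f)"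
        by (simp add: F_def G_def mult_ac)
    qed (use pS in auto)
  qed
  have "(\<Sum>p\<in>Z. winding_number ?c p * of_int (zorder (\<lambda>p. F p + G p) p)) =
     (\<Sum>p\<in>Z \<inter> ball w e. of_nat (order (psi p) f))"
  proof (rule sum.mono_neutral_cong_right[OF finZ])
    show "\<forall>p\<in>Z - Z \<inter> ball w e. winding_number ?c p * of_int (zorder (\<lambda>p. F p + G p) p) = 0"
    proof
      fix p assume p: "p \<in> Z - Z \<inter> ball w e"
      then have "F p + G p = 0" using Z by auto
      then have "p \<notin> sphere w e"
        using less'[of p] by (metis add_eq_0_iff norm_minus_cancel order_less_irrefl)
      then have "p \<notin> cball w e" using p by auto
      then have "winding_number ?c p = 0"
        using e by (intro winding_number_zero_outside[of _ "cball w e"]) auto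
      then show "winding_number ?c p * of_int (zorder (\<lambda>p. F p + G p) p) = 0" by simp
    qed
    show "winding_number ?c p * of_int (zorder (\<lambda>p. F p + G p) p) = of_nat (order (psi p) f)"
      if "p \<in> Z \<inter> ball w e" for p
      using that zord by (simp add: winding_number_circlepath dist_norm norm_minus_commute)
  qed auto
  then have "of_nat (\<Sum>p\<in>Z \<inter> ball w e. order (psi p) f) = (of_nat k :: complex)"
    using main rhs by simp
  then have k': "(\<Sum>p\<in>Z \<inter> ball w e. order (psi p) f) = k" by (simp only: of_nat_eq_iff)
  have "{x \<in> set_mset (proots f). x \<in> psi ` ball w e} = psi ` (Z \<inter> ball w e)"
    using f0 e by (auto simp: Z_def)
  then have "size (filter_mset (\<lambda>x. x \<in> psi ` ball w e) (proots f)) = (\<Sum>x\<in>psi ` (Z \<inter> ball w e). order x f)"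
    using f0 by (auto simp: size_multiset_overloaded_eq intro!: sum.cong)
  also have "\<dots> = (\<Sum>p\<in>Z \<inter> ball w e. order (psi p) f)"
    by (rule sum.reindex_cong[OF inj_on_subset[OF inj]]) (auto simp: Z_def)
  finally show ?thesis using k' by (simp add: psi_def)
qed

text \<open>
  Divided by the Laguerre polynomial of degree \<open>N\<close>, the member of the pencil with coefficients \<open>s\<close>
  and \<open>t\<close> tends to \<open>(s + t / z) * P z / z ^ K\<close>. The function \<open>c\<close> keeps the first factor away from
  zero, so that \<open>N\<close> can be chosen independently of the admissible pair \<open>(s, t)\<close>.
\<close>
lemma pencil_zeros_near:
  fixes P :: "real poly" and w :: complex and Adm :: "(real \<times> real) set"
  assumes a: "a \<ge> -1" and P: "P \<noteq> 0" "degree P = K" and w: "poly (cpoly P) w = 0"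
    and T: "open T" "w \<in> T" "off_cut T"
    and c: "continuous_on T c" "\<And>z. z \<in> T \<Longrightarrow> c z > 0"
    and Adm: "\<And>s t. (s, t) \<in> Adm \<Longrightarrow> \<bar>s\<bar> \<le> 1 \<and> \<bar>t\<bar> \<le> 1 \<and> (\<forall>z\<in>T. c z \<le> norm (of_real s + of_real t / z))"
  shows "\<forall>\<^sub>F e in at_right 0. ball w e \<subseteq> T \<and> (\<forall>\<^sub>F N in sequentially. \<forall>(s, t)\<in>Adm.
    size (filter_mset (\<lambda>x. x \<in> (\<lambda>z. of_nat N * phi z) ` ball w e)
      (proots (cpoly (smult s (laguerre_lift (N - K) a P) + smult t (laguerre_lift (N - Suc K) a P)))))
    = order w (cpoly P))"
proof -
  define k where "k = order w (cpoly P)"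
  have cP: "cpoly P \<noteq> 0" using P by (simp add: cpoly_eq_0_iff)
  have k0: "k > 0" using w cP by (simp add: k_def order_gt_0_iff)
  obtain P1 where P1: "cpoly P = [:- w, 1:] ^ k * P1" "\<not> [:- w, 1:] dvd P1"
    using order_decomp[OF cP] unfolding k_def by blast
  have P1w: "poly P1 w \<noteq> 0" using P1(2) by (simp add: poly_eq_0_iff_dvd)
  have "open (T \<inter> {z. poly P1 z \<noteq> 0})"
    by (intro open_Int T open_Collect_neq continuous_intros)
  moreover have "w \<in> T \<inter> {z. poly P1 z \<noteq> 0}" using T(2) P1w by simp
  ultimately obtain r where r: "r > 0" "ball w r \<subseteq> T \<inter> {z. poly P1 z \<noteq> 0}"
    by (rule openE)
  have big: "norm z > 1" if "z \<in> T" for z using T(3) that by (auto simp: off_cut_def)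
  have "ball w e \<subseteq> T \<and> (\<forall>\<^sub>F N in sequentially. \<forall>(s, t)\<in>Adm.
    size (filter_mset (\<lambda>x. x \<in> (\<lambda>z. of_nat N * phi z) ` ball w e)
      (proots (cpoly (smult s (laguerre_lift (N - K) a P) + smult t (laguerre_lift (N - Suc K) a P)))))
    = k)" if e: "0 < e" "e < r" for e
  proof
    show "ball w e \<subseteq> T" using r(2) e by auto
    have sub: "sphere w e \<subseteq> ball w r" using e by auto
    then have sT: "sphere w e \<subseteq> T" using r(2) by auto
    have s0: "0 \<notin> sphere w e" using sT big[of 0] by (metis norm_zero not_one_less_zero subset_iff)
    have "continuous_on (sphere w e) (\<lambda>z. norm (poly P1 z / z ^ K) * c z)"
      using s0 by (intro continuous_intros continuous_on_subset[OF c(1) sT]) auto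
    moreover have "norm (poly P1 z / z ^ K) * c z > 0" if "z \<in> sphere w e" for z
    proof -
      have "poly P1 z \<noteq> 0" "z \<noteq> 0" "c z > 0" using that sub r(2) s0 c(2) sT by auto
      then show ?thesis by simp
    qed
    ultimately obtain d where d: "d > 0" "\<And>z. z \<in> sphere w e \<Longrightarrow> d \<le> norm (poly P1 z / z ^ K) * c z"
      using compact_pos_lower_bound[of "sphere w e" "\<lambda>z. norm (poly P1 z / z ^ K) * c z"] by auto
    define eta where "eta = d * e ^ k / 2"
    have eta: "eta > 0" using d e by (simp add: eta_def)
    let ?L = "\<lambda>N z. poly (cpoly (laguerre a N)) (of_nat N * phi z)"
    let ?Q = "\<lambda>j N z. poly (cpoly (laguerre_lift (N - j) a P)) (of_nat N * phi z)"
    have lim: "\<forall>\<^sub>F N in sequentially. \<forall>z\<in>sphere w e. dist (?Q j N z / ?L N z) (poly (cpoly P) z / z ^ j) < eta"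
      if "K \<le> j" for j
      by (intro uniform_limitD laguerre_lift_limit a eta off_cut_subset[OF T(3) sT]) (use that P in auto)
    show "\<forall>\<^sub>F N in sequentially. \<forall>(s, t)\<in>Adm.
      size (filter_mset (\<lambda>x. x \<in> (\<lambda>z. of_nat N * phi z) ` ball w e)
        (proots (cpoly (smult s (laguerre_lift (N - K) a P) + smult t (laguerre_lift (N - Suc K) a P))))) = k"
      using lim[OF order_refl] lim[of "Suc K", simplified] eventually_gt_at_top[of 0]
    proof (eventually_elim, intro ballI, clarify)
      fix N s t
      assume 1: "\<forall>z\<in>sphere w e. dist (?Q K N z / ?L N z) (poly (cpoly P) z / z ^ K) < eta"
        and 2: "\<forall>z\<in>sphere w e. dist (?Q (Suc K) N z / ?L N z) (poly (cpoly P) z / (z * z ^ K)) < eta"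
        and N: "0 < N" and st: "(s, t) \<in> Adm"
      have L0: "?L N z \<noteq> 0" if "z \<in> ball w r" for z
        by (rule laguerre_nonzero_off_cut[OF a _ N]) (rule off_cut_subset[OF T(3)], use that r(2) in auto)
      define m where "m = (\<lambda>z::complex. of_real s + of_real t / z)"
      \<comment> \<open>The limit of the normalised member of the pencil is (z - w) ^ k * g z.\<close>
      define g where "g = (\<lambda>z. poly P1 z / z ^ K * m z)"
      have m: "c z \<le> norm (m z)" if "z \<in> T" for z using Adm[OF st] that by (auto simp: m_def)
      have g0: "g z \<noteq> 0" if "z \<in> ball w r" for z
      proof -
        have "z \<in> T" "poly P1 z \<noteq> 0" using that r(2) by auto
        moreover from this have "m z \<noteq> 0" "z \<noteq> 0" using m[of z] c(2)[of z] big[of z] by force+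
        ultimately show ?thesis by (simp add: g_def)
      qed
      have "0 \<notin> T" using big[of 0] by force
      then have b0: "z \<noteq> 0" if "z \<in> ball w r" for z using that r(2) by blast
      let ?f = "cpoly (smult s (laguerre_lift (N - K) a P) + smult t (laguerre_lift (N - Suc K) a P))"
      show "size (filter_mset (\<lambda>x. x \<in> (\<lambda>z. of_nat N * phi z) ` ball w e) (proots ?f)) = k"
      proof (rule Rouche_power_count[OF N k0 e])
        show "norm z > 1" if "z \<in> ball w r" for z using that r(2) big by auto
        show "(\<lambda>z. 1 / (?L N z * g z)) holomorphic_on ball w r"
          using L0 g0 b0 unfolding g_def m_def phi_def by (intro holomorphic_intros) auto
        show "1 / (?L N z * g z) \<noteq> 0" if "z \<in> ball w r" for z using L0 g0 that by simp
        fix z assume z: "z \<in> sphere w e"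
        have zr: "z \<in> ball w r" using z sub by auto
        have nz: "?L N z \<noteq> 0" "g z \<noteq> 0" "z \<noteq> 0" using L0 g0 b0 zr by auto
        define u where "u = of_real s * (?Q K N z / ?L N z - poly (cpoly P) z / z ^ K)
           + of_real t * (?Q (Suc K) N z / ?L N z - poly (cpoly P) z / (z * z ^ K))"
        have Pz: "poly (cpoly P) z = (z - w) ^ k * poly P1 z" by (simp add: P1(1))
        have "of_real s * (poly (cpoly P) z / z ^ K) + of_real t * (poly (cpoly P) z / (z * z ^ K)) = (z - w) ^ k * g z"
          using nz(3) by (simp add: Pz g_def m_def field_simps)
        moreover have "poly ?f (of_nat N * phi z) / ?L N z = of_real s * (?Q K N z / ?L N z) + of_real t * (?Q (Suc K) N z / ?L N z)"
          by (simp add: cpoly_add cpoly_smult add_divide_distrib)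
        ultimately have "poly ?f (of_nat N * phi z) / ?L N z - (z - w) ^ k * g z = u"
          unfolding u_def by (simp add: algebra_simps)
        moreover have "poly ?f (of_nat N * phi z) * (1 / (?L N z * g z)) - (z - w) ^ k
          = (poly ?f (of_nat N * phi z) / ?L N z - (z - w) ^ k * g z) / g z"
          using nz by (simp add: field_simps)
        ultimately have eq: "poly ?f (of_nat N * phi z) * (1 / (?L N z * g z)) - (z - w) ^ k = u / g z" by simp
        have "d \<le> norm (g z)"
        proof -
          have "d \<le> norm (poly P1 z / z ^ K) * c z" by (rule d(2)[OF z])
          also have "\<dots> \<le> norm (poly P1 z / z ^ K) * norm (m z)"
            using m[of z] sT z by (intro mult_left_mono) auto
          also have "\<dots> = norm (g z)" by (simp add: g_def norm_mult norm_divide)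
          finally show ?thesis .
        qed
        moreover have "norm u < e ^ k * d"
        proof -
          have "norm u \<le> \<bar>s\<bar> * norm (?Q K N z / ?L N z - poly (cpoly P) z / z ^ K)
             + \<bar>t\<bar> * norm (?Q (Suc K) N z / ?L N z - poly (cpoly P) z / (z * z ^ K))"
            unfolding u_def by (rule order_trans[OF norm_triangle_ineq]) (simp add: norm_mult)
          also have "\<dots> \<le> 1 * norm (?Q K N z / ?L N z - poly (cpoly P) z / z ^ K)
             + 1 * norm (?Q (Suc K) N z / ?L N z - poly (cpoly P) z / (z * z ^ K))"
            using Adm[OF st] by (intro add_mono mult_right_mono) auto
          also have "\<dots> < eta + eta"
            using bspec[OF 1 z] bspec[OF 2 z] unfolding dist_norm by linarith
          finally show ?thesis by (simp add: eta_def mult.commute)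
        qed
        ultimately have "norm u < e ^ k * norm (g z)"
          using e by (meson less_le_trans mult_left_mono zero_le_power less_imp_le)
        then show "norm (poly ?f (of_nat N * phi z) * (1 / (?L N z * g z)) - (z - w) ^ k) < e ^ k"
          unfolding eq norm_divide using nz(2) by (simp add: divide_less_eq)
      qed
    qed
  qed
  then show ?thesis
    unfolding k_def eventually_at_right_field using r(1) by blast
qed

text \<open>
  Around each of the finitely many points of \<open>Z\<close> choose discs with a common radius so small that they
  are disjoint. Their images under \<open>N * phi\<close> are disjoint as well, so the numbers of attracted zeros
  add up.
\<close>
lemma zeros_persist:
  fixes P :: "real poly" and Z :: "complex set" and Adm :: "(real \<times> real) set"
  assumes a: "a \<ge> -1" and P: "P \<noteq> 0" "degree P = K"
    and Z: "finite Z" "\<And>w. w \<in> Z \<Longrightarrow> poly (cpoly P) w = 0"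
    and T: "\<And>w. w \<in> Z \<Longrightarrow> open (T w) \<and> w \<in> T w \<and> off_cut (T w)"
    and c: "\<And>w. w \<in> Z \<Longrightarrow> continuous_on (T w) c" "\<And>w z. w \<in> Z \<Longrightarrow> z \<in> T w \<Longrightarrow> c z > 0"
    and Adm: "\<And>s t w. (s, t) \<in> Adm \<Longrightarrow> w \<in> Z \<Longrightarrow>
        \<bar>s\<bar> \<le> 1 \<and> \<bar>t\<bar> \<le> 1 \<and> (\<forall>z\<in>T w. c z \<le> norm (of_real s + of_real t / z))"
    and R: "\<And>N w z. N > 0 \<Longrightarrow> w \<in> Z \<Longrightarrow> z \<in> T w \<Longrightarrow> of_nat N * phi z \<in> R"
  shows "\<forall>\<^sub>F N in sequentially. \<forall>(s, t)\<in>Adm. (\<Sum>w\<in>Z. order w (cpoly P)) \<le>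
    size (filter_mset (\<lambda>x. x \<in> R)
      (proots (cpoly (smult s (laguerre_lift (N - K) a P) + smult t (laguerre_lift (N - Suc K) a P)))))"
proof -
  let ?psi = "\<lambda>N z. of_nat N * phi z"
  let ?f = "\<lambda>N s t. proots (cpoly (smult s (laguerre_lift (N - K) a P) + smult t (laguerre_lift (N - Suc K) a P)))"
  let ?Q = "\<lambda>e w N. \<forall>(s, t)\<in>Adm. size (filter_mset (\<lambda>x. x \<in> ?psi N ` ball w e) (?f N s t)) = order w (cpoly P)"
  have 1: "\<forall>\<^sub>F e in at_right 0. ball w e \<subseteq> T w \<and> (\<forall>\<^sub>F N in sequentially. ?Q e w N)" if "w \<in> Z" for w
  proof (rule pencil_zeros_near[OF a P Z(2)[OF that]])
    show "open (T w)" "w \<in> T w" "off_cut (T w)" using T[OF that] by auto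
    show "continuous_on (T w) c" by (rule c(1)[OF that])
    show "c z > 0" if "z \<in> T w" for z using c(2) \<open>w \<in> Z\<close> that by blast
    show "\<bar>s\<bar> \<le> 1 \<and> \<bar>t\<bar> \<le> 1 \<and> (\<forall>z\<in>T w. c z \<le> norm (of_real s + of_real t / z))"
      if "(s, t) \<in> Adm" for s t using Adm[OF that \<open>w \<in> Z\<close>] .
  qed
  have 2: "\<forall>\<^sub>F e in at_right 0. w \<noteq> w' \<longrightarrow> ball w e \<inter> ball w' e = {}" for w w' :: complex
  proof (cases "w = w'")
    case False
    then have "0 < dist w w' / 2" by simp
    then have "\<forall>\<^sub>F e in at_right 0. e < dist w w' / 2"
      by (rule eventually_at_right_real[THEN eventually_mono]) auto
    then show ?thesis by eventually_elim (auto intro!: disjoint_ballI)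
  qed simp
  have "\<forall>\<^sub>F e in at_right 0. \<forall>w\<in>Z. ball w e \<subseteq> T w \<and> (\<forall>\<^sub>F N in sequentially. ?Q e w N)"
    using Z(1) 1 by (auto intro: eventually_ball_finite)
  moreover have "\<forall>\<^sub>F e in at_right 0. \<forall>w\<in>Z. \<forall>w'\<in>Z. w \<noteq> w' \<longrightarrow> ball w e \<inter> ball w' e = {}"
    using Z(1) 2 by (intro eventually_ball_finite ballI)
  ultimately have "\<forall>\<^sub>F e in at_right 0. (\<forall>w\<in>Z. ball w e \<subseteq> T w \<and> (\<forall>\<^sub>F N in sequentially. ?Q e w N))
     \<and> (\<forall>w\<in>Z. \<forall>w'\<in>Z. w \<noteq> w' \<longrightarrow> ball w e \<inter> ball w' e = {})"
    by (rule eventually_conj)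
  then have "\<exists>e. (\<forall>w\<in>Z. ball w e \<subseteq> T w \<and> (\<forall>\<^sub>F N in sequentially. ?Q e w N))
     \<and> (\<forall>w\<in>Z. \<forall>w'\<in>Z. w \<noteq> w' \<longrightarrow> ball w e \<inter> ball w' e = {})"
    by (rule eventually_happens'[OF trivial_limit_at_right_real])
  then obtain e where e_all: "(\<forall>w\<in>Z. ball w e \<subseteq> T w \<and> (\<forall>\<^sub>F N in sequentially. ?Q e w N))
     \<and> (\<forall>w\<in>Z. \<forall>w'\<in>Z. w \<noteq> w' \<longrightarrow> ball w e \<inter> ball w' e = {})"
    by (rule exE)
  have e: "ball w e \<subseteq> T w" "\<forall>\<^sub>F N in sequentially. ?Q e w N"
    "w' \<in> Z \<Longrightarrow> w \<noteq> w' \<Longrightarrow> ball w e \<inter> ball w' e = {}" if "w \<in> Z" for w w'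
    by (rule bspec[OF conjunct1[OF e_all] that, THEN conjunct1],
        rule bspec[OF conjunct1[OF e_all] that, THEN conjunct2],
        rule bspec[OF bspec[OF conjunct2[OF e_all] that], THEN mp])
  have "\<forall>\<^sub>F N in sequentially. \<forall>w\<in>Z. ?Q e w N"
    by (rule eventually_ball_finite[OF Z(1)]) (rule ballI, rule e(2))
  then show ?thesis
    using eventually_gt_at_top[of 0]
  proof (eventually_elim, intro ballI, clarify)
    fix N s t assume Q: "\<forall>w\<in>Z. ?Q e w N" and N: "0 < N" and st: "(s, t) \<in> Adm"
    have big: "ball w e \<subseteq> {z. norm z > 1}" if "w \<in> Z" for w
      using e(1)[OF that] T[OF that] by (auto simp: off_cut_def)
    have "disjoint_family_on (\<lambda>w. ?psi N ` ball w e) Z"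
      unfolding disjoint_family_on_def
    proof (intro ballI impI)
      fix w w' assume w: "w \<in> Z" "w' \<in> Z" "w \<noteq> w'"
      show "?psi N ` ball w e \<inter> ?psi N ` ball w' e = {}"
      proof (rule ccontr)
        assume "?psi N ` ball w e \<inter> ?psi N ` ball w' e \<noteq> {}"
        then obtain z z' where z: "z \<in> ball w e" "z' \<in> ball w' e" "?psi N z = ?psi N z'" by blast
        then have "phi z = phi z'" using N by simp
        then have "z = z'" using inj_onD[OF inj_on_phi] z big w by blast
        then show False using e(3)[OF w] z by blast
      qed
    qed
    then have "(\<Sum>w\<in>Z. size (filter_mset (\<lambda>x. x \<in> ?psi N ` ball w e) (?f N s t)))
      \<le> size (filter_mset (\<lambda>x. x \<in> R) (?f N s t))"
      by (rule size_filter_disjoint_le[OF Z(1)]) (use R[OF N] e(1) in blast)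
    moreover have "(\<Sum>w\<in>Z. size (filter_mset (\<lambda>x. x \<in> ?psi N ` ball w e) (?f N s t))) = (\<Sum>w\<in>Z. order w (cpoly P))"
      using Q st by (intro sum.cong) auto
    ultimately show "(\<Sum>w\<in>Z. order w (cpoly P)) \<le> size (filter_mset (\<lambda>x. x \<in> R) (?f N s t))" by simp
  qed
qed

lemma num_nonreal_zeros_eq_sum:
  assumes "P \<noteq> 0"
  shows "num_nonreal_zeros P = (\<Sum>w | poly (cpoly P) w = 0 \<and> w \<notin> \<real>. order w (cpoly P))"
  using assms by (auto simp: num_nonreal_zeros_def size_multiset_overloaded_eq cpoly_eq_0_iff intro!: sum.cong)

lemma finite_zeros_cpoly: "P \<noteq> 0 \<Longrightarrow> finite {w. poly (cpoly P) w = 0 \<and> Q w}"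
  by (rule finite_subset[OF _ poly_roots_finite[of "cpoly P"]]) (auto simp: cpoly_eq_0_iff)

lemma open_nonreal: "open {z. norm z > 1 \<and> Im z \<noteq> 0}"
  by (intro open_Collect_conj open_Collect_less open_Collect_neq continuous_intros)

lemma off_cut_nonreal: "off_cut {z. norm z > 1 \<and> Im z \<noteq> 0}"
  by (auto simp: off_cut_def)

text \<open>
  For non-real \<open>z\<close> the factor \<open>s + t / z\<close> vanishes for no real pair except \<open>(0, 0)\<close>. If \<open>|t|\<close> is at
  least \<open>1 / 2\<close> the imaginary part is large enough, and otherwise \<open>|s| = 1\<close> dominates.
\<close>
lemma pencil_lower_bound:
  assumes z: "norm z > 1" and st: "max \<bar>s\<bar> \<bar>t\<bar> = 1"
  shows "\<bar>Im (1 / z)\<bar> / 2 \<le> norm (of_real s + of_real t / z)"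
proof (cases "\<bar>t\<bar> \<ge> 1 / 2")
  case True
  have "Im (of_real s + of_real t / z) = t * Im (1 / z)" by (simp add: Im_divide)
  then have "\<bar>t\<bar> * \<bar>Im (1 / z)\<bar> \<le> norm (of_real s + of_real t / z)"
    using abs_Im_le_cmod[of "of_real s + of_real t / z"] by (simp add: abs_mult)
  moreover have "1 / 2 * \<bar>Im (1 / z)\<bar> \<le> \<bar>t\<bar> * \<bar>Im (1 / z)\<bar>" using True by (intro mult_right_mono) auto
  ultimately show ?thesis by simp
next
  case False
  then have s: "\<bar>s\<bar> = 1" using st by (auto simp: max_def split: if_splits)
  have n: "norm (1 / z) \<le> 1"
    unfolding norm_divide norm_one by (subst divide_le_eq_1_pos) (use z in linarith)+
  have "\<bar>Im (1 / z)\<bar> \<le> 1" using abs_Im_le_cmod[of "1 / z"] n by linarith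
  moreover have "norm (of_real t / z) \<le> 1 / 2"
  proof -
    have "norm (of_real t / z) = \<bar>t\<bar> * norm (1 / z)" by (simp add: norm_divide)
    also have "\<dots> \<le> 1 / 2 * 1" using False n by (intro mult_mono) auto
    finally show ?thesis by simp
  qed
  moreover have "norm (complex_of_real s) - norm (of_real t / z) \<le> norm (of_real s + of_real t / z)"
    by (rule norm_diff_ineq)
  ultimately show ?thesis using s by simp
qed

text \<open>
  Since \<open>phi\<close> maps non-real points outside the closed unit disc to non-real points, the zeros
  attracted by the non-real zeros of \<open>P\<close> are non-real. By \<open>pencil_lower_bound\<close> the normalisation
  of the pair \<open>(s, t)\<close> makes the estimate uniform in the pencil.
\<close>
lemma nonreal_zeros_persist:
  assumes a: "a \<ge> -1" and P: "P \<noteq> 0" "degree P = K"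
    and out: "\<forall>z. z \<notin> \<real> \<longrightarrow> norm z \<le> 1 \<longrightarrow> poly (cpoly P) z \<noteq> 0"
  shows "\<forall>\<^sub>F N in sequentially. \<forall>s t. max \<bar>s\<bar> \<bar>t\<bar> = 1 \<longrightarrow>
    num_nonreal_zeros P \<le> num_nonreal_zeros (smult s (laguerre_lift (N - K) a P) + smult t (laguerre_lift (N - Suc K) a P))"
proof -
  let ?Z = "{w. poly (cpoly P) w = 0 \<and> w \<notin> \<real>}" and ?T = "{z. norm z > 1 \<and> Im z \<noteq> 0}"
  let ?Adm = "{(s :: real, t). max \<bar>s\<bar> \<bar>t\<bar> = 1}"
  have "\<forall>\<^sub>F N in sequentially. \<forall>(s, t)\<in>?Adm. (\<Sum>w\<in>?Z. order w (cpoly P)) \<le>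
    size (filter_mset (\<lambda>x. x \<in> - \<real>)
      (proots (cpoly (smult s (laguerre_lift (N - K) a P) + smult t (laguerre_lift (N - Suc K) a P)))))"
  proof (rule zeros_persist[OF a P, where T = "\<lambda>_. ?T" and c = "\<lambda>z. \<bar>Im (1 / z)\<bar> / 2"])
    show "finite ?Z" using P(1) by (rule finite_zeros_cpoly)
    show "open ?T \<and> w \<in> ?T \<and> off_cut ?T" if "w \<in> ?Z" for w
    proof -
      have "norm w > 1" using that out by force
      then show ?thesis using that by (auto simp: open_nonreal off_cut_nonreal complex_is_Real_iff)
    qed
    have "z \<noteq> 0" if "z \<in> ?T" for z using that by auto
    then show "continuous_on ?T (\<lambda>z. \<bar>Im (1 / z)\<bar> / 2)" by (intro continuous_intros) auto
    show "\<bar>Im (1 / z)\<bar> / 2 > 0" if "z \<in> ?T" for z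
    proof -
      have "Im (1 / z) \<noteq> 0" using that by (simp add: Im_divide sum_power2_eq_zero_iff)
      then show ?thesis by simp
    qed
    show "\<bar>s\<bar> \<le> 1 \<and> \<bar>t\<bar> \<le> 1 \<and> (\<forall>z\<in>?T. \<bar>Im (1 / z)\<bar> / 2 \<le> norm (of_real s + of_real t / z))"
      if "(s, t) \<in> ?Adm" for s t
      using that pencil_lower_bound[of _ s t] by (auto simp: max_def split: if_splits)
    show "of_nat N * phi z \<in> - \<real>" if "N > 0" "z \<in> ?T" for N :: nat and z
      using that Im_phi_neq_0 by (auto simp: complex_is_Real_iff)
  qed auto
  then show ?thesis
    by eventually_elim
      (use P(1) in \<open>auto simp: num_nonreal_zeros_eq_sum[of P] num_nonreal_zeros_def[of "smult _ _ + smult _ _"]\<close>)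
qed

lemma order_le_order_cpoly:
  assumes "p \<noteq> 0" shows "order x p \<le> order (of_real x) (cpoly p)"
proof -
  obtain q where q: "p = [:- x, 1:] ^ order x p * q" using order_decomp[OF assms] by blast
  have pow: "cpoly ([:- x, 1:] ^ k) = [:- of_real x, 1:] ^ k" for k
    by (induction k) (simp_all only: power_0 power_Suc cpoly_mult cpoly_linear of_real_minus of_real_1 map_poly_1')
  have "cpoly p = [:- of_real x, 1:] ^ order x p * cpoly q"
    by (subst q) (simp only: cpoly_mult pow)
  then have "[:- of_real x, 1:] ^ order x p dvd cpoly p" by (metis dvd_triv_left)
  then show ?thesis using assms by (simp add: order_divides cpoly_eq_0_iff)
qed

text \<open>
  The real zeros \<open>x > 1\<close> of \<open>P\<close> attract zeros as well, near \<open>N * phi x < 0\<close>. These zeros might be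
  non-real here; only their position off \<open>[0, \<infinity>)\<close> is recorded.
\<close>
lemma zeros_off_half_line_persist:
  assumes a: "a \<ge> -1" and P: "P \<noteq> 0" "degree P = K"
    and out: "\<forall>z. z \<notin> \<real> \<longrightarrow> norm z \<le> 1 \<longrightarrow> poly (cpoly P) z \<noteq> 0"
  shows "\<forall>\<^sub>F N in sequentially. num_nonreal_zeros P + num_zeros_gt_one P \<le>
    size (filter_mset (\<lambda>x. x \<notin> of_real ` {0..}) (proots (cpoly (laguerre_lift (N - K) a P))))"
proof -
  let ?T1 = "{z. norm z > 1 \<and> Im z \<noteq> 0}" and ?T2 = "{z. norm z > 1 \<and> Re (phi z) < 0}"
  let ?Zn = "{w. poly (cpoly P) w = 0 \<and> w \<notin> \<real>}" and ?X = "{x. poly P x = 0 \<and> x > 1}"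
  let ?Z = "?Zn \<union> of_real ` ?X"
  let ?T = "\<lambda>w. if w \<in> \<real> then ?T2 else ?T1"
  have finX: "finite ?X" by (rule finite_subset[OF _ poly_roots_finite[OF P(1)]]) auto
  have finZ: "finite ?Zn" using P(1) by (rule finite_zeros_cpoly)
  have "continuous_on {z. norm z > 1} (\<lambda>z. Re (phi z))"
    by (intro continuous_intros continuous_on_phi) auto
  moreover have "open {z :: complex. norm z > 1}" by (intro open_Collect_less continuous_intros)
  ultimately have "open ((\<lambda>z. Re (phi z)) -` {..<0} \<inter> {z. norm z > 1})"
    by (simp add: continuous_on_open_vimage)
  moreover have "(\<lambda>z. Re (phi z)) -` {..<0} \<inter> {z. norm z > 1} = ?T2" by auto
  ultimately have openT2: "open ?T2" by simp
  have offT2: "off_cut ?T2" by (auto simp: off_cut_def)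
  have cross: "of_nat N * phi z \<in> - (complex_of_real ` {0..})" if "N > 0" "w \<in> ?Z" "z \<in> ?T w" for N :: nat and w z
  proof
    assume "of_nat N * phi z \<in> complex_of_real ` {0..}"
    then obtain y where y: "y \<ge> 0" "of_nat N * phi z = of_real y" by auto
    have "real N * Re (phi z) = y" "real N * Im (phi z) = 0"
      using arg_cong[OF y(2), of Re] arg_cong[OF y(2), of Im] by simp_all
    then have "Re (phi z) \<ge> 0" "Im (phi z) = 0" using y(1) that(1) by (auto simp: zero_le_mult_iff)
    then show False using that(3) Im_phi_neq_0[of z] by (auto split: if_splits)
  qed
  have "\<forall>\<^sub>F N in sequentially. \<forall>(s, t)\<in>{(1 :: real, 0 :: real)}. (\<Sum>w\<in>?Z. order w (cpoly P)) \<le>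
    size (filter_mset (\<lambda>x. x \<in> - (of_real ` {0..}))
      (proots (cpoly (smult s (laguerre_lift (N - K) a P) + smult t (laguerre_lift (N - Suc K) a P)))))"
  proof (rule zeros_persist[OF a P, where T = ?T and c = "\<lambda>_. 1"])
    show "finite ?Z" using finX finZ by simp
    show "poly (cpoly P) w = 0" if "w \<in> ?Z" for w using that by (auto simp: poly_cpoly)
    show "open (?T w) \<and> w \<in> ?T w \<and> off_cut (?T w)" if wZ: "w \<in> ?Z" for w
    proof (cases "w \<in> \<real>")
      case True
      then obtain x where "w = of_real x" "x > 1" using wZ by auto
      then show ?thesis using openT2 offT2 phi_of_real_gt_1[of x] by simp
    next
      case False
      moreover from False have "norm w > 1" using wZ out by force
      ultimately show ?thesis by (auto simp: open_nonreal off_cut_nonreal complex_is_Real_iff)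
    qed
  qed (use cross in auto)
  moreover have "num_nonreal_zeros P + num_zeros_gt_one P \<le> (\<Sum>w\<in>?Z. order w (cpoly P))"
  proof -
    have "num_zeros_gt_one P = (\<Sum>x\<in>?X. order x P)"
      using P(1) by (auto simp: num_zeros_gt_one_def size_multiset_overloaded_eq intro!: sum.cong)
    also have "\<dots> \<le> (\<Sum>x\<in>?X. order (of_real x) (cpoly P))"
      by (intro sum_mono order_le_order_cpoly P(1))
    also have "\<dots> = (\<Sum>w\<in>of_real ` ?X. order w (cpoly P))"
      by (subst sum.reindex) (auto simp: inj_on_def)
    finally have "num_nonreal_zeros P + num_zeros_gt_one P \<le>
      (\<Sum>w\<in>?Zn. order w (cpoly P)) + (\<Sum>w\<in>of_real ` ?X. order w (cpoly P))"
      using num_nonreal_zeros_eq_sum[OF P(1)] by simp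
    also have "\<dots> = (\<Sum>w\<in>?Z. order w (cpoly P))"
      by (rule sum.union_disjoint[symmetric]) (use finX finZ in auto)
    finally show ?thesis .
  qed
  ultimately show ?thesis by (auto elim!: eventually_mono)
qed


section \<open>Zeros of the polynomials q n\<close>

lemma size_proots_le_if_nonreal:
  assumes "p \<noteq> 0" "m \<le> num_nonreal_zeros p"
  shows "size (proots p) \<le> degree p - m"
  using degree_eq_real_plus_nonreal[OF assms(1)] assms(2) by simp

lemma num_nonreal_zeros_smult: "c \<noteq> 0 \<Longrightarrow> num_nonreal_zeros (smult c p) = num_nonreal_zeros p"
  by (simp add: num_nonreal_zeros_def cpoly_smult)

theorem theorem1p5:
  fixes K :: nat and \<gamma> :: "nat \<Rightarrow> real" and \<alpha> :: real
    and P :: "real poly" and q :: "nat \<Rightarrow> real poly" and Nnr N1 :: nat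
  assumes "0 < K" and "\<gamma> 0 = 1" and "\<gamma> K \<noteq> 0"
    and "P = (\<Sum>j\<le>K. monom (\<gamma> j) (K - j))"
    and "\<And>n. n \<ge> K \<Longrightarrow> q n = (\<Sum>j\<le>K. smult (\<gamma> j) (laguerre \<alpha> (n - j)))"
    and "\<And>z::complex. z \<notin> \<real> \<Longrightarrow> norm z \<le> 1 \<Longrightarrow> poly (map_poly complex_of_real P) z \<noteq> 0"
    and "Nnr = num_nonreal_zeros P" and "N1 = num_zeros_gt_one P"
    and "\<alpha> \<ge> real K - real Nnr - 1"
  shows
    "(Nnr = 0 \<longrightarrow>
        (\<forall>n\<ge>K. has_simple_real_zeros (q n) n \<and>
                interlaces (real_zeros (q (Suc n))) (real_zeros (q n))) \<and>
        (N1 = 0 \<longrightarrow>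
           (\<forall>n\<ge>K. \<forall>x\<in>real_zeros (q n).
              x > 0 \<or> (x = 0 \<and> \<alpha> = real K - 1 \<and> P = [:-1, 1:] ^ K))) \<and>
        (N1 > 0 \<longrightarrow>
           (\<forall>\<^sub>F n in sequentially. card {x \<in> real_zeros (q n). x < 0} = N1)))
     \<and>
     (Nnr \<noteq> 0 \<longrightarrow>
        (\<forall>\<^sub>F n in sequentially.
           has_simple_real_zeros (q n) (n - Nnr) \<and>
           card {x \<in> real_zeros (q n). x < 0} = N1 \<and>
           interlaces (real_zeros (q (Suc n))) (real_zeros (q n))))"
proof -
  note \<gamma>0 = assms(2) and P_def = assms(4) and q_def = assms(5)
    and Nnr = assms(7) and N1 = assms(8) and \<alpha> = assms(9)
  have out: "\<forall>z. z \<notin> \<real> \<longrightarrow> norm z \<le> 1 \<longrightarrow> poly (cpoly P) z \<noteq> 0"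
    using assms(6) by blast
  have coeff_P: "coeff P i = (if i \<le> K then \<gamma> (K - i) else 0)" for i
  proof -
    have "coeff P i = (\<Sum>j\<le>K. if i \<le> K \<and> j = K - i then \<gamma> j else 0)"
      unfolding P_def coeff_sum by (rule sum.cong) auto
    then show ?thesis by auto
  qed
  have cPK: "coeff P K = 1" using \<gamma>0 by (simp add: coeff_P)
  then have P0: "P \<noteq> 0" by auto
  have degP: "degree P = K"
    by (rule antisym) (auto intro!: degree_le le_degree simp: coeff_P \<gamma>0)
  have q: "q n = laguerre_lift (n - K) \<alpha> P" if "n \<ge> K" for n
  proof -
    have "laguerre_lift (n - K) \<alpha> P = (\<Sum>i\<le>K. smult (\<gamma> (K - i)) (laguerre \<alpha> (n - (K - i))))"
      unfolding laguerre_lift_def degP using that by (intro sum.cong) (auto simp: coeff_P)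
    also have "\<dots> = (\<Sum>j\<le>K. smult (\<gamma> j) (laguerre \<alpha> (n - j)))"
      by (rule sum.reindex_bij_witness[of _ "\<lambda>j. K - j" "\<lambda>i. K - i"]) auto
    finally show ?thesis using q_def[OF that] by simp
  qed
  have degq: "degree (q n) = n" "q n \<noteq> 0" if "n \<ge> K" for n
  proof -
    show "degree (q n) = n" using that degree_laguerre_lift[OF P0] degP by (simp add: q)
    then show "q n \<noteq> 0" using that assms(1) by auto
  qed
  define M where "M = proots P"
  obtain R where R: "P = (\<Prod>r\<in>#M. [:-r, 1:]) * R"
    using linear_factors_times_rootfree[OF P0] unfolding M_def by blast
  have sizeM: "K = size M + Nnr"
    using degree_eq_real_plus_nonreal[OF P0] degP by (simp add: M_def Nnr)
  define \<beta> where "\<beta> = \<alpha> - real (size M)"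
  have \<beta>: "\<beta> \<ge> -1" using \<alpha> sizeM by (simp add: \<beta>_def)
  have \<alpha>': "\<alpha> \<ge> -1" using \<alpha> sizeM by simp
  have shift: "n - K + size M = n - Nnr" if "n \<ge> K" for n using that sizeM by simp
  \<comment> \<open>After all real zeros of P have been split off, the parameter is \<beta> \<ge> -1.\<close>
  have base: "zeros_in {0..} (n - Nnr) (laguerre_lift (n - K + size M) (\<alpha> - real (size M)) S)" if "n \<ge> K" for n S
    using zeros_in_laguerre_lift[OF \<beta>] shift[OF that] by (simp add: \<beta>_def)
  have base': "zeros_in UNIV (n - Nnr) (laguerre_lift (n - K + size M) (\<alpha> - real (size M)) S)" if "n \<ge> K" for n S
    using base[OF that] by (rule zeros_in_mono) simp
  \<comment> \<open>A member of the pencil is a combination of the same kind, for (x + b) P instead of P.\<close>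
  have pencil: "q (Suc n) + smult b (q n) = laguerre_lift (n - K) \<alpha> ((\<Prod>r\<in>#M. [:-r, 1:]) * ([:b, 1:] * R))"
    if "n \<ge> K" for n b
  proof -
    have "q (Suc n) + smult b (q n) = laguerre_lift (n - K) \<alpha> ([:b, 1:] * P)"
      using that by (simp add: laguerre_lift_linear_times q Suc_diff_le del: mult_pCons_left)
    also have "[:b, 1:] * P = (\<Prod>r\<in>#M. [:-r, 1:]) * ([:b, 1:] * R)"
      by (simp only: R mult_ac)
    finally show ?thesis .
  qed
  have many: "zeros_in UNIV (n - Nnr) (q (Suc n) + smult b (q n))" if "n \<ge> K" for n b
    unfolding pencil[OF that] by (rule laguerre_lift_linear_factors_zeros) (rule base'[OF that])
  have q_R: "q n = laguerre_lift (n - K) \<alpha> ((\<Prod>r\<in>#M. [:-r, 1:]) * R)" if "n \<ge> K" for n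
    using q[OF that] by (simp only: R[symmetric])
  have many1: "zeros_in UNIV (n - Nnr) (q n)" if "n \<ge> K" for n
    unfolding q_R[OF that] by (rule laguerre_lift_linear_factors_zeros) (rule base'[OF that])
  have many0: "zeros_in {0..} (n - Nnr - N1) (q n)" if "n \<ge> K" for n
    unfolding q_R[OF that] N1 num_zeros_gt_one_def M_def[symmetric]
    by (rule laguerre_lift_linear_factors_zeros_nonneg) (rule base[OF that])
  have degpencil: "degree (q (Suc n) + smult b (q n)) = Suc n" "q (Suc n) + smult b (q n) \<noteq> 0" if "n \<ge> K" for n b
  proof -
    show "degree (q (Suc n) + smult b (q n)) = Suc n"
      using degq(1)[of n] degq(1)[of "Suc n"] that degree_smult_le[of b "q n"] by (subst degree_add_eq_left) auto
    then show "q (Suc n) + smult b (q n) \<noteq> 0" by auto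
  qed
  have simple: "has_simple_real_zeros (q n) (n - Nnr)" if "n \<ge> K" "Nnr \<le> num_nonreal_zeros (q n)" for n
    using has_simple_real_zerosI[OF degq(2)[OF that(1)] many1[OF that(1)]]
      size_proots_le_if_nonreal[OF degq(2)[OF that(1)] that(2)] degq(1)[OF that(1)] by simp
  have interlace: "interlaces (real_zeros (q (Suc n))) (real_zeros (q n))"
    if n: "n \<ge> K" and nr: "Nnr \<le> num_nonreal_zeros (q n)"
      "\<And>b. Nnr \<le> num_nonreal_zeros (q (Suc n) + smult b (q n))" for n
  proof (rule pencil_interlaces)
    have Nn: "Suc n - Nnr = Suc (n - Nnr)" using n sizeM by simp
    show "degree (q (Suc n)) = Suc (degree (q n))" using degq(1) n by simp
    show "has_simple_real_zeros (q (Suc n)) (Suc (n - Nnr))"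
      using simple[of "Suc n"] nr(2)[of 0] n Nn by simp
    show "has_simple_real_zeros (q n) (n - Nnr)" using simple n nr(1) by simp
    show "zeros_in UNIV (n - Nnr) (q (Suc n) + smult b (q n))" for b by (rule many[OF n])
    show "size (proots (q (Suc n) + smult b (q n))) \<le> Suc (n - Nnr)" for b
      using size_proots_le_if_nonreal[OF degpencil(2)[OF n] nr(2)] degpencil(1)[OF n] Nn by simp
  qed
  have negative: "card {x \<in> real_zeros (q n). x < 0} = N1"
    if n: "n \<ge> K" and nr: "Nnr \<le> num_nonreal_zeros (q n)"
      and off: "Nnr + N1 \<le> size (filter_mset (\<lambda>x. x \<notin> of_real ` {0..}) (proots (cpoly (q n))))" for n
  proof -
    let ?Z = "real_zeros (q n)"
    have fin: "finite ?Z" unfolding real_zeros_def by (rule poly_roots_finite[OF degq(2)[OF n]])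
    have "?Z = {x \<in> ?Z. x < 0} \<union> {x \<in> ?Z. 0 \<le> x}" by auto
    then have "card ?Z = card {x \<in> ?Z. x < 0} + card {x \<in> ?Z. 0 \<le> x}"
      using fin by (subst card_Un_disjoint[symmetric]) auto
    moreover have "card ?Z = n - Nnr" using simple[OF n nr] by (simp add: has_simple_real_zeros_def)
    moreover have "n - Nnr - N1 \<le> card {x \<in> ?Z. 0 \<le> x}"
      using card_zeros_ge[OF many0[OF n] degq(2)[OF n]] by (simp add: real_zeros_def conj_commute)
    moreover have "card {x \<in> ?Z. 0 \<le> x} + (Nnr + N1) \<le> n"
    proof -
      let ?M = "proots (cpoly (q n))" and ?C = "complex_of_real ` {0..}"
      have "size (filter_mset (\<lambda>x. x \<in> ?C) ?M) + size (filter_mset (\<lambda>x. x \<notin> ?C) ?M) = size ?M"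
        by (metis multiset_partition size_union)
      also have "\<dots> = n" using degq(1)[OF n] by (simp add: size_proots_complex degree_cpoly)
      finally have "size (filter_mset (\<lambda>x. x \<in> ?C) ?M) + (Nnr + N1) \<le> n" using off by linarith
      moreover have "set_mset (filter_mset (\<lambda>x. x \<in> ?C) ?M) = of_real ` {x \<in> ?Z. 0 \<le> x}"
        using degq(2)[OF n] by (auto simp: real_zeros_def cpoly_eq_0_iff poly_cpoly)
      then have "card {x \<in> ?Z. 0 \<le> x} \<le> size (filter_mset (\<lambda>x. x \<in> ?C) ?M)"
        using card_set_mset_le_size[of "filter_mset (\<lambda>x. x \<in> ?C) ?M"] by (simp add: card_image inj_on_def)
      ultimately show ?thesis by linarith
    qed
    ultimately show ?thesis by linarith
  qed
  have off: "\<forall>\<^sub>F n in sequentially. Nnr + N1 \<le> size (filter_mset (\<lambda>x. x \<notin> of_real ` {0..}) (proots (cpoly (q n))))"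
    using zeros_off_half_line_persist[OF \<alpha>' P0 degP out] eventually_ge_at_top[of K]
    by eventually_elim (auto simp: q Nnr N1)
  show ?thesis
  proof (intro conjI impI allI ballI)
    fix n assume m: "Nnr = 0" and n: "K \<le> n"
    show "has_simple_real_zeros (q n) n" using simple[OF n] m by simp
    show "interlaces (real_zeros (q (Suc n))) (real_zeros (q n))" using interlace[OF n] m by simp
  next
    fix n x assume m: "Nnr = 0" and N10: "N1 = 0" and n: "K \<le> n" and x: "x \<in> real_zeros (q n)"
    \<comment> \<open>All of the n real zeros of q n lie in any set that contains n zeros.\<close>
    have all: "x \<in> S" if "zeros_in S n (q n)" for S
    proof -
      have fin: "finite (real_zeros (q n))" unfolding real_zeros_def by (rule poly_roots_finite[OF degq(2)[OF n]])
      have "n \<le> card {x \<in> S. poly (q n) x = 0}" by (rule card_zeros_ge[OF that degq(2)[OF n]])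
      moreover have "card (real_zeros (q n)) = n" using simple[OF n] m by (simp add: has_simple_real_zeros_def)
      moreover have sub: "{x \<in> S. poly (q n) x = 0} \<subseteq> real_zeros (q n)" by (auto simp: real_zeros_def)
      ultimately have "{x \<in> S. poly (q n) x = 0} = real_zeros (q n)"
        using fin by (intro card_seteq) auto
      then show ?thesis using x by auto
    qed
    have x0: "x \<ge> 0" using all[OF many0[OF n, unfolded m N10 diff_zero]] by simp
    have le1: "\<forall>r\<in>#M. r \<le> 1"
      using N1 N10 by (auto simp: num_zeros_gt_one_def M_def[symmetric] filter_mset_eq_conv not_less)
    have base0: "zeros_in {0..} n (laguerre_lift (n - K + size M) (\<alpha> - real (size M)) R)"
      using base[OF n] m by simp
    \<comment> \<open>The zero x = 0 occurs only if no factor of P pushes the zeros away from the origin; then q n is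
      the Laguerre polynomial with parameter -1.\<close>
    show "x > 0 \<or> (x = 0 \<and> \<alpha> = real K - 1 \<and> P = [:-1, 1:] ^ K)"
    proof (cases "\<beta> > -1 \<or> (\<exists>r\<in>#M. r < 1)")
      case True
      have "zeros_in {0<..} n (laguerre_lift (n - K + size M) (\<alpha> - real (size M)) R)" if "\<beta> > -1"
        using zeros_in_laguerre_lift_pos[OF that, of "n - K + size M" R] shift[OF n] m by (simp add: \<beta>_def)
      then have "zeros_in {0<..} n (laguerre_lift (n - K) \<alpha> ((\<Prod>r\<in>#M. [:-r, 1:]) * R))"
        using True by (intro laguerre_lift_linear_factors_zeros_pos[OF le1 base0]) blast
      then show ?thesis using all[of "{0<..}"] q_R[OF n] by simp
    next
      case False
      then have "\<beta> = -1" "\<forall>r\<in>#M. r = 1" using \<beta> le1 by force+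
      moreover have KM: "size M = K" using sizeM m by simp
      ultimately have \<alpha>1: "\<alpha> = real K - 1" and Meq: "M = replicate_mset K 1"
        using set_mset_subset_singletonD[of M 1] by (auto simp: \<beta>_def)
      have prod: "(\<Prod>r\<in>#M. [:-r, 1:]) = [:-1, 1:] ^ K" by (simp add: Meq)
      have R0: "R \<noteq> 0" using R P0 by auto
      have "degree R = 0"
        using degree_mult_eq[OF degree_linear_factors(2)[of M] R0] degree_linear_factors(1)[of M] R degP KM by simp
      then obtain c where c: "R = [:c:]" by (rule degree_eq_zeroE)
      have "lead_coeff P = c" unfolding R prod c by (simp add: lead_coeff_mult lead_coeff_power)
      then have "R = 1" using cPK degP c by (simp add: one_pCons)
      then have "P = [:-1, 1:] ^ K" using R prod by simp
      then show ?thesis using x0 \<alpha>1 by auto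
    qed
  next
    assume m: "Nnr = 0"
    show "\<forall>\<^sub>F n in sequentially. card {x \<in> real_zeros (q n). x < 0} = N1"
      using off eventually_ge_at_top[of K] by eventually_elim (use negative m in auto)
  next
    have "\<forall>\<^sub>F N in sequentially. \<forall>s t. max \<bar>s\<bar> \<bar>t\<bar> = 1 \<longrightarrow>
        Nnr \<le> num_nonreal_zeros (smult s (laguerre_lift (N - K) \<alpha> P) + smult t (laguerre_lift (N - Suc K) \<alpha> P))"
      unfolding Nnr by (rule nonreal_zeros_persist[OF \<alpha>' P0 degP out])
    \<comment> \<open>The scale is N = n + 1, the larger degree in the pencil.\<close>
    then have "\<forall>\<^sub>F n in sequentially. \<forall>s t. max \<bar>s\<bar> \<bar>t\<bar> = 1 \<longrightarrow>
        Nnr \<le> num_nonreal_zeros (smult s (laguerre_lift (Suc n - K) \<alpha> P) + smult t (laguerre_lift (Suc n - Suc K) \<alpha> P))"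
      by (rule eventually_compose_filterlim[OF _ filterlim_Suc])
    then show "\<forall>\<^sub>F n in sequentially. has_simple_real_zeros (q n) (n - Nnr) \<and>
           card {x \<in> real_zeros (q n). x < 0} = N1 \<and>
           interlaces (real_zeros (q (Suc n))) (real_zeros (q n))"
      using off eventually_ge_at_top[of K]
    proof eventually_elim
      case (elim n)
      have nr: "Nnr \<le> num_nonreal_zeros (smult s (q (Suc n)) + smult t (q n))" if "max \<bar>s\<bar> \<bar>t\<bar> = 1" for s t
        using elim that by (simp add: q)
      have nr1: "Nnr \<le> num_nonreal_zeros (q n)" using nr[of 0 1] by simp
      have nrb: "Nnr \<le> num_nonreal_zeros (q (Suc n) + smult b (q n))" for b
      proof -
        \<comment> \<open>Normalise the pair (1, b).\<close>
        define m where "m = max 1 \<bar>b\<bar>"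
        have m: "m > 0" by (simp add: m_def)
        have "max \<bar>1 / m\<bar> \<bar>b / m\<bar> = 1" using m by (auto simp: m_def max_def field_simps)
        then have "Nnr \<le> num_nonreal_zeros (smult (1 / m) (q (Suc n)) + smult (b / m) (q n))" by (rule nr)
        also have "smult (1 / m) (q (Suc n)) + smult (b / m) (q n) = smult (1 / m) (q (Suc n) + smult b (q n))"
          by (simp add: smult_add_right)
        finally show ?thesis using m by (simp add: num_nonreal_zeros_smult)
      qed
      show ?case using simple[of n] negative[of n] interlace[of n] nr1 nrb elim by blast
    qed
  qed
qed

end
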